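(* Suppose there is a prime $p$ such that $\overline{\mathcal{R}}_p(A_1,\ldots,A_n)=\mathcal{V}_p(A_1,\ldots,A_n)^{O(1)}$ for all finite $A_1,\ldots,A_n\subset\mathbb{Z}^n$; that is, there is a constant $c>0$ such that $\overline{\mathcal{R}}_p(A_1,\ldots,A_n)\le\mathcal{V}_p(A_1,\ldots,A_n)^{c}$ for all $n\ge 1$ and all finite $A_1,\ldots,A_n\subset\mathbb{Z}^n$. Then the permanent of $n\times n$ matrices cannot be computed by constant-free, division-free arithmetic circuits of size $n^{O(1)}$.
   Context: $\mathbb{C}_p$ is the completion of the algebraic closure of $\mathbb{Q}_p$, and $\mathrm{ord}_p$ is the $p$-adic valuation extended to $\mathbb{C}_p$ with $\mathrm{ord}_p(p)=1$; for vectors, $\mathrm{ord}_p(x_1,\ldots,x_n):=(\mathrm{ord}_p x_1,\ldots,\mathrm{ord}_p x_n)$. $\mathrm{Supp}(f)$ is the set of exponent vectors of the monomial terms of $f$. For $F=(f_1,\ldots,f_n)$ and $R\in\{\mathbb{Q}_p,\mathbb{C}_p\}$, $Z^*_{R}(F)$ is the set of common roots of $f_1,\ldots,f_n$ in $(R\setminus\{0\})^n$. $F=(f_1,\ldots,f_n)$ is tropically generic (over $\mathbb{C}_p$) iff the closures in $\mathbb{R}^n$ of $\mathrm{ord}_p(Z^*_{\mathbb{C}_p}(f_1)),\ldots,\mathrm{ord}_p(Z^*_{\mathbb{C}_p}(f_n))$ (which are polyhedral complexes of codimension $1$) intersect transversally; in the standard sense, every common point lies, for each $i$, in the relative interior of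 an $(n-1)$-dimensional cell of the $i$-th complex, and these $n$ cells have linearly independent normal vectors. For finite $A_1,\ldots,A_n\subset\mathbb{Z}^n$ consider all $F=(f_1,\ldots,f_n)$ with $f_i\in\mathbb{C}_p[x_1^{\pm1},\ldots,x_n^{\pm1}]$, $\mathrm{Supp}(f_i)\subseteq A_i$ for all $i$, and $Z^*_{\mathbb{C}_p}(F)$ finite. Then $\overline{\mathcal{R}}_p(A_1,\ldots,A_n)$ is the maximum of $\#\mathrm{ord}_p(Z^*_{\mathbb{Q}_p}(F))$ over all such $F$, and $\mathcal{V}_p(A_1,\ldots,A_n)$ is the maximum of $\#\mathrm{ord}_p(Z^*_{\mathbb{C}_p}(F))$ over those such $F$ that are tropically generic. A constant-free, division-free arithmetic circuit is a circuit whose inputs are variables and the constant $1$, and whose gates are additions, subtractions and multiplications of two previously computed quantities; its size is its number of gates. The permanent of $n\times n$ matrices is the polynomial $\sum_{\sigma\in S_n}\prod_{i=1}^n x_{i,\sigma(i)}$. "Cannot be computed by circuits of size $n^{O(1)}$" means: there is no polynomial $q$ such that for every $n$ there is a constant-free, division-free arithmetic circuit of size at most $q(n)$ computing the $n\times n$ permanent. *)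

theory Defs
  imports
    "HOL-Analysis.Analysis"
    "HOL-Library.Poly_Mapping"
    "HOL-Computational_Algebra.Computational_Algebra"
    "HOL-Combinatorics.Permutations"
begin

section \<open>The field of complex p-adic numbers\<close>

text \<open>
  The libraries contain neither the field of p-adic numbers nor its algebraic closure, so the
  completion of the algebraic closure of the p-adic numbers is given by its definition, which
  determines it up to isometric isomorphism: a type together with its valuation.  The value of
  the valuation at 0 (conventionally infinity) is left unspecified and is never used.
\<close>

text \<open>The completion of the rationals, taken inside a complete field.\<close>

definition Qp :: "'k::{field_char_0, metric_space} set" where
  "Qp = closure (range of_rat)"

definition algebraic_over :: "'k::field set \<Rightarrow> 'k set" where
  "algebraic_over L = {x. \<exists>f. f \<noteq> 0 \<and> (\<forall>i. coeff f i \<in> L) \<and> poly f x = 0}"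

definition algebraically_closed_in :: "'k::field set \<Rightarrow> bool" where
  "algebraically_closed_in L \<longleftrightarrow>
     (\<forall>f. 0 < degree f \<and> (\<forall>i. coeff f i \<in> L) \<longrightarrow> (\<exists>x\<in>L. poly f x = 0))"

text \<open>
  Completeness is part of the sort of the type.  The last two assumptions say that the elements
  algebraic over the p-adic numbers form an algebraic closure of them, and that this algebraic
  closure is dense.  On the rationals, the valuation is forced to be the p-adic one by the
  first three assumptions.
\<close>

locale complex_padic_field =
  fixes p :: nat and ord :: "'k::{field_char_0, complete_space} \<Rightarrow> real"
  assumes ord_p: "ord (of_nat p) = 1"
    and ord_mult: "\<And>x y. x \<noteq> 0 \<Longrightarrow> y \<noteq> 0 \<Longrightarrow> ord (x * y) = ord x + ord y"
    and ord_add: "\<And>x y. x \<noteq> 0 \<Longrightarrow> y \<noteq> 0 \<Longrightarrow> x + y \<noteq> 0 \<Longrightarrow> min (ord x) (ord y) \<le> ord (x + y)"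
    and dist_ord: "\<And>x y. x \<noteq> y \<Longrightarrow> dist x y = real p powr (- ord (x - y))"
    and algebraic_closure: "algebraically_closed_in (algebraic_over (Qp :: 'k set))"
    and dense: "closure (algebraic_over (Qp :: 'k set)) = UNIV"

section \<open>Laurent polynomials and their zeros in the torus\<close>

text \<open>
  Exponent vectors are finitely supported integer sequences; those of Laurent polynomials in
  \<open>n\<close> variables vanish from index \<open>n\<close> on.  The support of a Laurent polynomial
  is its set of \<open>keys\<close>.  Points with \<open>n\<close> coordinates are functions on
  \<open>{..<n}\<close>, extensional in the sense of \<open>PiE\<close>.
\<close>

type_synonym 'k laurent = "(nat \<Rightarrow>\<^sub>0 int) \<Rightarrow>\<^sub>0 'k"

definition exponents :: "nat \<Rightarrow> (nat \<Rightarrow>\<^sub>0 int) set" where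
  "exponents n = {a. Poly_Mapping.keys a \<subseteq> {..<n}}"

definition laurent_eval :: "nat \<Rightarrow> 'k::field laurent \<Rightarrow> (nat \<Rightarrow> 'k) \<Rightarrow> 'k" where
  "laurent_eval n f x = 
     (\<Sum>a\<in>Poly_Mapping.keys f. Poly_Mapping.lookup f a * (\<Prod>i<n. x i powi Poly_Mapping.lookup a i))"

text \<open>The common zeros of the Laurent polynomials in \<open>S\<close> with coordinates in \<open>R\<close>.\<close>

definition torus_zeros :: "nat \<Rightarrow> 'k::field set \<Rightarrow> 'k laurent set \<Rightarrow> (nat \<Rightarrow> 'k) set" where
  "torus_zeros n R S = {x \<in> {..<n} \<rightarrow>\<^sub>E (R - {0}). \<forall>f\<in>S. laurent_eval n f x = 0}"

definition ord_vec :: "nat \<Rightarrow> ('k \<Rightarrow> real) \<Rightarrow> (nat \<Rightarrow> 'k) \<Rightarrow> nat \<Rightarrow> real" where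
  "ord_vec n ord x = (\<lambda>i\<in>{..<n}. ord (x i))"

section \<open>Polyhedral complexes in n-dimensional space\<close>

text \<open>
  The dimension is quantified inside the final statement, so it cannot be a type.  The closed set
  \<open>euclid n\<close> with the product topology is homeomorphic to Euclidean
  \<open>n\<close>-space.
\<close>

definition euclid :: "nat \<Rightarrow> (nat \<Rightarrow> real) set" where
  "euclid n = {..<n} \<rightarrow>\<^sub>E UNIV"

definition dot :: "nat \<Rightarrow> (nat \<Rightarrow> real) \<Rightarrow> (nat \<Rightarrow> real) \<Rightarrow> real" where
  "dot n u w = (\<Sum>i<n. u i * w i)"

definition polyhedron_in :: "nat \<Rightarrow> (nat \<Rightarrow> real) set \<Rightarrow> bool" where
  "polyhedron_in n P \<longleftrightarrow>
     (\<exists>H. finite H \<and> P = {w \<in> euclid n. \<forall>(u, b)\<in>H. dot n u w \<le> b})"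

definition face_in :: "nat \<Rightarrow> (nat \<Rightarrow> real) set \<Rightarrow> (nat \<Rightarrow> real) set \<Rightarrow> bool" where
  "face_in n Q P \<longleftrightarrow>
     (\<exists>u b. (\<forall>w\<in>P. dot n u w \<le> b) \<and> Q = {w \<in> P. dot n u w = b})"

definition polyhedral_complex :: "nat \<Rightarrow> (nat \<Rightarrow> real) set set \<Rightarrow> bool" where
  "polyhedral_complex n C \<longleftrightarrow>
     finite C \<and>
     (\<forall>P\<in>C. polyhedron_in n P \<and> P \<noteq> {}) \<and>
     (\<forall>P\<in>C. \<forall>Q. face_in n Q P \<and> Q \<noteq> {} \<longrightarrow> Q \<in> C) \<and>
     (\<forall>P\<in>C. \<forall>Q\<in>C. P \<inter> Q \<noteq> {} \<longrightarrow> face_in n (P \<inter> Q) P \<and> face_in n (P \<inter> Q) Q)"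

definition nonzero_vec :: "nat \<Rightarrow> (nat \<Rightarrow> real) \<Rightarrow> bool" where
  "nonzero_vec n u \<longleftrightarrow> (\<exists>i<n. u i \<noteq> 0)"

text \<open>Every cell has dimension at most \<open>n - 1\<close>.\<close>

definition positive_codim :: "nat \<Rightarrow> (nat \<Rightarrow> real) set set \<Rightarrow> bool" where
  "positive_codim n C \<longleftrightarrow>
     (\<forall>P\<in>C. \<exists>u b. nonzero_vec n u \<and> (\<forall>w\<in>P. dot n u w = b))"

text \<open>
  \<open>P\<close> is \<open>(n - 1)\<close>-dimensional with normal vector \<open>u\<close>, and \<open>w\<close> is in its
  relative interior: the affine hull of \<open>P\<close> is the hyperplane through
  \<open>w\<close> orthogonal to \<open>u\<close>, and \<open>P\<close> contains a neighbourhood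
  of \<open>w\<close> in it.
\<close>

definition rel_interior_hyper ::
  "nat \<Rightarrow> (nat \<Rightarrow> real) set \<Rightarrow> (nat \<Rightarrow> real) \<Rightarrow> (nat \<Rightarrow> real) \<Rightarrow> bool" where
  "rel_interior_hyper n P u w \<longleftrightarrow>
     nonzero_vec n u \<and> w \<in> P \<and> (\<forall>v\<in>P. dot n u v = dot n u w) \<and>
     (\<exists>e>0. \<forall>v\<in>euclid n. dot n u v = dot n u w \<and> (\<forall>i<n. \<bar>v i - w i\<bar> < e) \<longrightarrow> v \<in> P)"

definition lin_independent :: "nat \<Rightarrow> (nat \<Rightarrow> nat \<Rightarrow> real) \<Rightarrow> bool" where
  "lin_independent n u \<longleftrightarrow>
     (\<forall>c :: nat \<Rightarrow> real. (\<forall>j<n. (\<Sum>i<n. c i * u i j) = 0) \<longrightarrow> (\<forall>i<n. c i = 0))"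

section \<open>Tropical genericity\<close>

definition tropical_set ::
  "nat \<Rightarrow> ('k::field \<Rightarrow> real) \<Rightarrow> 'k laurent \<Rightarrow> (nat \<Rightarrow> real) set" where
  "tropical_set n ord f = closure (ord_vec n ord ` torus_zeros n UNIV {f})"

text \<open>
  No particular subdivision of the tropical sets into cells is singled out.  This does not matter:
  a point lies in the relative interior of an \<open>(n - 1)\<close>-dimensional cell, with a given normal
  direction, for some subdivision if and only if it does for the coarsest one.  If some
  \<open>f i\<close> is 0, then its tropical set is the whole space and the condition
  on the codimension makes \<open>f\<close> non-generic.
\<close>

definition tropically_generic ::
  "nat \<Rightarrow> ('k::field \<Rightarrow> real) \<Rightarrow> (nat \<Rightarrow> 'k laurent) \<Rightarrow> bool" where
  "tropically_generic n ord f \<longleftrightarrow>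
     (\<exists>C. (\<forall>i<n. polyhedral_complex n (C i) \<and> positive_codim n (C i) \<and>
                 \<Union> (C i) = tropical_set n ord (f i)) \<and>
          (\<forall>w\<in>euclid n. (\<forall>i<n. w \<in> tropical_set n ord (f i)) \<longrightarrow>
             (\<exists>P u. (\<forall>i<n. P i \<in> C i \<and> rel_interior_hyper n (P i) (u i) w) \<and>
                    lin_independent n u)))"

section \<open>Maximal numbers of valuation vectors\<close>

text \<open>
  All systems with the given supports and finitely many zeros over the whole field.  The
  numbers of zeros of such systems are bounded (Bernstein--Kushnirenko), so the suprema
  below are maxima; the supremum of the empty set of natural numbers is 0.
\<close>

definition finite_systems ::
  "nat \<Rightarrow> (nat \<Rightarrow> (nat \<Rightarrow>\<^sub>0 int) set) \<Rightarrow> (nat \<Rightarrow> 'k::field laurent) set" where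
  "finite_systems n A =
     {f. (\<forall>i<n. Poly_Mapping.keys (f i) \<subseteq> A i) \<and> finite (torus_zeros n UNIV (f ` {..<n}))}"

definition max_vals_Qp ::
  "nat \<Rightarrow> ('k::{field_char_0, metric_space} \<Rightarrow> real) \<Rightarrow> (nat \<Rightarrow> (nat \<Rightarrow>\<^sub>0 int) set) \<Rightarrow> nat" where
  "max_vals_Qp n ord A =
     (SUP f \<in> finite_systems n A. card (ord_vec n ord ` torus_zeros n Qp (f ` {..<n})))"

definition max_vals_generic ::
  "nat \<Rightarrow> ('k::field \<Rightarrow> real) \<Rightarrow> (nat \<Rightarrow> (nat \<Rightarrow>\<^sub>0 int) set) \<Rightarrow> nat" where
  "max_vals_generic n ord A =
     (SUP f \<in> {f \<in> finite_systems n A. tropically_generic n ord f}.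
        card (ord_vec n ord ` torus_zeros n UNIV (f ` {..<n})))"

section \<open>Constant-free, division-free arithmetic circuits\<close>

type_synonym 'v int_mpoly = "('v \<Rightarrow>\<^sub>0 nat) \<Rightarrow>\<^sub>0 int"

definition mvar :: "'v \<Rightarrow> 'v int_mpoly" where
  "mvar v = Poly_Mapping.single (Poly_Mapping.single v 1) 1"

datatype 'v operand = Input 'v | One | Gate nat

datatype 'v gate =
    Add "'v operand" "'v operand"
  | Sub "'v operand" "'v operand"
  | Mult "'v operand" "'v operand"

text \<open>
  A circuit consists of its gates, in the order of computation, and of its output.
  \<open>Gate j\<close> refers to the result of the gate number \<open>j\<close>.
\<close>

type_synonym 'v circuit = "'v gate list \<times> 'v operand"

fun operand_ok :: "nat \<Rightarrow> 'v operand \<Rightarrow> bool" where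
  "operand_ok k (Input v) = True"
| "operand_ok k One = True"
| "operand_ok k (Gate j) = (j < k)"

fun gate_ok :: "nat \<Rightarrow> 'v gate \<Rightarrow> bool" where
  "gate_ok k (Add a b) = (operand_ok k a \<and> operand_ok k b)"
| "gate_ok k (Sub a b) = (operand_ok k a \<and> operand_ok k b)"
| "gate_ok k (Mult a b) = (operand_ok k a \<and> operand_ok k b)"

definition circuit_ok :: "'v circuit \<Rightarrow> bool" where
  "circuit_ok c \<longleftrightarrow>
     (\<forall>k<length (fst c). gate_ok k (fst c ! k)) \<and> operand_ok (length (fst c)) (snd c)"

definition circuit_size :: "'v circuit \<Rightarrow> nat" where
  "circuit_size c = length (fst c)"

fun operand_poly :: "'v int_mpoly list \<Rightarrow> 'v operand \<Rightarrow> 'v int_mpoly" where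
  "operand_poly qs (Input v) = mvar v"
| "operand_poly qs One = 1"
| "operand_poly qs (Gate j) = qs ! j"

fun gate_poly :: "'v int_mpoly list \<Rightarrow> 'v gate \<Rightarrow> 'v int_mpoly" where
  "gate_poly qs (Add a b) = operand_poly qs a + operand_poly qs b"
| "gate_poly qs (Sub a b) = operand_poly qs a - operand_poly qs b"
| "gate_poly qs (Mult a b) = operand_poly qs a * operand_poly qs b"

definition circuit_poly :: "'v circuit \<Rightarrow> 'v int_mpoly" where
  "circuit_poly c = operand_poly (foldl (\<lambda>qs g. qs @ [gate_poly qs g]) [] (fst c)) (snd c)"

definition computes :: "'v circuit \<Rightarrow> 'v int_mpoly \<Rightarrow> bool" where
  "computes c f \<longleftrightarrow> circuit_ok c \<and> circuit_poly c = f"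

definition permanent_poly :: "nat \<Rightarrow> (nat \<times> nat) int_mpoly" where
  "permanent_poly n = (\<Sum>\<sigma> | \<sigma> permutes {1..n}. \<Prod>i=1..n. mvar (i, \<sigma> i))"

definition permanent_poly_size_circuits :: bool where
  "permanent_poly_size_circuits \<longleftrightarrow>
     (\<exists>q :: real poly. \<forall>n\<ge>1. \<exists>c.
        computes c (permanent_poly n) \<and> real (circuit_size c) \<le> poly q (real n))"

end

theory Submission
  imports Defs "HOL-Real_Asymp.Real_Asymp"
begin

text \<open>
  Suppose that permanents have circuits of polynomial size.  The proof exhibits supports for which the
  number of valuation vectors of \<open>p\<close>-adic zeros grows much faster than any power of the number of
  valuation vectors of a generic system.

  The polynomial \<open>f = (\<Sum>i<2 ^ \<nu>. p ^ i\<^sup>2 * x ^ i)\<close> has a strictly convex Newton polygon, and each of the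
  \<open>2 ^ \<nu> - 1\<close> slopes is, up to sign, the valuation of a root in \<open>Qp\<close> (\<open>quadratic_root\<close>, by a contraction).
  Squaring \<open>i = (\<Sum>j\<in>S. 2 ^ j)\<close> turns \<open>p ^ i\<^sup>2 * x ^ i\<close> into a product of weights over the elements of
  \<open>S\<close> and over the pairs of elements of \<open>S\<close>, and a sum of such products over all subsets \<open>S\<close> of
  \<open>{..<\<nu>}\<close> is the permanent of an explicit matrix of size at most \<open>2 * \<nu>\<^sup>2\<close> (\<open>per_subsets\<close>).  So \<open>f\<close>
  would have circuits of size polynomial in \<open>\<nu>\<close>, and these can be balanced: separating the values of
  the gates by their degree in the entries, and doubling the degree at each step, gives a formula whose
  depth \<open>\<Delta>\<close> is of the order of \<open>(log \<nu>) ^ 3\<close> (\<open>permanent_formula\<close>).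

  A formula of depth \<open>\<Delta>\<close> is a system of \<open>2 ^ \<Delta>\<close> equations in as many unknowns: each node of a binary
  tree has an unknown and an equation that expresses it as a bilinear function of its children, the
  leaves being powers of the unknown \<open>x\<close>, and a last equation sets the root to 0.  The zeros of the
  system correspond to the roots of \<open>f\<close>, hence its \<open>p\<close>-adic zeros have at least \<open>2 ^ \<nu> - 1\<close> valuation
  vectors (\<open>many_valuations\<close>).

  On the other hand, a generic system with the same support has at most \<open>2 * 2050 ^ \<Delta>\<close> valuation vectors
  (\<open>generic_bound\<close>), independently of the exponents at the leaves.  At such a vector two terms of each
  equation have the same minimal valuation, and transversality says that the linear equations given by
  these pairs of terms are independent.  The key fact is a classification of the solutions of bilinear
  systems on a tree (\<open>classification\<close>, \<open>isolated_cases\<close>): an isolated solution either has each value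
  determined by \<open>x\<close>, or \<open>x\<close> is determined by an equation between two such values at a single node and the
  remaining values are determined along the path from there to the root.  Applied to the independent
  linear equations, it shows that the valuation of \<open>x\<close> is a breakpoint of a piecewise affine function or
  a point where such a function crosses a given level, and these are few (\<open>card_tropical_solutions\<close>).  Applied to the system itself, it bounds the number of zeros
  of every system with finitely many of them (\<open>bounded_zeros\<close>), so that the suprema of numbers of valuation
  vectors are not degenerate.

  For \<open>\<nu> = 2 ^ r\<close>, the depth \<open>\<Delta>\<close> is at most cubic in \<open>r\<close>, so \<open>2 ^ \<nu> - 1\<close> exceeds
  \<open>(2 * 2050 ^ \<Delta>) powr c\<close> for large \<open>r\<close>.
\<close>

section \<open>Fields with an absolute value\<close>

text \<open>
  Isolated solutions are studied over the \<open>p\<close>-adic field and, for linearised tropical systems, over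
  the reals.  Both are covered by an absolute value, with convergence defined from it; the last
  assumption provides nonzero elements that tend to 0.
\<close>

locale abs_field =
  fixes N :: "'a::field \<Rightarrow> real"
  assumes N_eq_0 [simp]: "N x = 0 \<longleftrightarrow> x = 0"
    and N_nonneg [simp]: "0 \<le> N x"
    and N_mult: "N (x * y) = N x * N y"
    and N_triangle: "N (x + y) \<le> N x + N y"
    and N_nontrivial: "\<exists>x. x \<noteq> 0 \<and> N x < 1"
begin

lemma N_zero [simp]: "N 0 = 0"
  by simp

lemma N_one [simp]: "N 1 = 1"
  using N_mult[of 1 1] N_eq_0[of 1] by auto

lemma N_uminus [simp]: "N (- x) = N x"
proof -
  have "N (-1) * N (-1) = 1"
    using N_mult[of "-1" "-1"] by simp
  moreover have "N (-1) \<ge> 0" by simp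
  ultimately have "N (-1) = 1"
    by (metis abs_of_nonneg abs_square_eq_1 power2_eq_square)
  then show ?thesis using N_mult[of "-1" x] by simp
qed

lemma N_minus_commute: "N (x - y) = N (y - x)"
  using N_uminus[of "x - y"] by simp

lemma N_power: "N (x ^ n) = N x ^ n"
  by (induction n) (auto simp: N_mult)

lemma N_divide: "y \<noteq> 0 \<Longrightarrow> N (x / y) = N x / N y"
  using N_mult[of "x / y" y] by (simp add: field_simps)

definition conv :: "(nat \<Rightarrow> 'a) \<Rightarrow> 'a \<Rightarrow> bool" where
  "conv f a \<longleftrightarrow> (\<lambda>n. N (f n - a)) \<longlonglongrightarrow> 0"

lemma conv_squeeze:
  assumes "\<And>n. N (f n - a) \<le> g n" "g \<longlonglongrightarrow> 0"
  shows "conv f a"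
  unfolding conv_def
  by (rule tendsto_sandwich[OF _ _ tendsto_const assms(2)]) (use assms(1) in auto)

lemma conv_const [simp]: "conv (\<lambda>n. a) a"
  by (simp add: conv_def)

lemma conv_add:
  assumes "conv f a" "conv g b" shows "conv (\<lambda>n. f n + g n) (a + b)"
proof (rule conv_squeeze)
  show "N (f n + g n - (a + b)) \<le> N (f n - a) + N (g n - b)" for n
    using N_triangle[of "f n - a" "g n - b"] by (simp add: algebra_simps)
  show "(\<lambda>n. N (f n - a) + N (g n - b)) \<longlonglongrightarrow> 0"
    using tendsto_add[OF assms[unfolded conv_def]] by simp
qed

lemma conv_uminus: "conv f a \<Longrightarrow> conv (\<lambda>n. - f n) (- a)"
  unfolding conv_def using N_uminus by (metis (no_types, lifting) ext minus_diff_minus)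

lemma conv_diff: "conv f a \<Longrightarrow> conv g b \<Longrightarrow> conv (\<lambda>n. f n - g n) (a - b)"
  using conv_add[OF _ conv_uminus, of f a g b] by simp

lemma conv_mult:
  assumes "conv f a" "conv g b" shows "conv (\<lambda>n. f n * g n) (a * b)"
proof (rule conv_squeeze)
  fix n
  have "f n * g n - a * b = (f n - a) * (g n - b) + (a * (g n - b) + b * (f n - a))"
    by (simp add: algebra_simps)
  also have "N \<dots> \<le> N (f n - a) * N (g n - b) + (N a * N (g n - b) + N b * N (f n - a))"
    by (metis (no_types, opaque_lifting) N_mult N_triangle add_left_mono order_trans)
  finally show "N (f n * g n - a * b)
      \<le> N (f n - a) * N (g n - b) + (N a * N (g n - b) + N b * N (f n - a))" .
next
  have "(\<lambda>n. N (f n - a) * N (g n - b) + (N a * N (g n - b) + N b * N (f n - a)))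
      \<longlonglongrightarrow> 0 * 0 + (N a * 0 + N b * 0)"
    using assms unfolding conv_def by (intro tendsto_intros)
  then show "(\<lambda>n. N (f n - a) * N (g n - b) + (N a * N (g n - b) + N b * N (f n - a))) \<longlonglongrightarrow> 0"
    by simp
qed

lemma conv_eventually_near: "conv f a \<Longrightarrow> e > 0 \<Longrightarrow> \<forall>\<^sub>F n in sequentially. N (f n - a) < e"
  unfolding conv_def by (rule order_tendstoD(2))

lemma N_diff_ge: "N (x - y) \<ge> N y - N x"
  using N_triangle[of "y - x" x] N_minus_commute[of x y] by simp

lemma conv_eventually_ge:
  assumes "conv f a" "a \<noteq> 0"
  shows "\<forall>\<^sub>F n in sequentially. N (f n) > N a / 2"
proof -
  have pos: "N a / 2 > 0"
    using assms(2) N_eq_0[of a] N_nonneg[of a] by (simp del: N_eq_0 N_nonneg)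
  show ?thesis
    using conv_eventually_near[OF assms(1) pos]
  proof eventually_elim
    case (elim n)
    then show ?case using N_diff_ge[where x="f n" and y=a] by simp
  qed
qed

lemma conv_eventually_nonzero:
  assumes "conv f a" "a \<noteq> 0"
  shows "\<forall>\<^sub>F n in sequentially. f n \<noteq> 0"
  using conv_eventually_ge[OF assms]
proof eventually_elim
  case (elim n)
  then show ?case using N_nonneg[of a] by (auto simp del: N_nonneg)
qed

lemma conv_inverse:
  assumes "conv f a" "a \<noteq> 0"
  shows "conv (\<lambda>n. inverse (f n)) (inverse a)"
proof -
  have pos: "N a > 0" using assms(2) N_eq_0[of a] N_nonneg[of a] by (simp del: N_eq_0 N_nonneg)
  have ev: "\<forall>\<^sub>F n in sequentially. N (inverse (f n) - inverse a) \<le> N (f n - a) * (2 / (N a * N a))"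
    using conv_eventually_ge[OF assms]
  proof eventually_elim
    case (elim n)
    then have pos': "N (f n) > 0" "f n \<noteq> 0" using pos N_zero by force+
    have "inverse (f n) - inverse a = (a - f n) / (f n * a)"
      using pos' assms(2) by (simp add: field_simps)
    then have "N (inverse (f n) - inverse a) = N (f n - a) / (N (f n) * N a)"
      using pos' assms(2) by (simp add: N_divide N_mult N_minus_commute)
    also have "\<dots> \<le> N (f n - a) / (N a / 2 * N a)"
      using elim pos pos' by (intro divide_left_mono mult_right_mono) auto
    finally show ?case by (simp add: field_simps)
  qed
  have "(\<lambda>n. N (f n - a) * (2 / (N a * N a))) \<longlonglongrightarrow> 0 * (2 / (N a * N a))"
    using assms(1) unfolding conv_def by (intro tendsto_intros)
  then have "(\<lambda>n. N (f n - a) * (2 / (N a * N a))) \<longlonglongrightarrow> 0" by simp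
  then show ?thesis unfolding conv_def
    by (rule tendsto_sandwich[OF _ ev tendsto_const, rotated]) auto
qed

lemma conv_divide:
  "conv f a \<Longrightarrow> conv g b \<Longrightarrow> b \<noteq> 0 \<Longrightarrow> conv (\<lambda>n. f n / g n) (a / b)"
  using conv_mult[OF _ conv_inverse] by (simp add: divide_inverse)

lemma null_sequence: obtains t where "conv t 0" "\<And>n. t n \<noteq> 0"
proof -
  obtain x where x: "x \<noteq> 0" "N x < 1" using N_nontrivial by blast
  have "(\<lambda>n. N x ^ n) \<longlonglongrightarrow> 0" using x(2) by (intro LIMSEQ_realpow_zero) auto
  then have "conv (\<lambda>n. x ^ n) 0" by (simp add: conv_def N_power)
  then show ?thesis using x(1) by (intro that[of "\<lambda>n. x ^ n"]) auto
qed

lemmas conv_intros = conv_const conv_add conv_diff conv_uminus conv_mult conv_divide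

end

section \<open>Systems of bilinear equations along a binary tree\<close>

text \<open>
  The nodes at distance at most \<open>h\<close> below \<open>k\<close> in heap numbering, where \<open>2 * k\<close> and \<open>2 * k + 1\<close> are
  the children of \<open>k\<close>.  The index 0 lies below no positive node, which leaves it for the unknown on which
  the leaves depend.
\<close>

primrec desc :: "nat \<Rightarrow> nat \<Rightarrow> nat set" where
  "desc 0 k = {k}"
| "desc (Suc h) k = insert k (desc h (2 * k) \<union> desc h (2 * k + 1))"

lemma root_in_desc [simp]: "k \<in> desc h k"
  by (cases h) auto

lemma desc_div: "j \<in> desc h k \<Longrightarrow> \<exists>i\<le>h. j div 2 ^ i = k"
proof (induction h arbitrary: k)
  case 0
  then show ?case by simp
next
  case (Suc h)
  show ?case
  proof (cases "j = k")
    case True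
    then show ?thesis by (intro exI[of _ 0]) auto
  next
    case False
    then obtain i b where "i \<le> h" "j div 2 ^ i = 2 * k + b" "b \<le> 1"
      using Suc by fastforce
    then have "j div 2 ^ Suc i = k" by (simp add: div_mult2_eq mult.commute[of 2])
    then show ?thesis using \<open>i \<le> h\<close> by (intro exI[of _ "Suc i"]) auto
  qed
qed

lemma desc_ge: "j \<in> desc h k \<Longrightarrow> k \<le> j"
  using desc_div by fastforce

lemma zero_notin_desc: "0 < k \<Longrightarrow> 0 \<notin> desc h k"
  using desc_ge by force

lemma root_notin_desc: "0 < k \<Longrightarrow> k \<notin> desc h (2 * k)" "0 < k \<Longrightarrow> k \<notin> desc h (2 * k + 1)"
  using desc_ge by force+

lemma desc_disjoint:
  assumes "0 < k" shows "desc h (2 * k) \<inter> desc h (2 * k + 1) = {}"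
proof (rule ccontr)
  assume "\<not> ?thesis"
  then obtain j where j: "j \<in> desc h (2 * k)" "j \<in> desc h (2 * k + 1)" by blast
  obtain a b where a: "j div 2 ^ a = 2 * k" and b: "j div 2 ^ b = 2 * k + 1"
    using desc_div[OF j(1)] desc_div[OF j(2)] by blast
  show False
  proof (cases "a \<le> b")
    case True
    then have "j div 2 ^ b = j div 2 ^ a div 2 ^ (b - a)"
      by (metis div_mult2_eq le_add_diff_inverse power_add)
    also have "\<dots> \<le> j div 2 ^ a" by simp
    finally show False using a b by simp
  next
    case False
    then obtain d where d: "a = b + Suc d" by (metis add_Suc_right less_imp_Suc_add not_le)
    then have "j div 2 ^ a = j div 2 ^ b div 2 ^ Suc d"
      by (metis div_mult2_eq power_add)
    also have "\<dots> = (2 * k + 1) div 2 div 2 ^ d" using b by (simp add: div_mult2_eq)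
    also have "\<dots> \<le> k" by simp
    finally show False using a assms by simp
  qed
qed

text \<open>
  There is one unknown per node, and one equation per inner node, which involves the node and its two
  children only.  The equations of a subtree are therefore connected with the rest of the system only through
  the value of its root and through the \<open>abscissa\<close>, the unknown of index 0.
\<close>

locale bilinear_tree = abs_field N for N :: "'a::field \<Rightarrow> real" +
  fixes c0 c1 c2 c3 c4 :: "nat \<Rightarrow> 'a" and leaf :: "nat \<Rightarrow> 'a \<Rightarrow> 'a"
  assumes leaf_conv: "conv x a \<Longrightarrow> conv (\<lambda>n. leaf k (x n)) (leaf k a)"
begin

definition form :: "nat \<Rightarrow> 'a \<Rightarrow> 'a \<Rightarrow> 'a" where
  "form k a b = c1 k + c2 k * a + c3 k * b + c4 k * a * b"

primrec sol :: "nat \<Rightarrow> nat \<Rightarrow> (nat \<Rightarrow> 'a) \<Rightarrow> bool" where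
  "sol 0 k z \<longleftrightarrow> z k = leaf k (z 0)"
| "sol (Suc h) k z \<longleftrightarrow> c0 k * z k + form k (z (2 * k)) (z (2 * k + 1)) = 0 \<and>
     sol h (2 * k) z \<and> sol h (2 * k + 1) z"

text \<open>
  Two rigid shapes of the solutions of a subtree, seen in the plane of the abscissa and the value of its
  root: the graph of a function of the abscissa, and a vertical line over an abscissa which is singled out at
  one node by an equation between the graphs of its children.  On a vertical line the path from that node to
  the root must have nonzero slopes, so that values can be transported along it.
\<close>

primrec graph :: "nat \<Rightarrow> nat \<Rightarrow> bool" where
  "graph 0 k \<longleftrightarrow> True"
| "graph (Suc h) k \<longleftrightarrow> c0 k \<noteq> 0 \<and> graph h (2 * k) \<and> graph h (2 * k + 1)"

primrec gval :: "nat \<Rightarrow> nat \<Rightarrow> 'a \<Rightarrow> 'a" where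
  "gval 0 k x = leaf k x"
| "gval (Suc h) k x = - form k (gval h (2 * k) x) (gval h (2 * k + 1) x) / c0 k"

primrec vertical :: "nat \<Rightarrow> nat \<Rightarrow> (nat \<Rightarrow> 'a) \<Rightarrow> bool" where
  "vertical 0 k z \<longleftrightarrow> False"
| "vertical (Suc h) k z \<longleftrightarrow>
     c0 k = 0 \<and> graph h (2 * k) \<and> graph h (2 * k + 1) \<and>
       (\<exists>x. form k (gval h (2 * k) x) (gval h (2 * k + 1) x) \<noteq> 0) \<or>
     vertical h (2 * k) z \<and> graph h (2 * k + 1) \<and> c2 k + c4 k * z (2 * k + 1) \<noteq> 0 \<or>
     graph h (2 * k) \<and> vertical h (2 * k + 1) z \<and> c3 k + c4 k * z (2 * k) \<noteq> 0"

lemma sol_cong: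
  "(\<And>i. i \<in> desc h k \<Longrightarrow> z i = z' i) \<Longrightarrow> z 0 = z' 0 \<Longrightarrow> sol h k z = sol h k z'"
proof (induction h arbitrary: k)
  case (Suc h)
  then have "sol h (2 * k) z = sol h (2 * k) z'" "sol h (2 * k + 1) z = sol h (2 * k + 1) z'"
    by simp_all
  moreover have "z k = z' k" "z (2 * k) = z' (2 * k)" "z (2 * k + 1) = z' (2 * k + 1)"
    using Suc.prems(1) root_in_desc by simp_all
  ultimately show ?case by simp
qed simp

lemma sol_graph: "graph h k \<Longrightarrow> sol h k z \<Longrightarrow> z k = gval h k (z 0)"
  by (induction h arbitrary: k) (auto simp: field_simps eq_neg_iff_add_eq_0)

text \<open>
  Moving a solution is expressed by sequences of solutions that converge to it.  Only almost all members of
  the sequence have to be solutions, as solving an equation for one of its variables is possible only near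
  the limit.
\<close>

definition tracks :: "nat \<Rightarrow> nat \<Rightarrow> (nat \<Rightarrow> 'a) \<Rightarrow> (nat \<Rightarrow> nat \<Rightarrow> 'a) \<Rightarrow> bool" where
  "tracks h k z Z \<longleftrightarrow> (\<forall>\<^sub>F n in sequentially. sol h k (Z n)) \<and>
     (\<forall>i\<in>insert 0 (desc h k). conv (\<lambda>n. Z n i) (z i))"

lemma tracks_const: "sol h k z \<Longrightarrow> tracks h k z (\<lambda>n. z)"
  by (simp add: tracks_def)

text \<open>
  The two subtrees share no unknown besides the abscissa, so sequences for them combine whenever they have
  the same abscissae and satisfy the equation of the node.
\<close>

lemma tracks_node:
  assumes k: "0 < k"
    and l: "tracks h (2 * k) z Zl" and r: "tracks h (2 * k + 1) z Zr"
    and same: "\<And>n. Zl n 0 = Zr n 0"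
    and y: "conv y (z k)"
    and eq: "\<forall>\<^sub>F n in sequentially. c0 k * y n + form k (Zl n (2 * k)) (Zr n (2 * k + 1)) = 0"
  obtains Z where "tracks (Suc h) k z Z" "\<And>n. Z n 0 = Zl n 0" "\<And>n. Z n k = y n"
    "\<And>n i. i \<in> desc h (2 * k) \<Longrightarrow> Z n i = Zl n i"
    "\<And>n i. i \<in> desc h (2 * k + 1) \<Longrightarrow> Z n i = Zr n i"
proof -
  define Z where "Z n i = (if i = k then y n else if i \<in> desc h (2 * k + 1) then Zr n i else Zl n i)"
    for n i
  have Z: "Z n 0 = Zl n 0" "Z n k = y n"
    "i \<in> desc h (2 * k) \<Longrightarrow> Z n i = Zl n i" "i \<in> desc h (2 * k + 1) \<Longrightarrow> Z n i = Zr n i" for n i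
    using k zero_notin_desc[of "2 * k + 1" h] root_notin_desc[OF k, of h] desc_disjoint[OF k, of h]
    by (auto simp: Z_def)
  have "\<forall>\<^sub>F n in sequentially. sol (Suc h) k (Z n)"
    using eq l[unfolded tracks_def, THEN conjunct1] r[unfolded tracks_def, THEN conjunct1]
  proof eventually_elim
    case (elim n)
    have "sol h (2 * k) (Z n)" "sol h (2 * k + 1) (Z n)"
      using elim(2,3) sol_cong[of h "2 * k" "Z n" "Zl n"] sol_cong[of h "2 * k + 1" "Z n" "Zr n"]
        Z same by auto
    moreover have "Z n (2 * k) = Zl n (2 * k)" "Z n (2 * k + 1) = Zr n (2 * k + 1)"
      using Z root_in_desc by blast+
    ultimately show ?case using elim(1) Z(2) by simp
  qed
  moreover have "conv (\<lambda>n. Z n i) (z i)" if "i \<in> insert 0 (desc (Suc h) k)" for i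
  proof -
    have "(\<lambda>n. Z n i) = y \<and> i = k \<or> (\<lambda>n. Z n i) = (\<lambda>n. Zl n i) \<and> i \<in> insert 0 (desc h (2 * k)) \<or>
        (\<lambda>n. Z n i) = (\<lambda>n. Zr n i) \<and> i \<in> desc h (2 * k + 1)"
      using that Z by (auto simp: fun_eq_iff)
    then show ?thesis using l r y unfolding tracks_def by auto
  qed
  ultimately have "tracks (Suc h) k z Z" unfolding tracks_def by blast
  then show ?thesis using that Z by blast
qed

lemma graph_moves:
  assumes "0 < k" "graph h k" "sol h k z" "conv x (z 0)"
  shows "conv (\<lambda>n. gval h k (x n)) (z k) \<and>
    (\<exists>Z. tracks h k z Z \<and> (\<forall>n. Z n 0 = x n \<and> Z n k = gval h k (x n)))"
  using assms
proof (induction h arbitrary: k)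
  case 0
  have c: "conv (\<lambda>n. leaf k (x n)) (z k)" using 0 leaf_conv by simp
  moreover have "tracks 0 k z (\<lambda>n i. if i = k then leaf k (x n) else x n)"
    using 0 c by (auto simp: tracks_def)
  ultimately show ?case
    using 0 by (auto intro!: exI[of _ "\<lambda>n i. if i = k then leaf k (x n) else x n"])
next
  case (Suc h)
  obtain Zl Zr where l: "tracks h (2 * k) z Zl" "\<And>n. Zl n 0 = x n"
      "\<And>n. Zl n (2 * k) = gval h (2 * k) (x n)"
    and r: "tracks h (2 * k + 1) z Zr" "\<And>n. Zr n 0 = x n"
      "\<And>n. Zr n (2 * k + 1) = gval h (2 * k + 1) (x n)"
    and c: "conv (\<lambda>n. gval h (2 * k) (x n)) (z (2 * k))"
      "conv (\<lambda>n. gval h (2 * k + 1) (x n)) (z (2 * k + 1))"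
    using Suc.IH[of "2 * k"] Suc.IH[of "2 * k + 1"] Suc.prems by auto
  have zk: "z k = - form k (z (2 * k)) (z (2 * k + 1)) / c0 k"
    using Suc.prems by (auto simp: field_simps eq_neg_iff_add_eq_0)
  have c': "conv (\<lambda>n. gval (Suc h) k (x n)) (z k)"
    unfolding zk gval.simps form_def using Suc.prems by (intro conv_intros c) auto
  have eq: "\<forall>\<^sub>F n in sequentially.
      c0 k * gval (Suc h) k (x n) + form k (Zl n (2 * k)) (Zr n (2 * k + 1)) = 0"
    using Suc.prems l r by (auto simp: field_simps)
  obtain Z where "tracks (Suc h) k z Z" "\<And>n. Z n 0 = x n" "\<And>n. Z n k = gval (Suc h) k (x n)"
    using tracks_node[OF Suc.prems(1) l(1) r(1) _ c' eq] l(2) r(2) by metis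
  then show ?case using c' by blast
qed

text \<open>
  Three ways to move a solution that prevent or transmit rigidity.  A flexible one moves while the abscissa
  and the value of the root stay fixed, so no equation outside the subtree can make it isolated.  The root of
  a movable one can be given any nearby value at the same abscissa; for a floating one, the abscissa can
  be prescribed as well.
\<close>

definition flexible :: "nat \<Rightarrow> nat \<Rightarrow> (nat \<Rightarrow> 'a) \<Rightarrow> bool" where
  "flexible h k z \<longleftrightarrow> (\<exists>Z. tracks h k z Z \<and>
     (\<forall>\<^sub>F n in sequentially. Z n 0 = z 0 \<and> Z n k = z k \<and> (\<exists>i\<in>desc h k. Z n i \<noteq> z i)))"

lemma flexibleI:
  assumes "tracks h k z Z" "\<And>n. Z n 0 = z 0" "\<And>n. Z n k = z k"
    "\<And>n. \<exists>i\<in>desc h k. Z n i \<noteq> z i"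
  shows "flexible h k z"
  unfolding flexible_def
  by (rule exI[of _ Z], intro conjI assms(1) always_eventually allI assms(2-4))

definition movable :: "nat \<Rightarrow> nat \<Rightarrow> (nat \<Rightarrow> 'a) \<Rightarrow> bool" where
  "movable h k z \<longleftrightarrow> (\<forall>y. conv y (z k) \<longrightarrow>
     (\<exists>Z. tracks h k z Z \<and> (\<forall>n. Z n 0 = z 0 \<and> Z n k = y n)))"

definition floating :: "nat \<Rightarrow> nat \<Rightarrow> (nat \<Rightarrow> 'a) \<Rightarrow> bool" where
  "floating h k z \<longleftrightarrow> (\<forall>x y. conv x (z 0) \<longrightarrow> conv y (z k) \<longrightarrow>
     (\<exists>Z. tracks h k z Z \<and> (\<forall>n. Z n 0 = x n \<and> Z n k = y n)))"

lemma form_add_left: "form k (a + d) b = form k a b + d * (c2 k + c4 k * b)"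
  and form_add_right: "form k a (b + d) = form k a b + d * (c3 k + c4 k * a)"
  by (simp_all add: form_def algebra_simps)

text \<open>
  An affine equation with nonzero leading coefficient can be solved for its variable, also after a small
  change of the coefficients.
\<close>

lemma solve_left:
  assumes "c2 k + c4 k * b \<noteq> 0" "c0 k * y + form k a b = 0" "conv Y y" "conv Yr b"
  obtains Yl where "conv Yl a"
    "\<forall>\<^sub>F n in sequentially. c0 k * Y n + form k (Yl n) (Yr n) = 0"
proof
  define Yl where "Yl n = - (c0 k * Y n + c1 k + c3 k * Yr n) / (c2 k + c4 k * Yr n)" for n
  have "- (c0 k * y + c1 k + c3 k * b) = a * (c2 k + c4 k * b)"
    using assms(2) unfolding form_def by algebra
  then have a: "a = - (c0 k * y + c1 k + c3 k * b) / (c2 k + c4 k * b)"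
    using assms(1) by (simp add: eq_divide_eq)
  show "conv Yl a"
    unfolding a Yl_def by (intro conv_intros assms)
  have "conv (\<lambda>n. c2 k + c4 k * Yr n) (c2 k + c4 k * b)"
    by (intro conv_intros assms)
  from conv_eventually_nonzero[OF this assms(1)]
  show "\<forall>\<^sub>F n in sequentially. c0 k * Y n + form k (Yl n) (Yr n) = 0"
  proof eventually_elim
    case (elim n)
    have "form k (Yl n) (Yr n) = c1 k + c3 k * Yr n + Yl n * (c2 k + c4 k * Yr n)"
      unfolding form_def by algebra
    also have "Yl n * (c2 k + c4 k * Yr n) = - (c0 k * Y n + c1 k + c3 k * Yr n)"
      using elim unfolding Yl_def by simp
    finally show ?case by simp
  qed
qed

lemma solve_right:
  assumes "c3 k + c4 k * a \<noteq> 0" "c0 k * y + form k a b = 0" "conv Y y" "conv Yl a"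
  obtains Yr where "conv Yr b"
    "\<forall>\<^sub>F n in sequentially. c0 k * Y n + form k (Yl n) (Yr n) = 0"
proof -
  interpret swap: bilinear_tree N c0 c1 c3 c2 c4 leaf
    by unfold_locales (rule leaf_conv)
  have f: "swap.form k u v = form k v u" for u v
    by (simp add: form_def swap.form_def algebra_simps)
  show ?thesis
    using swap.solve_left[of k a y b Y Yl] assms that by (auto simp: f)
qed

lemma flexible_node_left:
  assumes k: "0 < k" and sol: "sol (Suc h) k z" and flex: "flexible h (2 * k) z"
  shows "flexible (Suc h) k z"
proof -
  obtain Zl where Zl: "tracks h (2 * k) z Zl" "\<forall>\<^sub>F n in sequentially. Zl n 0 = z 0 \<and>
      Zl n (2 * k) = z (2 * k) \<and> (\<exists>i\<in>desc h (2 * k). Zl n i \<noteq> z i)"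
    using flex unfolding flexible_def by blast
  \<comment> \<open>The abscissa is fixed eventually, but not from the start; the exceptional members only need to
      have the same abscissa as their counterparts on the left.\<close>
  define Zr where "Zr n = (if Zl n 0 = z 0 then z else (\<lambda>i. Zl n 0))" for n
  have ev: "\<forall>\<^sub>F n in sequentially. Zr n = z"
    using Zl(2) by eventually_elim (simp add: Zr_def)
  have r: "tracks h (2 * k + 1) z Zr"
    unfolding tracks_def
  proof (intro conjI ballI)
    show "\<forall>\<^sub>F n in sequentially. sol h (2 * k + 1) (Zr n)"
      using ev by eventually_elim (use sol in auto)
    show "conv (\<lambda>n. Zr n i) (z i)" for i
      unfolding conv_def by (rule tendsto_eventually) (use ev in eventually_elim, simp)
  qed
  have eq: "\<forall>\<^sub>F n in sequentially. c0 k * z k + form k (Zl n (2 * k)) (Zr n (2 * k + 1)) = 0"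
    using Zl(2) ev by eventually_elim (use sol in auto)
  have same: "Zl n 0 = Zr n 0" for n by (simp add: Zr_def)
  obtain Z where Z: "tracks (Suc h) k z Z" "\<And>n. Z n 0 = Zl n 0" "\<And>n. Z n k = z k"
      "\<And>n i. i \<in> desc h (2 * k) \<Longrightarrow> Z n i = Zl n i"
      "\<And>n i. i \<in> desc h (2 * k + 1) \<Longrightarrow> Z n i = Zr n i"
    by (rule tracks_node[OF k Zl(1) r same conv_const eq]) auto
  show ?thesis
    unfolding flexible_def
  proof (rule exI[of _ Z], rule conjI[OF Z(1)], use Zl(2) in eventually_elim)
    case (elim n)
    then obtain i where "i \<in> desc h (2 * k)" "Zl n i \<noteq> z i" by blast
    then have "i \<in> desc (Suc h) k" "Z n i \<noteq> z i" using Z(4) by simp_all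
    then show ?case using elim Z(2,3) by metis
  qed
qed

lemma flexible_node_right:
  assumes k: "0 < k" and sol: "sol (Suc h) k z" and flex: "flexible h (2 * k + 1) z"
  shows "flexible (Suc h) k z"
proof -
  obtain Zr where Zr: "tracks h (2 * k + 1) z Zr" "\<forall>\<^sub>F n in sequentially. Zr n 0 = z 0 \<and>
      Zr n (2 * k + 1) = z (2 * k + 1) \<and> (\<exists>i\<in>desc h (2 * k + 1). Zr n i \<noteq> z i)"
    using flex unfolding flexible_def by blast
  define Zl where "Zl n = (if Zr n 0 = z 0 then z else (\<lambda>i. Zr n 0))" for n
  have ev: "\<forall>\<^sub>F n in sequentially. Zl n = z"
    using Zr(2) by eventually_elim (simp add: Zl_def)
  have l: "tracks h (2 * k) z Zl"
    unfolding tracks_def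
  proof (intro conjI ballI)
    show "\<forall>\<^sub>F n in sequentially. sol h (2 * k) (Zl n)"
      using ev by eventually_elim (use sol in auto)
    show "conv (\<lambda>n. Zl n i) (z i)" for i
      unfolding conv_def by (rule tendsto_eventually) (use ev in eventually_elim, simp)
  qed
  have eq: "\<forall>\<^sub>F n in sequentially. c0 k * z k + form k (Zl n (2 * k)) (Zr n (2 * k + 1)) = 0"
    using Zr(2) ev by eventually_elim (use sol in auto)
  have same: "Zl n 0 = Zr n 0" for n by (simp add: Zl_def)
  obtain Z where Z: "tracks (Suc h) k z Z" "\<And>n. Z n 0 = Zl n 0" "\<And>n. Z n k = z k"
      "\<And>n i. i \<in> desc h (2 * k) \<Longrightarrow> Z n i = Zl n i"
      "\<And>n i. i \<in> desc h (2 * k + 1) \<Longrightarrow> Z n i = Zr n i"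
    by (rule tracks_node[OF k l Zr(1) same conv_const eq]) auto
  show ?thesis
    unfolding flexible_def
  proof (rule exI[of _ Z], rule conjI[OF Z(1)], use Zr(2) in eventually_elim)
    case (elim n)
    then obtain i where "i \<in> desc h (2 * k + 1)" "Zr n i \<noteq> z i" by blast
    then have "i \<in> desc (Suc h) k" "Z n i \<noteq> z i" using Z(5) by simp_all
    then show ?case using elim Z(2,3) same[of n] by metis
  qed
qed

text \<open>
  Two free values bound by a single equation leave a degree of freedom.
\<close>

lemma two_movable_children:
  assumes k: "0 < k" and sol: "sol (Suc h) k z"
    and l: "movable h (2 * k) z" and r: "movable h (2 * k + 1) z"
  shows "flexible (Suc h) k z"
proof -
  obtain t where t: "conv t 0" "\<And>n. t n \<noteq> 0" by (rule null_sequence) auto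
  have eq: "c0 k * z k + form k (z (2 * k)) (z (2 * k + 1)) = 0" using sol by simp
  have "\<exists>Yl Yr. conv Yl (z (2 * k)) \<and> conv Yr (z (2 * k + 1)) \<and>
      (\<forall>n. Yl n \<noteq> z (2 * k) \<or> Yr n \<noteq> z (2 * k + 1)) \<and>
      (\<forall>\<^sub>F n in sequentially. c0 k * z k + form k (Yl n) (Yr n) = 0)"
  proof (cases "c2 k + c4 k * z (2 * k + 1) = 0")
    case True
    have "c0 k * z k + form k (z (2 * k) + t n) (z (2 * k + 1)) = 0" for n
      using True eq by (simp add: form_add_left)
    then show ?thesis
      using t conv_add[OF conv_const t(1), of "z (2 * k)"]
      by (intro exI[of _ "\<lambda>n. z (2 * k) + t n"] exI[of _ "\<lambda>n. z (2 * k + 1)"]) auto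
  next
    case False
    have c: "conv (\<lambda>n. z (2 * k + 1) + t n) (z (2 * k + 1))"
      using conv_add[OF conv_const t(1), of "z (2 * k + 1)"] by simp
    obtain Yl where "conv Yl (z (2 * k))" "\<forall>\<^sub>F n in sequentially.
        c0 k * z k + form k (Yl n) (z (2 * k + 1) + t n) = 0"
      using solve_left[OF False eq conv_const c] .
    then show ?thesis
      using c t(2) by (intro exI[of _ Yl] exI[of _ "\<lambda>n. z (2 * k + 1) + t n"]) auto
  qed
  then obtain Yl Yr where Y: "conv Yl (z (2 * k))" "conv Yr (z (2 * k + 1))"
      "\<And>n. Yl n \<noteq> z (2 * k) \<or> Yr n \<noteq> z (2 * k + 1)"
      "\<forall>\<^sub>F n in sequentially. c0 k * z k + form k (Yl n) (Yr n) = 0"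
    by blast
  obtain Zl where Zl: "tracks h (2 * k) z Zl" "\<And>n. Zl n 0 = z 0" "\<And>n. Zl n (2 * k) = Yl n"
    using l Y(1) unfolding movable_def by blast
  obtain Zr where Zr: "tracks h (2 * k + 1) z Zr" "\<And>n. Zr n 0 = z 0"
      "\<And>n. Zr n (2 * k + 1) = Yr n"
    using r Y(2) unfolding movable_def by blast
  obtain Z where Z: "tracks (Suc h) k z Z" "\<And>n. Z n 0 = Zl n 0" "\<And>n. Z n k = z k"
      "\<And>n i. i \<in> desc h (2 * k) \<Longrightarrow> Z n i = Zl n i"
      "\<And>n i. i \<in> desc h (2 * k + 1) \<Longrightarrow> Z n i = Zr n i"
    by (rule tracks_node[OF k Zl(1) Zr(1), of "\<lambda>n. z k"]) (use Y(4) Zl Zr in auto)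
  have "\<exists>i\<in>desc (Suc h) k. Z n i \<noteq> z i" for n
  proof -
    have "Z n (2 * k) = Yl n" "Z n (2 * k + 1) = Yr n"
      using Z(4,5) Zl(3) Zr(3) by simp_all
    moreover have "2 * k \<in> desc (Suc h) k" "2 * k + 1 \<in> desc (Suc h) k" by simp_all
    ultimately show ?thesis using Y(3)[of n] by metis
  qed
  with Z(1) show ?thesis
    using Z(2,3) Zl(2) by (intro flexibleI[of _ _ _ Z]) simp_all
qed

lemma floating_imp_movable: "floating h k z \<Longrightarrow> movable h k z"
  unfolding floating_def movable_def using conv_const by blast

text \<open>
  An equation whose coefficient at the left child vanishes does not react to the value there.
\<close>

lemma left_slope_zero:
  assumes k: "0 < k" and sol: "sol (Suc h) k z" and l: "movable h (2 * k) z"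
    and s: "c2 k + c4 k * z (2 * k + 1) = 0"
  shows "flexible (Suc h) k z"
proof -
  obtain t where t: "conv t 0" "\<And>n. t n \<noteq> 0" by (rule null_sequence) auto
  have eq: "c0 k * z k + form k (z (2 * k)) (z (2 * k + 1)) = 0" using sol by simp
  have c: "conv (\<lambda>n. z (2 * k) + t n) (z (2 * k))"
    using conv_add[OF conv_const t(1), of "z (2 * k)"] by simp
  obtain Zl where Zl: "tracks h (2 * k) z Zl" "\<And>n. Zl n 0 = z 0"
      "\<And>n. Zl n (2 * k) = z (2 * k) + t n"
    using l c unfolding movable_def by blast
  have r: "tracks h (2 * k + 1) z (\<lambda>n. z)" using sol by (intro tracks_const) simp
  have "c0 k * z k + form k (z (2 * k) + t n) (z (2 * k + 1)) = 0" for n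
    using s eq by (simp add: form_add_left)
  then have ev: "\<forall>\<^sub>F n in sequentially. c0 k * z k + form k (Zl n (2 * k)) (z (2 * k + 1)) = 0"
    using Zl(3) by simp
  obtain Z where Z: "tracks (Suc h) k z Z" "\<And>n. Z n 0 = Zl n 0" "\<And>n. Z n k = z k"
      "\<And>n i. i \<in> desc h (2 * k) \<Longrightarrow> Z n i = Zl n i"
      "\<And>n i. i \<in> desc h (2 * k + 1) \<Longrightarrow> Z n i = z i"
    by (rule tracks_node[OF k Zl(1) r Zl(2) conv_const ev]) auto
  have "\<exists>i\<in>desc (Suc h) k. Z n i \<noteq> z i" for n
    using Z(4)[of "2 * k" n] Zl(3) t(2) by (intro bexI[of _ "2 * k"]) simp_all
  with Z(1) show ?thesis
    using Z(2,3) Zl(2) by (intro flexibleI[of _ _ _ Z]) simp_all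
qed

lemma right_slope_zero:
  assumes k: "0 < k" and sol: "sol (Suc h) k z" and r: "movable h (2 * k + 1) z"
    and s: "c3 k + c4 k * z (2 * k) = 0"
  shows "flexible (Suc h) k z"
proof -
  obtain t where t: "conv t 0" "\<And>n. t n \<noteq> 0" by (rule null_sequence) auto
  have eq: "c0 k * z k + form k (z (2 * k)) (z (2 * k + 1)) = 0" using sol by simp
  have c: "conv (\<lambda>n. z (2 * k + 1) + t n) (z (2 * k + 1))"
    using conv_add[OF conv_const t(1), of "z (2 * k + 1)"] by simp
  obtain Zr where Zr: "tracks h (2 * k + 1) z Zr" "\<And>n. Zr n 0 = z 0"
      "\<And>n. Zr n (2 * k + 1) = z (2 * k + 1) + t n"
    using r c unfolding movable_def by blast
  have l: "tracks h (2 * k) z (\<lambda>n. z)" using sol by (intro tracks_const) simp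
  have "c0 k * z k + form k (z (2 * k)) (z (2 * k + 1) + t n) = 0" for n
    using s eq by (simp add: form_add_right)
  then have ev: "\<forall>\<^sub>F n in sequentially. c0 k * z k + form k (z (2 * k)) (Zr n (2 * k + 1)) = 0"
    using Zr(3) by simp
  obtain Z where Z: "tracks (Suc h) k z Z" "\<And>n. Z n 0 = z 0" "\<And>n. Z n k = z k"
      "\<And>n i. i \<in> desc h (2 * k) \<Longrightarrow> Z n i = z i"
      "\<And>n i. i \<in> desc h (2 * k + 1) \<Longrightarrow> Z n i = Zr n i"
    by (rule tracks_node[OF k l Zr(1) Zr(2)[symmetric] conv_const ev]) auto
  have "\<exists>i\<in>desc (Suc h) k. Z n i \<noteq> z i" for n
    using Z(5)[of "2 * k + 1" n] Zr(3) t(2) by (intro bexI[of _ "2 * k + 1"]) simp_all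
  with Z(1) show ?thesis
    using Z(2,3) by (intro flexibleI[of _ _ _ Z]) simp_all
qed

text \<open>
  If that coefficient does not vanish, the left child can follow any motion of the abscissa and of the node;
  the value of the right child, being on a graph, is then determined by the abscissa.
\<close>

lemma left_slope_nonzero:
  assumes k: "0 < k" and sol: "sol (Suc h) k z" and r: "graph h (2 * k + 1)"
    and s: "c2 k + c4 k * z (2 * k + 1) \<noteq> 0" and x: "conv x (z 0)" and y: "conv y (z k)"
    and l: "\<And>yl. conv yl (z (2 * k)) \<Longrightarrow>
      \<exists>Z. tracks h (2 * k) z Z \<and> (\<forall>n. Z n 0 = x n \<and> Z n (2 * k) = yl n)"
  shows "\<exists>Z. tracks (Suc h) k z Z \<and> (\<forall>n. Z n 0 = x n \<and> Z n k = y n)"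
proof -
  have solr: "sol h (2 * k + 1) z" using sol by simp
  obtain Zr where Zr: "tracks h (2 * k + 1) z Zr" "\<And>n. Zr n 0 = x n"
      "\<And>n. Zr n (2 * k + 1) = gval h (2 * k + 1) (x n)"
    and c: "conv (\<lambda>n. gval h (2 * k + 1) (x n)) (z (2 * k + 1))"
    using graph_moves[OF _ r solr x] by fastforce
  obtain yl where yl: "conv yl (z (2 * k))" "\<forall>\<^sub>F n in sequentially.
      c0 k * y n + form k (yl n) (gval h (2 * k + 1) (x n)) = 0"
    using solve_left[OF s _ y c] sol by auto
  obtain Zl where Zl: "tracks h (2 * k) z Zl" "\<And>n. Zl n 0 = x n" "\<And>n. Zl n (2 * k) = yl n"
    using l[OF yl(1)] by blast
  obtain Z where "tracks (Suc h) k z Z" "\<And>n. Z n 0 = Zl n 0" "\<And>n. Z n k = y n"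
    by (rule tracks_node[OF k Zl(1) Zr(1) _ y]) (use yl Zl Zr in auto)
  then show ?thesis using Zl by auto
qed

lemma right_slope_nonzero:
  assumes k: "0 < k" and sol: "sol (Suc h) k z" and l: "graph h (2 * k)"
    and s: "c3 k + c4 k * z (2 * k) \<noteq> 0" and x: "conv x (z 0)" and y: "conv y (z k)"
    and r: "\<And>yr. conv yr (z (2 * k + 1)) \<Longrightarrow>
      \<exists>Z. tracks h (2 * k + 1) z Z \<and> (\<forall>n. Z n 0 = x n \<and> Z n (2 * k + 1) = yr n)"
  shows "\<exists>Z. tracks (Suc h) k z Z \<and> (\<forall>n. Z n 0 = x n \<and> Z n k = y n)"
proof -
  have soll: "sol h (2 * k) z" using sol by simp
  obtain Zl where Zl: "tracks h (2 * k) z Zl" "\<And>n. Zl n 0 = x n"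
      "\<And>n. Zl n (2 * k) = gval h (2 * k) (x n)"
    and c: "conv (\<lambda>n. gval h (2 * k) (x n)) (z (2 * k))"
    using graph_moves[OF _ l soll x] k by auto
  obtain yr where yr: "conv yr (z (2 * k + 1))" "\<forall>\<^sub>F n in sequentially.
      c0 k * y n + form k (gval h (2 * k) (x n)) (yr n) = 0"
    using solve_right[OF s _ y c] sol by auto
  obtain Zr where Zr: "tracks h (2 * k + 1) z Zr" "\<And>n. Zr n 0 = x n"
      "\<And>n. Zr n (2 * k + 1) = yr n"
    using r[OF yr(1)] by blast
  obtain Z where "tracks (Suc h) k z Z" "\<And>n. Z n 0 = Zl n 0" "\<And>n. Z n k = y n"
    by (rule tracks_node[OF k Zl(1) Zr(1) _ y]) (use yr Zl Zr in auto)
  then show ?thesis using Zl by auto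
qed

text \<open>
  The type at a node follows from the types at its children.  Two graphs give a graph if the value of the
  node occurs in the equation; otherwise the equation relates the two graphs and either fixes the abscissa
  or is void, which makes the solution vertical or floating.  A graph and a moving child transmit the motion
  or make the node flexible, depending on the coefficient of the moving child.  Two moving children, and
  any flexible child, make the node flexible.
\<close>

theorem classification:
  assumes "0 < k" "sol h k z"
  shows "graph h k \<or> flexible h k z \<or> floating h k z \<or> vertical h k z \<and> movable h k z"
  using assms
proof (induction h arbitrary: k)
  case 0
  then show ?case by simp
next
  case (Suc h)
  note k = \<open>0 < k\<close> and sol = \<open>sol (Suc h) k z\<close>
  have eq: "c0 k * z k + form k (z (2 * k)) (z (2 * k + 1)) = 0"
    and soll: "sol h (2 * k) z" and solr: "sol h (2 * k + 1) z"
    using sol by simp_all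
  note IHl = Suc.IH[OF _ soll] and IHr = Suc.IH[OF _ solr]
  consider (flex) "flexible h (2 * k) z \<or> flexible h (2 * k + 1) z"
    | (both) "movable h (2 * k) z" "movable h (2 * k + 1) z"
    | (graph) "graph h (2 * k)" "graph h (2 * k + 1)"
    | (left) "graph h (2 * k + 1)" "floating h (2 * k) z \<or> vertical h (2 * k) z \<and> movable h (2 * k) z"
    | (right) "graph h (2 * k)"
        "floating h (2 * k + 1) z \<or> vertical h (2 * k + 1) z \<and> movable h (2 * k + 1) z"
    using IHl IHr k floating_imp_movable by auto
  then show ?case
  proof cases
    case flex
    then show ?thesis using flexible_node_left[OF k sol] flexible_node_right[OF k sol] by blast
  next
    case both
    then show ?thesis using two_movable_children[OF k sol] by blast
  next
    case left
    show ?thesis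
    proof (cases "c2 k + c4 k * z (2 * k + 1) = 0")
      case True
      then show ?thesis using left_slope_zero[OF k sol] left(2) floating_imp_movable by blast
    next
      case False
      note move = left_slope_nonzero[OF k sol left(1) False]
      have "floating (Suc h) k z" if "floating h (2 * k) z"
        unfolding floating_def
      proof (intro allI impI)
        fix x y assume "conv x (z 0)" "conv y (z k)"
        then show "\<exists>Z. tracks (Suc h) k z Z \<and> (\<forall>n. Z n 0 = x n \<and> Z n k = y n)"
          using move[of x y] that unfolding floating_def by blast
      qed
      moreover have "movable (Suc h) k z" if "movable h (2 * k) z"
        unfolding movable_def
      proof (intro allI impI)
        fix y assume "conv y (z k)"
        then show "\<exists>Z. tracks (Suc h) k z Z \<and> (\<forall>n. Z n 0 = z 0 \<and> Z n k = y n)"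
          using move[of "\<lambda>n. z 0" y] that unfolding movable_def by simp
      qed
      ultimately show ?thesis using left False by auto
    qed
  next
    case right
    show ?thesis
    proof (cases "c3 k + c4 k * z (2 * k) = 0")
      case True
      then show ?thesis using right_slope_zero[OF k sol] right(2) floating_imp_movable by blast
    next
      case False
      note move = right_slope_nonzero[OF k sol right(1) False]
      have "floating (Suc h) k z" if "floating h (2 * k + 1) z"
        unfolding floating_def
      proof (intro allI impI)
        fix x y assume "conv x (z 0)" "conv y (z k)"
        then show "\<exists>Z. tracks (Suc h) k z Z \<and> (\<forall>n. Z n 0 = x n \<and> Z n k = y n)"
          using move[of x y] that unfolding floating_def by blast
      qed
      moreover have "movable (Suc h) k z" if "movable h (2 * k + 1) z"
        unfolding movable_def
      proof (intro allI impI)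
        fix y assume "conv y (z k)"
        then show "\<exists>Z. tracks (Suc h) k z Z \<and> (\<forall>n. Z n 0 = z 0 \<and> Z n k = y n)"
          using move[of "\<lambda>n. z 0" y] that unfolding movable_def by simp
      qed
      ultimately show ?thesis using right False by auto
    qed
  next
    case graph
    have move: "\<exists>Z. tracks (Suc h) k z Z \<and> (\<forall>n. Z n 0 = x n \<and> Z n k = y n)"
      if cx: "conv x (z 0)" and cy: "conv y (z k)" and free: "c0 k = 0"
        and zero: "\<And>n. form k (gval h (2 * k) (x n)) (gval h (2 * k + 1) (x n)) = 0" for x y
    proof -
      obtain Zl where Zl: "tracks h (2 * k) z Zl" "\<And>n. Zl n 0 = x n"
          "\<And>n. Zl n (2 * k) = gval h (2 * k) (x n)"
        using graph_moves[OF _ graph(1) soll cx] k by auto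
      obtain Zr where Zr: "tracks h (2 * k + 1) z Zr" "\<And>n. Zr n 0 = x n"
          "\<And>n. Zr n (2 * k + 1) = gval h (2 * k + 1) (x n)"
        using graph_moves[OF _ graph(2) solr cx] k by auto
      obtain Z where "tracks (Suc h) k z Z" "\<And>n. Z n 0 = Zl n 0" "\<And>n. Z n k = y n"
        by (rule tracks_node[OF k Zl(1) Zr(1) _ cy]) (use Zl Zr free zero in auto)
      then show ?thesis using Zl by auto
    qed
    consider "c0 k \<noteq> 0"
      | (float) "c0 k = 0" "\<And>x. form k (gval h (2 * k) x) (gval h (2 * k + 1) x) = 0"
      | (vert) "c0 k = 0" "\<exists>x. form k (gval h (2 * k) x) (gval h (2 * k + 1) x) \<noteq> 0"
      by blast
    then show ?thesis
    proof cases
      case 1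
      then show ?thesis using graph by simp
    next
      case float
      then have "floating (Suc h) k z" unfolding floating_def using move by blast
      then show ?thesis by blast
    next
      case vert
      have "form k (gval h (2 * k) (z 0)) (gval h (2 * k + 1) (z 0)) = 0"
        using sol vert(1) sol_graph[OF graph(1) soll] sol_graph[OF graph(2) solr] by simp
      then have "movable (Suc h) k z" unfolding movable_def using move vert(1) by simp
      moreover have "vertical (Suc h) k z" using graph vert by simp
      ultimately show ?thesis by blast
    qed
  qed
qed

definition isolated :: "nat \<Rightarrow> nat \<Rightarrow> 'a \<Rightarrow> 'a \<Rightarrow> (nat \<Rightarrow> 'a) \<Rightarrow> bool" where
  "isolated h k d0 d1 z \<longleftrightarrow> (\<forall>Z. tracks h k z Z \<longrightarrow>
     (\<forall>\<^sub>F n in sequentially. d0 * Z n k + d1 = 0) \<longrightarrow>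
     \<not> (\<forall>\<^sub>F n in sequentially. \<exists>i\<in>insert 0 (desc h k). Z n i \<noteq> z i))"

text \<open>
  Flexible and floating solutions can be moved with the value at the root unchanged, so they are not isolated.
  A movable solution is isolated only if the last equation prescribes the value at the root, and a solution
  on a graph only if the last equation is a nontrivial condition on the abscissa.
\<close>

theorem isolated_cases:
  assumes k: "0 < k" and sol: "sol h k z" and eq: "d0 * z k + d1 = 0" and iso: "isolated h k d0 d1 z"
  shows "graph h k \<and> (\<exists>x. d0 * gval h k x + d1 \<noteq> 0) \<or> vertical h k z \<and> d0 \<noteq> 0"
proof -
  obtain t where t: "conv t 0" "\<And>n. t n \<noteq> 0" by (rule null_sequence) auto
  have cx: "conv (\<lambda>n. z 0 + t n) (z 0)" and cy: "conv (\<lambda>n. z k + t n) (z k)"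
    using conv_add[OF conv_const t(1)] by simp_all
  have "\<not> flexible h k z"
  proof
    assume "flexible h k z"
    then obtain Z where Z: "tracks h k z Z" "\<forall>\<^sub>F n in sequentially. Z n 0 = z 0 \<and> Z n k = z k \<and>
        (\<exists>i\<in>desc h k. Z n i \<noteq> z i)"
      by (auto simp: flexible_def)
    have "\<forall>\<^sub>F n in sequentially. d0 * Z n k + d1 = 0"
      using Z(2) by eventually_elim (simp add: eq)
    moreover have "\<forall>\<^sub>F n in sequentially. \<exists>i\<in>insert 0 (desc h k). Z n i \<noteq> z i"
      using Z(2) by eventually_elim blast
    ultimately show False using iso Z(1) unfolding isolated_def by blast
  qed
  moreover have no_move: False
    if "tracks h k z Z" "\<And>n. d0 * Z n k + d1 = 0" "\<And>n. Z n 0 \<noteq> z 0 \<or> Z n k \<noteq> z k" for Z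
  proof -
    have "\<exists>i\<in>insert 0 (desc h k). Z n i \<noteq> z i" for n
      using that(3)[of n] by (meson insertI1 insertI2 root_in_desc)
    then have B: "\<forall>\<^sub>F n in sequentially. \<exists>i\<in>insert 0 (desc h k). Z n i \<noteq> z i"
      by (intro always_eventually allI)
    have A: "\<forall>\<^sub>F n in sequentially. d0 * Z n k + d1 = 0"
      by (intro always_eventually allI that(2))
    show False
      using iso[unfolded isolated_def, rule_format, OF that(1) A] B by (rule notE)
  qed
  moreover have "\<not> floating h k z"
  proof
    assume "floating h k z"
    from this[unfolded floating_def, rule_format, OF cx conv_const]
    obtain Z where Z: "tracks h k z Z" "\<forall>n. Z n 0 = z 0 + t n \<and> Z n k = z k" by blast
    show False
      by (rule no_move[OF Z(1)]) (use Z(2) t eq in simp_all)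
  qed
  moreover have "d0 \<noteq> 0" if "movable h k z"
  proof
    assume "d0 = 0"
    from that[unfolded movable_def, rule_format, OF cy]
    obtain Z where Z: "tracks h k z Z" "\<forall>n. Z n 0 = z 0 \<and> Z n k = z k + t n" by blast
    show False
      by (rule no_move[OF Z(1)]) (use Z(2) t eq \<open>d0 = 0\<close> in simp_all)
  qed
  moreover have "\<exists>x. d0 * gval h k x + d1 \<noteq> 0" if g: "graph h k"
  proof (rule ccontr)
    assume *: "\<not> ?thesis"
    from graph_moves[OF k g sol cx]
    obtain Z where Z: "tracks h k z Z" "\<forall>n. Z n 0 = z 0 + t n \<and> Z n k = gval h k (z 0 + t n)"
      by blast
    show False
      by (rule no_move[OF Z(1)]) (use Z(2) t * in simp_all)
  qed
  ultimately show ?thesis using classification[OF k sol] by blast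
qed

end

lemma in_desc_iff: "j \<in> desc h k \<longleftrightarrow> (\<exists>i\<le>h. j div 2 ^ i = k)"
proof (rule iffI[OF desc_div])
  assume "\<exists>i\<le>h. j div 2 ^ i = k"
  then obtain i where "i \<le> h" "j div 2 ^ i = k" by blast
  then show "j \<in> desc h k"
  proof (induction h arbitrary: i k)
    case 0
    then show ?case by simp
  next
    case (Suc h)
    show ?case
    proof (cases i)
      case 0
      then show ?thesis using Suc.prems by simp
    next
      case (Suc i')
      then have "(j div 2 ^ i') div 2 = k"
        using Suc.prems(2) by (simp add: div_mult2_eq mult.commute[of 2])
      then have "j div 2 ^ i' = 2 * k \<or> j div 2 ^ i' = 2 * k + 1" by linarith
      then show ?thesis
        using Suc.IH[of i'] Suc.prems(1) \<open>i = Suc i'\<close> by auto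
    qed
  qed
qed

lemma in_desc_one: "0 < j \<Longrightarrow> j < 2 ^ Suc h \<Longrightarrow> j \<in> desc h 1"
proof -
  assume "0 < j" "j < 2 ^ Suc h"
  then have "\<exists>i\<le>h. j div 2 ^ i = 1"
  proof (induction h arbitrary: j)
    case 0
    then show ?case by auto
  next
    case (Suc h)
    show ?case
    proof (cases "j = 1")
      case True
      then show ?thesis by (intro exI[of _ 0]) auto
    next
      case False
      then have "0 < j div 2" "j div 2 < 2 ^ Suc h" using Suc.prems by auto
      then obtain i where "i \<le> h" "(j div 2) div 2 ^ i = 1"
        using Suc.IH[of "j div 2"] by blast
      then show ?thesis by (intro exI[of _ "Suc i"]) (auto simp: div_mult2_eq)
    qed
  qed
  then show ?thesis by (simp add: in_desc_iff)
qed

text \<open>Level \<open>h\<close> of a tree with leaves \<open>2 ^ \<Delta>, \<dots>\<close>, counted from the leaves.\<close>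

definition at_level :: "nat \<Rightarrow> nat \<Rightarrow> nat \<Rightarrow> bool" where
  "at_level \<Delta> h k \<longleftrightarrow> h \<le> \<Delta> \<and> 2 ^ (\<Delta> - h) \<le> k \<and> k < 2 ^ Suc (\<Delta> - h)"

lemma at_level_root: "at_level \<Delta> \<Delta> 1"
  by (simp add: at_level_def)

lemma at_level_pos: "at_level \<Delta> h k \<Longrightarrow> 0 < k"
  unfolding at_level_def by (metis gr0I le_zero_eq power_not_zero zero_neq_numeral)

lemma at_level_leaf: "at_level \<Delta> 0 k \<Longrightarrow> 2 ^ \<Delta> \<le> k"
  by (simp add: at_level_def)

lemma at_level_inner: "at_level \<Delta> (Suc h) k \<Longrightarrow> k < 2 ^ \<Delta>"
proof -
  assume a: "at_level \<Delta> (Suc h) k"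
  then have "k < 2 ^ Suc (\<Delta> - Suc h)" "Suc (\<Delta> - Suc h) \<le> \<Delta>" by (auto simp: at_level_def)
  then show ?thesis by (meson less_le_trans one_le_numeral power_increasing)
qed

lemma at_level_children:
  assumes "at_level \<Delta> (Suc h) k"
  shows "at_level \<Delta> h (2 * k)" "at_level \<Delta> h (2 * k + 1)"
proof -
  have "\<Delta> - h = Suc (\<Delta> - Suc h)" using assms by (auto simp: at_level_def)
  then show "at_level \<Delta> h (2 * k)" "at_level \<Delta> h (2 * k + 1)"
    using assms by (auto simp: at_level_def)
qed

context bilinear_tree
begin

lemma sol_at_level:
  assumes "\<And>j. 0 < j \<Longrightarrow> j < 2 ^ \<Delta> \<Longrightarrow> c0 j * z j + form j (z (2 * j)) (z (2 * j + 1)) = 0"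
    and "\<And>j. 2 ^ \<Delta> \<le> j \<Longrightarrow> z j = leaf j (z 0)" and "at_level \<Delta> h k"
  shows "sol h k z"
  using assms(3)
proof (induction h arbitrary: k)
  case 0
  then show ?case using assms(2) at_level_leaf by simp
next
  case (Suc h)
  then show ?case
    using assms(1)[OF at_level_pos at_level_inner, OF Suc.prems Suc.prems] at_level_children by simp
qed

lemma sol_at_level_node:
  assumes "sol h k z" "at_level \<Delta> h k" "j \<in> desc h k"
  shows "(j < 2 ^ \<Delta> \<longrightarrow> c0 j * z j + form j (z (2 * j)) (z (2 * j + 1)) = 0) \<and>
    (2 ^ \<Delta> \<le> j \<longrightarrow> z j = leaf j (z 0))"
  using assms
proof (induction h arbitrary: k)
  case 0
  then show ?case using at_level_leaf by force
next
  case (Suc h)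
  note l = at_level_children[OF Suc.prems(2)] and i = at_level_inner[OF Suc.prems(2)]
  show ?case
    using Suc.IH[of "2 * k"] Suc.IH[of "2 * k + 1"] l i Suc.prems by auto
qed

lemma vertical_not_graph: "vertical h k z \<Longrightarrow> \<not> graph h k"
  by (induction h arbitrary: k) auto

lemma graph_unique:
  assumes "graph h k" "sol h k z" "sol h k z'" "z 0 = z' 0" "i \<in> desc h k"
  shows "z i = z' i"
  using assms
proof (induction h arbitrary: k)
  case 0
  then show ?case by simp
next
  case (Suc h)
  then have "z k = z' k" using sol_graph[OF Suc.prems(1)] by metis
  then show ?case using Suc by auto
qed

text \<open>
  A solution that is rigid along a vertical line is determined by its abscissa and its value at
  the root: going down along the vertical path, each equation is affine with nonzero slope in
  the value at the next node of the path.
\<close>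

lemma vertical_unique:
  assumes "vertical h k z" "vertical h k z'" "sol h k z" "sol h k z'"
    and "z 0 = z' 0" "z k = z' k" "i \<in> desc h k"
  shows "z i = z' i"
  using assms
proof (induction h arbitrary: k i)
  case 0
  then show ?case by simp
next
  case (Suc h)
  have eq: "form k (z (2 * k)) (z (2 * k + 1)) = form k (z' (2 * k)) (z' (2 * k + 1))"
    using Suc.prems(3,4,6) by (metis add_left_cancel sol.simps(2))
  note gu = graph_unique[of h _ z z']
  consider (none) "graph h (2 * k)" "graph h (2 * k + 1)"
    | (left) "vertical h (2 * k) z" "graph h (2 * k + 1)" "c2 k + c4 k * z (2 * k + 1) \<noteq> 0"
    | (right) "graph h (2 * k)" "vertical h (2 * k + 1) z" "c3 k + c4 k * z (2 * k) \<noteq> 0"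
    using Suc.prems(1) by auto
  then show ?case
  proof cases
    case none
    then show ?thesis using gu[of "2 * k"] gu[of "2 * k + 1"] Suc.prems by auto
  next
    case left
    have r: "z j = z' j" if "j \<in> desc h (2 * k + 1)" for j
      using gu[OF left(2)] Suc.prems(3-5) that by simp
    have l: "vertical h (2 * k) z'"
      using Suc.prems(2) vertical_not_graph[OF left(1)] by auto
    have "form k (z (2 * k)) (z (2 * k + 1)) = form k (z' (2 * k)) (z (2 * k + 1)) +
        (z (2 * k) - z' (2 * k)) * (c2 k + c4 k * z (2 * k + 1))"
      using form_add_left[of k "z' (2 * k)" "z (2 * k) - z' (2 * k)" "z (2 * k + 1)"] by simp
    then have "z (2 * k) = z' (2 * k)"
      using eq left(3) r[OF root_in_desc] by simp
    then have "z j = z' j" if "j \<in> desc h (2 * k)" for j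
      using Suc.IH[OF left(1) l] Suc.prems(3-5) that by simp
    then show ?thesis using r Suc.prems(6,7) by auto
  next
    case right
    have l: "z j = z' j" if "j \<in> desc h (2 * k)" for j
      using gu[OF right(1)] Suc.prems(3-5) that by simp
    have r: "vertical h (2 * k + 1) z'"
      using Suc.prems(2) vertical_not_graph[OF right(2)] by auto
    have "form k (z (2 * k)) (z (2 * k + 1)) = form k (z (2 * k)) (z' (2 * k + 1)) +
        (z (2 * k + 1) - z' (2 * k + 1)) * (c3 k + c4 k * z (2 * k))"
      using form_add_right[of k "z (2 * k)" "z' (2 * k + 1)" "z (2 * k + 1) - z' (2 * k + 1)"] by simp
    then have "z (2 * k + 1) = z' (2 * k + 1)"
      using eq right(3) l[OF root_in_desc] by simp
    then have "z j = z' j" if "j \<in> desc h (2 * k + 1)" for j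
      using Suc.IH[OF right(2) r] Suc.prems(3-5) that by simp
    then show ?thesis using l Suc.prems(6,7) by auto
  qed
qed

end

section \<open>Counting the solutions over a valued field\<close>

text \<open>
  With powers of the abscissa at the leaves, the graphs are those of polynomials of bounded degree, and the
  abscissae of vertical lines are roots of such polynomials.
\<close>

locale power_tree = bilinear_tree N c0 c1 c2 c3 c4 "\<lambda>k x. x ^ a k"
  for N :: "'a::field \<Rightarrow> real" and c0 c1 c2 c3 c4 :: "nat \<Rightarrow> 'a" and a :: "nat \<Rightarrow> nat" +
  fixes b :: nat
  assumes a_le: "a k \<le> b"
begin

definition formp :: "nat \<Rightarrow> 'a poly \<Rightarrow> 'a poly \<Rightarrow> 'a poly" where
  "formp k f g = [:c1 k:] + smult (c2 k) f + smult (c3 k) g + smult (c4 k) (f * g)"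

primrec gpoly :: "nat \<Rightarrow> nat \<Rightarrow> 'a poly" where
  "gpoly 0 k = monom 1 (a k)"
| "gpoly (Suc h) k = smult (- 1 / c0 k) (formp k (gpoly h (2 * k)) (gpoly h (2 * k + 1)))"

lemma poly_formp: "poly (formp k f g) x = form k (poly f x) (poly g x)"
  by (simp add: formp_def form_def algebra_simps)

lemma poly_gpoly: "poly (gpoly h k) x = gval h k x"
  by (induction h arbitrary: k) (auto simp: poly_monom poly_formp)

lemma degree_formp:
  assumes "degree f \<le> d" "degree g \<le> d" shows "degree (formp k f g) \<le> 2 * d"
  unfolding formp_def
  by (intro degree_add_le order.trans[OF degree_smult_le] order.trans[OF degree_mult_le])
     (use assms in auto)

lemma degree_gpoly: "degree (gpoly h k) \<le> 2 ^ h * b"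
proof (induction h arbitrary: k)
  case 0
  then show ?case using a_le by (simp add: degree_monom_eq)
next
  case (Suc h)
  show ?case
    using degree_formp[OF Suc.IH Suc.IH, of k "2 * k" "2 * k + 1"]
    by (auto intro: order.trans[OF degree_smult_le])
qed

primrec abscissae :: "nat \<Rightarrow> nat \<Rightarrow> 'a set" where
  "abscissae 0 k = {}"
| "abscissae (Suc h) k = abscissae h (2 * k) \<union> abscissae h (2 * k + 1) \<union>
     (let f = formp k (gpoly h (2 * k)) (gpoly h (2 * k + 1)) in if f = 0 then {} else {x. poly f x = 0})"

lemma card_abscissae: "finite (abscissae h k) \<and> card (abscissae h k) \<le> h * 2 ^ h * b"
proof (induction h arbitrary: k)
  case 0
  then show ?case by simp
next
  case (Suc h)
  define f where "f = formp k (gpoly h (2 * k)) (gpoly h (2 * k + 1))"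
  define R where "R = (if f = 0 then {} else {x. poly f x = 0})"
  have R: "finite R \<and> card R \<le> 2 * (2 ^ h * b)"
    using poly_roots_finite[of f] card_poly_roots_bound[of f]
      degree_formp[OF degree_gpoly degree_gpoly, of k h "2 * k" "2 * k + 1"]
    by (auto simp: R_def f_def)
  have "abscissae (Suc h) k = abscissae h (2 * k) \<union> abscissae h (2 * k + 1) \<union> R"
    by (simp add: R_def f_def Let_def)
  moreover have "card (abscissae h (2 * k) \<union> abscissae h (2 * k + 1) \<union> R) \<le>
      card (abscissae h (2 * k)) + card (abscissae h (2 * k + 1)) + card R"
    by (meson add_le_mono card_Un_le le_refl order_trans)
  ultimately show ?case using R Suc.IH[of "2 * k"] Suc.IH[of "2 * k + 1"] by (auto simp: algebra_simps)
qed

lemma vertical_abscissa: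
  assumes "vertical h k z" "sol h k z" shows "z 0 \<in> abscissae h k"
  using assms
proof (induction h arbitrary: k)
  case 0
  then show ?case by simp
next
  case (Suc h)
  define f where "f = formp k (gpoly h (2 * k)) (gpoly h (2 * k + 1))"
  have "poly f (z 0) = 0 \<and> f \<noteq> 0"
    if "c0 k = 0" "graph h (2 * k)" "graph h (2 * k + 1)"
      "\<exists>x. form k (gval h (2 * k) x) (gval h (2 * k + 1) x) \<noteq> 0"
  proof -
    have "poly f x = form k (gval h (2 * k) x) (gval h (2 * k + 1) x)" for x
      by (simp add: f_def poly_formp poly_gpoly)
    then show ?thesis
      using that Suc.prems(2) sol_graph[OF that(2)] sol_graph[OF that(3)] by (auto simp del: poly_0)
         (metis poly_0)
  qed
  then show ?case using Suc by (auto simp: Let_def f_def)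
qed

text \<open>
  An isolated solution is determined by its abscissa, which is a root of the polynomial of the last equation or
  lies among the abscissae of vertical lines.
\<close>

theorem card_rigid_solutions:
  assumes k: "0 < k"
    and S: "\<And>z. z \<in> S \<Longrightarrow> sol h k z \<and> d0 * z k + d1 = 0 \<and> isolated h k d0 d1 z"
    and ext: "\<And>z z'. z \<in> S \<Longrightarrow> z' \<in> S \<Longrightarrow> (\<And>i. i \<in> insert 0 (desc h k) \<Longrightarrow> z i = z' i) \<Longrightarrow> z = z'"
  shows "card S \<le> (h + 1) * 2 ^ h * b"
proof -
  note cases = isolated_cases[OF k]
  show ?thesis
  proof (cases "graph h k")
    case True
    define f where "f = smult d0 (gpoly h k) + [:d1:]"
    have f: "poly f x = d0 * gval h k x + d1" for x by (simp add: f_def poly_gpoly)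
    show ?thesis
    proof (cases "S = {}")
      case False
      then have "f \<noteq> 0"
        using cases[of h _ d0 d1] S True vertical_not_graph f by (metis all_not_in_conv poly_0)
      have "inj_on (\<lambda>z. z 0) S"
        by (intro inj_onI ext) (use graph_unique[OF True] S in auto)
      moreover have "(\<lambda>z. z 0) ` S \<subseteq> {x. poly f x = 0}"
        using S sol_graph[OF True] f by force
      ultimately have "card S \<le> card {x. poly f x = 0}"
        using poly_roots_finite[OF \<open>f \<noteq> 0\<close>] by (metis card_inj_on_le)
      also have "\<dots> \<le> degree f" by (rule card_poly_roots_bound[OF \<open>f \<noteq> 0\<close>])
      also have "degree f \<le> 2 ^ h * b"
        unfolding f_def using degree_gpoly
        by (intro degree_add_le order.trans[OF degree_smult_le]) auto
      finally show ?thesis by (simp add: add_mult_distrib)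
    qed simp
  next
    case False
    then have v: "vertical h k z \<and> d0 \<noteq> 0" if "z \<in> S" for z using cases[of h z d0 d1] S[OF that] by blast
    have zk: "z k = - d1 / d0" if "z \<in> S" for z
      using S[OF that] v[OF that] by (simp add: field_simps eq_neg_iff_add_eq_0)
    have "inj_on (\<lambda>z. z 0) S"
    proof (intro inj_onI ext)
      fix z z' i assume *: "z \<in> S" "z' \<in> S" "z 0 = z' 0" "i \<in> insert 0 (desc h k)"
      then show "z i = z' i"
        using vertical_unique[of h k z z' i] v[OF *(1)] v[OF *(2)] S[OF *(1)] S[OF *(2)]
          zk[OF *(1)] zk[OF *(2)] by auto
    qed
    moreover have "(\<lambda>z. z 0) ` S \<subseteq> abscissae h k"
      using v S vertical_abscissa by blast
    ultimately have "card S \<le> h * 2 ^ h * b"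
      using card_abscissae[of h k] by (meson card_inj_on_le order_trans)
    then show ?thesis by (simp add: add_mult_distrib)
  qed
qed

end

section \<open>Laurent polynomials supported on a tree\<close>

abbreviation look where "look \<equiv> Poly_Mapping.lookup"
abbreviation mon where "mon \<equiv> Poly_Mapping.single"

definition mval :: "nat \<Rightarrow> (nat \<Rightarrow> 'k::field) \<Rightarrow> (nat \<Rightarrow>\<^sub>0 int) \<Rightarrow> 'k" where
  "mval n x e = (\<Prod>i<n. x i powi look e i)"

lemma mval_zero [simp]: "mval n x 0 = 1"
  by (simp add: mval_def)

lemma mval_add: "(\<And>i. i < n \<Longrightarrow> x i \<noteq> 0) \<Longrightarrow> mval n x (e + e') = mval n x e * mval n x e'"
  unfolding mval_def by (simp add: lookup_add power_int_add flip: prod.distrib)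

lemma mval_single: "i < n \<Longrightarrow> mval n x (mon i m) = x i powi m"
proof -
  assume "i < n"
  have "mval n x (mon i m) = (\<Prod>j<n. if j = i then x i powi m else 1)"
    unfolding mval_def by (intro prod.cong) (auto simp: lookup_single when_def)
  then show ?thesis using \<open>i < n\<close> by simp
qed

lemma laurent_eval_superset:
  assumes "finite S" "Poly_Mapping.keys f \<subseteq> S"
  shows "laurent_eval n f x = (\<Sum>e\<in>S. look f e * mval n x e)"
  unfolding laurent_eval_def mval_def
  by (rule sum.mono_neutral_left) (use assms in \<open>auto simp: in_keys_iff\<close>)

text \<open>
  The monomial standing for the node \<open>j\<close> of the tree: a variable of its own for an inner node,
  a power of the variable \<open>0\<close> for a leaf.
\<close>

definition node :: "nat \<Rightarrow> (nat \<Rightarrow> nat) \<Rightarrow> nat \<Rightarrow> (nat \<Rightarrow>\<^sub>0 int)" where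
  "node M a j = (if j < M then mon j 1 else mon 0 (int (a j)))"

definition children :: "nat \<Rightarrow> (nat \<Rightarrow> nat) \<Rightarrow> nat \<Rightarrow> (nat \<Rightarrow>\<^sub>0 int) set" where
  "children M a i = {0, node M a (2 * i), node M a (2 * i + 1),
     node M a (2 * i) + node M a (2 * i + 1)}"

text \<open>
  The equation of index 0 is affine in the root, which is the node 1; the equation of a node \<open>i > 0\<close> consists of
  a multiple of its variable and a bilinear function of its children.
\<close>

definition tree_support :: "nat \<Rightarrow> (nat \<Rightarrow> nat) \<Rightarrow> nat \<Rightarrow> (nat \<Rightarrow>\<^sub>0 int) set" where
  "tree_support M a i = (if i = 0 then {mon 1 1, 0} else insert (mon i 1) (children M a i))"

definition extend :: "nat \<Rightarrow> (nat \<Rightarrow> nat) \<Rightarrow> (nat \<Rightarrow> 'k::field) \<Rightarrow> nat \<Rightarrow> 'k" where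
  "extend M a z i = (if i < M then z i else z 0 ^ a i)"

lemma keys_node: "1 < M \<Longrightarrow> Poly_Mapping.keys (node M a j) \<subseteq> {..<M}"
  using keys_single[of "0::nat" "int (a j)"] keys_single[of j "1::int"]
  by (auto simp: node_def simp del: single_of_nat single_one keys_single split: if_splits)

lemma tree_support_exponents:
  assumes "1 < M" "i < M" shows "tree_support M a i \<subseteq> exponents M"
proof -
  have "Poly_Mapping.keys (node M a (2 * i) + node M a (2 * i + 1)) \<subseteq> {..<M}"
    using keys_add[of "node M a (2 * i)" "node M a (2 * i + 1)"] keys_node[OF assms(1)] by blast
  then show ?thesis
    using keys_node[OF assms(1)] assms by (auto simp: tree_support_def children_def exponents_def)
qed

lemma finite_tree_support [simp]: "finite (tree_support M a i)"
  by (simp add: tree_support_def children_def)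

lemma mval_node: "1 < M \<Longrightarrow> mval M z (node M a j) = extend M a z j"
  by (simp add: node_def extend_def mval_single del: single_of_nat)

text \<open>
  The exponents need not be distinct (a leaf with exponent 0 gives a constant term), so a sum over the
  support has to be split up one exponent after the other.
\<close>

lemma sum_five:
  assumes "finite S" "S \<subseteq> {k0, k1, k2, k3, k4}"
  shows "\<exists>d0 d1 d2 d3 d4 :: 'k::comm_ring_1. \<forall>u. (\<Sum>e\<in>S. l e * u e) =
    d0 * u k0 + d1 * u k1 + d2 * u k2 + d3 * u k3 + d4 * u k4"
proof -
  have step: "\<exists>c. \<forall>u. (\<Sum>e\<in>S. l e * u e) = c * u k + (\<Sum>e\<in>S - {k}. l e * u e)"
    if "finite S" for S and k :: 'a
  proof (cases "k \<in> S")
    case True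
    then show ?thesis using that by (intro exI[of _ "l k"]) (simp add: sum.remove)
  next
    case False
    then show ?thesis by (intro exI[of _ 0]) simp
  qed
  obtain d0 where d0: "\<And>u. (\<Sum>e\<in>S. l e * u e) = d0 * u k0 + (\<Sum>e\<in>S - {k0}. l e * u e)"
    using step[OF assms(1)] by blast
  obtain d1 where d1: "\<And>u. (\<Sum>e\<in>S - {k0}. l e * u e) = d1 * u k1 + (\<Sum>e\<in>S - {k0} - {k1}. l e * u e)"
    using step[of "S - {k0}"] assms(1) by blast
  obtain d2 where d2: "\<And>u. (\<Sum>e\<in>S - {k0} - {k1}. l e * u e) =
      d2 * u k2 + (\<Sum>e\<in>S - {k0} - {k1} - {k2}. l e * u e)"
    using step[of "S - {k0} - {k1}"] assms(1) by blast
  obtain d3 where d3: "\<And>u. (\<Sum>e\<in>S - {k0} - {k1} - {k2}. l e * u e) =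
      d3 * u k3 + (\<Sum>e\<in>S - {k0} - {k1} - {k2} - {k3}. l e * u e)"
    using step[of "S - {k0} - {k1} - {k2}"] assms(1) by blast
  obtain d4 where d4: "\<And>u. (\<Sum>e\<in>S - {k0} - {k1} - {k2} - {k3}. l e * u e) =
      d4 * u k4 + (\<Sum>e\<in>S - {k0} - {k1} - {k2} - {k3} - {k4}. l e * u e)"
    using step[of "S - {k0} - {k1} - {k2} - {k3}"] assms(1) by blast
  have "S - {k0} - {k1} - {k2} - {k3} - {k4} = {}" using assms(2) by blast
  then have "(\<Sum>e\<in>S. l e * u e) = d0 * u k0 + d1 * u k1 + d2 * u k2 + d3 * u k3 + d4 * u k4" for u
    by (simp only: d0 d1 d2 d3 d4 sum.empty add_0_right add.assoc)
  then show ?thesis by (intro exI allI)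
qed

lemma laurent_eval_tree:
  fixes f :: "'k::field laurent"
  assumes "1 < M" "0 < i" "Poly_Mapping.keys f \<subseteq> tree_support M a i" "i < M"
  shows "\<exists>d0 d1 d2 d3 d4. \<forall>z. (\<forall>i<M. z i \<noteq> 0) \<longrightarrow> laurent_eval M f z =
    d0 * z i + d1 + d2 * extend M a z (2 * i) + d3 * extend M a z (2 * i + 1) +
    d4 * extend M a z (2 * i) * extend M a z (2 * i + 1)"
proof -
  have "Poly_Mapping.keys f \<subseteq> {mon i 1, 0, node M a (2 * i), node M a (2 * i + 1),
     node M a (2 * i) + node M a (2 * i + 1)}"
    using assms(2,3) by (simp add: tree_support_def children_def)
  from sum_five[OF finite_keys this, of "look f"]
  obtain d0 d1 d2 d3 d4 :: 'k where d: "\<And>u. (\<Sum>e\<in>Poly_Mapping.keys f. look f e * u e) =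
      d0 * u (mon i 1) + d1 * u 0 + d2 * u (node M a (2 * i)) + d3 * u (node M a (2 * i + 1)) +
      d4 * u (node M a (2 * i) + node M a (2 * i + 1))"
    by blast
  have "laurent_eval M f z = d0 * z i + d1 + d2 * extend M a z (2 * i) +
      d3 * extend M a z (2 * i + 1) + d4 * extend M a z (2 * i) * extend M a z (2 * i + 1)"
    if "\<forall>i<M. z i \<noteq> 0" for z
    using d[of "mval M z"] laurent_eval_superset[OF finite_keys order.refl, of M f z] assms that
    by (simp add: mval_add mval_node mval_single mult.assoc)
  then show ?thesis by blast
qed

lemma laurent_eval_root:
  fixes f :: "'k::field laurent"
  assumes "1 < M" "Poly_Mapping.keys f \<subseteq> {mon 1 1, 0}"
  shows "laurent_eval M f z = look f (mon 1 1) * z 1 + look f 0"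
proof -
  have ne: "mon (1::nat) (1::int) \<noteq> 0" by (metis lookup_single_eq lookup_zero zero_neq_one)
  show ?thesis
    using laurent_eval_superset[OF _ assms(2), of M z] assms(1) ne by (simp add: mval_single)
qed

lemma (in abs_field) conv_power: "conv x y \<Longrightarrow> conv (\<lambda>n. x n ^ m) (y ^ m)"
  by (induction m) (auto simp: conv_mult)

section \<open>The absolute value of the field of complex p-adic numbers\<close>

locale padic = complex_padic_field p ord for p :: nat and ord :: "'k::{field_char_0, complete_space} \<Rightarrow> real" +
  assumes prime_p: "prime p"
begin

definition N :: "'k \<Rightarrow> real" where "N x = dist x 0"

lemma p_gt_1: "real p > 1" using prime_p prime_gt_1_nat by auto

lemma N_ord: "x \<noteq> 0 \<Longrightarrow> N x = real p powr (- ord x)"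
  using dist_ord[of x 0] by (simp add: N_def)

lemma dist_N: "dist x y = N (x - y)"
  using dist_ord[of x y] N_ord[of "x - y"] by (cases "x = y") (simp_all add: N_def)

lemma N_0 [simp]: "N x = 0 \<longleftrightarrow> x = 0" by (simp add: N_def)

lemma N_multiplicative: "N (x * y) = N x * N y"
proof (cases "x = 0 \<or> y = 0")
  case False
  then show ?thesis by (simp add: N_ord ord_mult powr_add[symmetric])
qed (auto simp: N_def)

lemma N_ultra: "N (x + y) \<le> max (N x) (N y)"
proof (cases "x = 0 \<or> y = 0 \<or> x + y = 0")
  case True
  then show ?thesis by (auto simp: N_def le_max_iff_disj)
next
  case False
  then have "- ord (x + y) \<le> max (- ord x) (- ord y)"
    using ord_add[of x y] by linarith
  then have "- ord (x + y) \<le> - ord x \<or> - ord (x + y) \<le> - ord y" by linarith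
  then show ?thesis using False p_gt_1 by (auto simp: N_ord le_max_iff_disj powr_mono)
qed

lemma N_p: "N (of_nat p) = 1 / p"
  using N_ord[of "of_nat p"] ord_p p_gt_1 by (auto simp: powr_minus field_simps)

sublocale abs_field N
proof
  show "\<exists>x. x \<noteq> 0 \<and> N x < 1"
    using N_p p_gt_1 by (intro exI[of _ "of_nat p"]) auto
  show "N (x + y) \<le> N x + N y" for x y
    using N_ultra[of x y] by (simp add: N_def max_def split: if_splits) (smt (verit) zero_le_dist)+
qed (auto simp: N_multiplicative, auto simp: N_def)

text \<open>
  Finitely many zeros are isolated, so the classification bounds their number.  The bound depends on the
  exponents at the leaves, but not on the coefficients; hence the maximal number of valuation vectors exists.
\<close>

theorem bounded_zeros:
  assumes M: "M = 2 ^ \<Delta>" "0 < \<Delta>" and a: "\<And>k. a k \<le> b"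
    and f: "f \<in> finite_systems M (tree_support M a)"
  shows "card (torus_zeros M (UNIV :: 'k set) (f ` {..<M})) \<le> (\<Delta> + 1) * 2 ^ \<Delta> * b"
proof -
  have M1: "1 < M" using M one_less_power[of "2::nat" \<Delta>] by simp
  define T where "T = torus_zeros M (UNIV :: 'k set) (f ` {..<M})"
  have fin: "finite T" and keys: "\<And>i. i < M \<Longrightarrow> Poly_Mapping.keys (f i) \<subseteq> tree_support M a i"
    using f by (auto simp: finite_systems_def T_def)
  have "\<forall>i. \<exists>d0 d1 d2 d3 d4. 0 < i \<and> i < M \<longrightarrow> (\<forall>z. (\<forall>i<M. z i \<noteq> 0) \<longrightarrow> laurent_eval M (f i) z =
    d0 * z i + d1 + d2 * extend M a z (2 * i) + d3 * extend M a z (2 * i + 1) +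
    d4 * extend M a z (2 * i) * extend M a z (2 * i + 1))"
    using laurent_eval_tree[OF M1 _ keys] by blast
  then obtain c0 c1 c2 c3 c4 where c: "\<And>i z. 0 < i \<Longrightarrow> i < M \<Longrightarrow> (\<forall>i<M. z i \<noteq> 0) \<Longrightarrow>
      laurent_eval M (f i) z =
      c0 i * z i + c1 i + c2 i * extend M a z (2 * i) + c3 i * extend M a z (2 * i + 1) +
      c4 i * extend M a z (2 * i) * extend M a z (2 * i + 1)"
    by metis
  define d0 where "d0 = look (f 0) (mon 1 1)"
  define d1 where "d1 = look (f 0) 0"
  have root: "laurent_eval M (f 0) z = d0 * z 1 + d1" for z
    using laurent_eval_root[OF M1, of "f 0" z] keys[of 0] M1
    by (simp add: d0_def d1_def tree_support_def)
  interpret power_tree N c0 c1 c2 c3 c4 a b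
  proof
    show "conv (\<lambda>n. x n ^ a k) (y ^ a k)" if "conv x y" for x y k
      using that by (rule conv_power)
  qed (rule a)
  have T: "z \<in> T \<longleftrightarrow> z \<in> {..<M} \<rightarrow>\<^sub>E UNIV - {0} \<and> (\<forall>i<M. laurent_eval M (f i) z = 0)" for z
    by (auto simp: T_def torus_zeros_def)
  have level: "at_level \<Delta> \<Delta> 1" by (rule at_level_root)
  have ext: "extend M a z i = z i" if "i < M" for z :: "nat \<Rightarrow> 'k" and i using that by (simp add: extend_def)
  have S: "sol \<Delta> 1 (extend M a z) \<and> d0 * extend M a z 1 + d1 = 0" if "z \<in> T" for z
  proof
    have nz: "\<forall>i<M. z i \<noteq> 0" using that T by (auto simp: PiE_iff)
    show "d0 * extend M a z 1 + d1 = 0" using that T M1 root by (auto simp: extend_def)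
    show "sol \<Delta> 1 (extend M a z)"
    proof (rule sol_at_level[OF _ _ level])
      fix j :: nat assume "0 < j" "j < 2 ^ \<Delta>"
      then show "c0 j * extend M a z j + form j (extend M a z (2 * j)) (extend M a z (2 * j + 1)) = 0"
        using c[of j z] nz T[of z] that M ext[of j z] by (simp add: form_def add.assoc)
    qed (use M M1 in \<open>auto simp: extend_def\<close>)
  qed
  have to_zero: "restrict Z {..<M} \<in> T \<and> (\<forall>i\<in>insert 0 (desc \<Delta> 1). extend M a (restrict Z {..<M}) i = Z i)"
    if "sol \<Delta> 1 Z" "d0 * Z 1 + d1 = 0" "\<And>i. i < M \<Longrightarrow> Z i \<noteq> 0" for Z
  proof
    let ?z = "restrict Z {..<M}"
    have agree: "extend M a ?z i = Z i" if "i \<in> insert 0 (desc \<Delta> 1)" for i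
      using sol_at_level_node[OF \<open>sol \<Delta> 1 Z\<close> level, of i] that M M1 by (auto simp: extend_def)
    then show "\<forall>i\<in>insert 0 (desc \<Delta> 1). extend M a ?z i = Z i" by blast
    have "laurent_eval M (f i) ?z = 0" if "i < M" for i
    proof (cases "i = 0")
      case True
      then show ?thesis using root[of ?z] that(1) \<open>d0 * Z 1 + d1 = 0\<close> M1 by simp
    next
      case False
      have "i \<in> desc \<Delta> 1" "2 * i \<in> desc \<Delta> 1" "2 * i + 1 \<in> desc \<Delta> 1"
        using False that M by (auto intro!: in_desc_one[of _ \<Delta>, simplified])
      then show ?thesis
        using c[of i ?z] False that \<open>\<And>i. i < M \<Longrightarrow> Z i \<noteq> 0\<close> agree M
          sol_at_level_node[OF \<open>sol \<Delta> 1 Z\<close> level, of i]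
        by (simp add: form_def add.assoc)
    qed
    then show "?z \<in> T" using T that(3) by (auto simp: PiE_iff)
  qed
  \<comment> \<open>The members of a sequence of solutions that converges to a zero z in the torus are eventually in the
      torus, hence zeros themselves, and eventually different from each of the finitely many other zeros.\<close>
  have iso: "isolated \<Delta> 1 d0 d1 (extend M a z)" if z: "z \<in> T" for z
    unfolding isolated_def
  proof (intro allI impI notI)
    fix Z assume Z: "tracks \<Delta> 1 (extend M a z) Z" "\<forall>\<^sub>F n in sequentially. d0 * Z n 1 + d1 = 0"
      "\<forall>\<^sub>F n in sequentially. \<exists>i\<in>insert 0 (desc \<Delta> 1). Z n i \<noteq> extend M a z i"
    have cv: "conv (\<lambda>n. Z n i) (extend M a z i)" if "i \<in> insert 0 (desc \<Delta> 1)" for i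
      using Z(1) that by (auto simp: tracks_def)
    have small: "i \<in> insert 0 (desc \<Delta> 1)" if "i < M" for i
      using in_desc_one[of i \<Delta>] that M by auto
    have "\<forall>\<^sub>F n in sequentially. \<forall>i\<in>{..<M}. Z n i \<noteq> 0"
    proof (rule eventually_ball_finite, safe)
      fix i assume "i < M"
      then have "extend M a z i \<noteq> 0" using z T by (auto simp: extend_def PiE_iff)
      then show "\<forall>\<^sub>F n in sequentially. Z n i \<noteq> 0"
        using conv_eventually_nonzero[OF cv[OF small]] \<open>i < M\<close> by blast
    qed
    moreover have "\<forall>\<^sub>F n in sequentially. \<forall>z'\<in>T. (\<exists>i\<in>insert 0 (desc \<Delta> 1). extend M a z' i \<noteq> extend M a z i) \<longrightarrow>
        (\<exists>i\<in>insert 0 (desc \<Delta> 1). Z n i \<noteq> extend M a z' i)"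
    proof (rule eventually_ball_finite[OF fin], rule ballI)
      fix z' assume "z' \<in> T"
      show "\<forall>\<^sub>F n in sequentially. (\<exists>i\<in>insert 0 (desc \<Delta> 1). extend M a z' i \<noteq> extend M a z i) \<longrightarrow>
        (\<exists>i\<in>insert 0 (desc \<Delta> 1). Z n i \<noteq> extend M a z' i)"
      proof (cases "\<exists>i\<in>insert 0 (desc \<Delta> 1). extend M a z' i \<noteq> extend M a z i")
        case True
        then obtain i where i: "i \<in> insert 0 (desc \<Delta> 1)" "extend M a z' i \<noteq> extend M a z i" by blast
        have "conv (\<lambda>n. Z n i - extend M a z' i) (extend M a z i - extend M a z' i)"
          by (intro conv_intros cv i)
        from conv_eventually_nonzero[OF this] i show ?thesis
          by (auto elim!: eventually_mono)
      qed auto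
    qed
    moreover have "\<forall>\<^sub>F n in sequentially. sol \<Delta> 1 (Z n)" using Z(1) by (simp add: tracks_def)
    ultimately have "\<forall>\<^sub>F n in sequentially. False"
      using Z(2,3)
    proof eventually_elim
      case (elim n)
      have "restrict (Z n) {..<M} \<in> T"
        "\<forall>i\<in>insert 0 (desc \<Delta> 1). extend M a (restrict (Z n) {..<M}) i = Z n i"
        using to_zero[OF elim(3,4)] elim(1) by auto
      then show False using elim(2,5) by metis
    qed
    then show False by simp
  qed
  have "card T = card (extend M a ` T)"
  proof (rule card_image[symmetric], rule inj_onI)
    fix z z' assume zz: "z \<in> T" "z' \<in> T" "extend M a z = extend M a z'"
    show "z = z'"
    proof (rule PiE_ext[of _ "{..<M}" "\<lambda>_. UNIV - {0}"])
      show "z i = z' i" if "i \<in> {..<M}" for i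
        using fun_cong[OF zz(3), of i] that by (simp add: ext)
    qed (use zz T in auto)
  qed
  also have "\<dots> \<le> (\<Delta> + 1) * 2 ^ \<Delta> * b"
  proof (rule card_rigid_solutions[of 1])
    show "sol \<Delta> 1 z \<and> d0 * z 1 + d1 = 0 \<and> isolated \<Delta> 1 d0 d1 z" if "z \<in> extend M a ` T" for z
      using that S iso by auto
    show "z = z'" if "z \<in> extend M a ` T" "z' \<in> extend M a ` T"
      "\<And>i. i \<in> insert 0 (desc \<Delta> 1) \<Longrightarrow> z i = z' i" for z z'
    proof
      fix i show "z i = z' i"
      proof (cases "i < M")
        case True
        then show ?thesis using that(3)[of i] in_desc_one[of i \<Delta>] M by auto
      next
        case False
        then show ?thesis using that(1,2) that(3)[of 0] M1 by (auto simp: extend_def)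
      qed
    qed
  qed simp
  finally show ?thesis by (simp add: T_def)
qed

end

section \<open>Points of transversal intersection\<close>

lemma dot_add: "dot n v (\<lambda>i. x i + s * y i) = dot n v x + s * dot n v y"
  by (simp add: dot_def algebra_simps sum.distrib sum_distrib_left)

lemma dot_cong: "(\<And>i. i < n \<Longrightarrow> x i = y i) \<Longrightarrow> dot n v x = dot n v y"
  by (simp add: dot_def)

text \<open>
  Linear dependence by elimination.  The number of coordinates is a variable, so the vectors are functions
  rather than elements of a type of fixed dimension.
\<close>

lemma more_vectors_than_coordinates:
  fixes v :: "'i \<Rightarrow> 'j \<Rightarrow> real"
  assumes "finite J" "finite I" "card J < card I"
  shows "\<exists>c. (\<exists>i\<in>I. c i \<noteq> 0) \<and> (\<forall>j\<in>J. (\<Sum>i\<in>I. c i * v i j) = 0)"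
  using assms
proof (induction J arbitrary: I v rule: finite_induct)
  case empty
  then have "I \<noteq> {}" by auto
  then obtain i where "i \<in> I" by blast
  then show ?case by (intro exI[of _ "\<lambda>_. 1"]) auto
next
  case (insert j J)
  show ?case
  proof (cases "\<forall>i\<in>I. v i j = 0")
    case True
    obtain c where "\<exists>i\<in>I. c i \<noteq> 0" "\<forall>j\<in>J. (\<Sum>i\<in>I. c i * v i j) = 0"
      using insert.IH[of I v] insert.prems insert.hyps by force
    then show ?thesis using True by (intro exI[of _ c]) auto
  next
    case False
    then obtain k where k: "k \<in> I" "v k j \<noteq> 0" by blast
    define v' where "v' i l = v i l - v i j / v k j * v k l" for i l
    have "card J < card (I - {k})" using insert.prems insert.hyps k by simp
    then obtain c where c: "\<exists>i\<in>I - {k}. c i \<noteq> 0" "\<forall>l\<in>J. (\<Sum>i\<in>I - {k}. c i * v' i l) = 0"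
      using insert.IH[of "I - {k}" v'] insert.prems by auto
    define c' where "c' = c(k := - (\<Sum>i\<in>I - {k}. c i * v i j) / v k j)"
    have eq: "(\<Sum>i\<in>I. c' i * v i l) = (\<Sum>i\<in>I - {k}. c i * v' i l)" for l
    proof -
      have "(\<Sum>i\<in>I. c' i * v i l) = c' k * v k l + (\<Sum>i\<in>I - {k}. c' i * v i l)"
        using k insert.prems by (simp add: sum.remove)
      also have "(\<Sum>i\<in>I - {k}. c' i * v i l) = (\<Sum>i\<in>I - {k}. c i * v i l)"
        by (intro sum.cong) (auto simp: c'_def)
      also have "c' k * v k l = - (\<Sum>i\<in>I - {k}. c i * v i j * (v k l / v k j))"
        unfolding sum_distrib_right[symmetric] by (simp add: c'_def)
      also have "\<dots> + (\<Sum>i\<in>I - {k}. c i * v i l) =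
          (\<Sum>i\<in>I - {k}. c i * v i l - c i * v i j * (v k l / v k j))"
        by (simp add: sum_subtractf)
      also have "\<dots> = (\<Sum>i\<in>I - {k}. c i * v' i l)"
        by (intro sum.cong) (simp_all add: v'_def algebra_simps)
      finally show ?thesis .
    qed
    have "(\<Sum>i\<in>I - {k}. c i * v' i j) = 0" using k by (simp add: v'_def)
    then have "\<forall>l\<in>insert j J. (\<Sum>i\<in>I. c' i * v i l) = 0" using c(2) eq by auto
    moreover have "\<exists>i\<in>I. c' i \<noteq> 0" using c(1) by (auto simp: c'_def)
    ultimately show ?thesis by blast
  qed
qed

lemma lin_independent_kernel:
  assumes "lin_independent n u" "\<And>i. i < n \<Longrightarrow> dot n (u i) d = 0" "j < n"
  shows "d j = 0"
proof (rule ccontr)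
  assume dj: "d j \<noteq> 0"
  have "card ({..<n} - {j}) < card {..<n}" using assms(3) by (simp add: card_Diff_subset)
  then obtain c where c: "\<exists>i\<in>{..<n}. c i \<noteq> 0"
      "\<forall>l\<in>{..<n} - {j}. (\<Sum>i\<in>{..<n}. c i * u i l) = 0"
    using more_vectors_than_coordinates[of "{..<n} - {j}" "{..<n}" u] by auto
  have "(\<Sum>i<n. c i * dot n (u i) d) = (\<Sum>l<n. (\<Sum>i<n. c i * u i l) * d l)"
    unfolding dot_def sum_distrib_left sum_distrib_right
    by (subst sum.swap) (simp add: mult.assoc)
  also have "\<dots> = (\<Sum>i<n. c i * u i j) * d j + (\<Sum>l\<in>{..<n} - {j}. (\<Sum>i<n. c i * u i l) * d l)"
    using assms(3) by (subst sum.remove[of _ j]) auto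
  also have "(\<Sum>l\<in>{..<n} - {j}. (\<Sum>i<n. c i * u i l) * d l) = 0"
    by (rule sum.neutral) (use c in auto)
  finally have "(\<Sum>i<n. c i * u i j) = 0" using dj assms(2) by simp
  then have "\<forall>l<n. (\<Sum>i<n. c i * u i l) = 0" using c(2) by (metis DiffI lessThan_iff singletonD)
  then show False using assms(1) c(1) by (auto simp: lin_independent_def)
qed

text \<open>
  A real vector space is not a finite union of proper subspaces.
\<close>

lemma avoid_hyperplanes:
  assumes "finite S" "U (\<lambda>i. 0)" "\<And>x y s. U x \<Longrightarrow> U y \<Longrightarrow> U (\<lambda>i. x i + s * y i)"
    and "\<And>v. v \<in> S \<Longrightarrow> \<exists>x. U x \<and> dot n v x \<noteq> 0"
  shows "\<exists>x. U x \<and> (\<forall>v\<in>S. dot n v x \<noteq> 0)"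
  using assms(1,4)
proof (induction S rule: finite_induct)
  case empty
  then show ?case using assms(2) by blast
next
  case (insert v S)
  obtain x where x: "U x" "\<forall>v\<in>S. dot n v x \<noteq> 0" using insert by auto
  obtain y where y: "U y" "dot n v y \<noteq> 0" using insert.prems by blast
  have "finite ((\<lambda>v. - dot n v x / dot n v y) ` insert v S)" using insert.hyps by simp
  then obtain s where s: "s \<notin> (\<lambda>v. - dot n v x / dot n v y) ` insert v S"
    using ex_new_if_finite infinite_UNIV_char_0 by blast
  have "dot n u (\<lambda>i. x i + s * y i) \<noteq> 0" if "u \<in> insert v S" for u
  proof
    assume *: "dot n u (\<lambda>i. x i + s * y i) = 0"
    then have "dot n u x + s * dot n u y = 0" by (simp add: dot_add)
    moreover have "dot n u y \<noteq> 0"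
    proof
      assume "dot n u y = 0"
      then show False using calculation x y that by auto
    qed
    ultimately have "s = - dot n u x / dot n u y" by (simp add: field_simps)
    then show False using s that by blast
  qed
  then show ?case using assms(3)[OF x(1) y(1)] by blast
qed

definition term_val :: "nat \<Rightarrow> ('k::field \<Rightarrow> real) \<Rightarrow> 'k laurent \<Rightarrow> (nat \<Rightarrow> real) \<Rightarrow> (nat \<Rightarrow>\<^sub>0 int) \<Rightarrow> real" where
  "term_val n ord f w e = ord (look f e) + dot n (\<lambda>i. of_int (look e i)) w"

definition tie :: "nat \<Rightarrow> ('k::field \<Rightarrow> real) \<Rightarrow> 'k laurent \<Rightarrow> (nat \<Rightarrow> real) \<Rightarrow>
    (nat \<Rightarrow>\<^sub>0 int) \<Rightarrow> (nat \<Rightarrow>\<^sub>0 int) \<Rightarrow> bool" where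
  "tie n ord f w a b \<longleftrightarrow> a \<in> Poly_Mapping.keys f \<and> b \<in> Poly_Mapping.keys f \<and> a \<noteq> b \<and>
     term_val n ord f w a = term_val n ord f w b \<and>
     (\<forall>e\<in>Poly_Mapping.keys f. term_val n ord f w a \<le> term_val n ord f w e)"

lemma closed_tie: "closed {w. \<exists>a b. tie n ord f w a b}"
proof -
  let ?K = "Poly_Mapping.keys f"
  have c: "continuous_on UNIV (\<lambda>w. term_val n ord f w e)" for e
    unfolding term_val_def dot_def by (intro continuous_intros continuous_on_product_coordinates)
  have "{w. \<exists>a b. tie n ord f w a b} =
      (\<Union>a\<in>?K. \<Union>b\<in>?K - {a}. {w. term_val n ord f w a = term_val n ord f w b} \<inter>
        (\<Inter>e\<in>?K. {w. term_val n ord f w a \<le> term_val n ord f w e}))"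
    by (auto simp: tie_def)
  also have "closed \<dots>"
    by (intro closed_UN ballI finite_keys finite_Diff closed_Int closed_INT closed_Collect_eq
        closed_Collect_le c)
  finally show ?thesis .
qed

context padic
begin

lemma ord_1 [simp]: "ord 1 = 0"
  using ord_mult[of 1 1] by simp

lemma ord_power: "x \<noteq> 0 \<Longrightarrow> ord (x ^ m) = real m * ord x"
  by (induction m) (auto simp: ord_mult algebra_simps)

lemma ord_inverse: "x \<noteq> 0 \<Longrightarrow> ord (inverse x) = - ord x"
  using ord_mult[of x "inverse x"] by simp

lemma ord_power_int: "x \<noteq> 0 \<Longrightarrow> ord (x powi m) = of_int m * ord x"
  by (auto simp: power_int_def ord_power ord_inverse)

lemma ord_prod: "(\<And>i. i \<in> I \<Longrightarrow> x i \<noteq> 0) \<Longrightarrow> ord (\<Prod>i\<in>I. x i) = (\<Sum>i\<in>I. ord (x i))"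
  by (induction I rule: infinite_finite_induct) (auto simp: ord_mult)

lemma N_sum_less: "r > 0 \<Longrightarrow> (\<And>e. e \<in> A \<Longrightarrow> N (t e) < r) \<Longrightarrow> N (\<Sum>e\<in>A. t e) < r"
proof (induction A rule: infinite_finite_induct)
  case (insert e A)
  then show ?case using N_ultra[of "t e" "\<Sum>e\<in>A. t e"] by fastforce
qed auto

lemma N_less_iff: "x \<noteq> 0 \<Longrightarrow> y \<noteq> 0 \<Longrightarrow> N x < N y \<longleftrightarrow> ord y < ord x"
  using p_gt_1 by (simp add: N_ord)

text \<open>
  By the ultrametric inequality, terms with sum 0 cannot contain a single term of smallest valuation.
\<close>

lemma zero_tie:
  assumes z: "z \<in> torus_zeros n (UNIV :: 'k set) {f}" and f: "f \<noteq> 0"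
  shows "\<exists>a b. tie n ord f (ord_vec n ord z) a b"
proof -
  let ?K = "Poly_Mapping.keys f" and ?w = "ord_vec n ord z"
  define t where "t e = look f e * mval n z e" for e
  have nz: "z i \<noteq> 0" if "i < n" for i using z that by (auto simp: torus_zeros_def PiE_iff)
  have mv: "mval n z e \<noteq> 0" for e using nz by (auto simp: mval_def)
  have t: "t e \<noteq> 0 \<and> ord (t e) = term_val n ord f ?w e" if "e \<in> ?K" for e
  proof -
    have "ord (mval n z e) = (\<Sum>i<n. of_int (look e i) * ord (z i))"
      unfolding mval_def by (subst ord_prod) (auto simp: ord_power_int nz)
    then show ?thesis
      using that mv[of e] by (simp add: t_def ord_mult in_keys_iff term_val_def dot_def ord_vec_def)
  qed
  have ne: "?K \<noteq> {}" using f by simp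
  then obtain a where a: "a \<in> ?K" "\<And>e. e \<in> ?K \<Longrightarrow> term_val n ord f ?w a \<le> term_val n ord f ?w e"
    by (metis finite_keys arg_min_if_finite(1) arg_min_least)
  have "\<exists>b\<in>?K - {a}. term_val n ord f ?w b \<le> term_val n ord f ?w a"
  proof (rule ccontr)
    assume "\<not> ?thesis"
    then have "N (t e) < N (t a)" if "e \<in> ?K - {a}" for e
      using that t[of e] t[OF a(1)] by (subst N_less_iff) (auto simp: not_le)
    then have "N (\<Sum>e\<in>?K - {a}. t e) < N (t a)"
      using t[OF a(1)] by (intro N_sum_less) (auto simp: N_def)
    moreover have "t a + (\<Sum>e\<in>?K - {a}. t e) = 0"
      using sum.remove[OF finite_keys a(1), of t] z
      by (simp add: torus_zeros_def laurent_eval_def t_def mval_def)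
    ultimately show False
      by (metis N_uminus eq_neg_iff_add_eq_0 less_irrefl)
  qed
  then show ?thesis using a unfolding tie_def by (metis DiffD1 DiffD2 antisym singletonI)
qed

lemma tropical_set_subset_ties: "f \<noteq> 0 \<Longrightarrow> tropical_set n ord f \<subseteq> {w. \<exists>a b. tie n ord f w a b}"
  unfolding tropical_set_def by (rule closure_minimal[OF _ closed_tie]) (use zero_tie in auto)

text \<open>
  The tropical set of the zero polynomial contains all points \<open>(s, s\<^sup>2, \<dots>, s\<^sup>n)\<close> of the moment
  curve, of which any hyperplane contains only finitely many.
\<close>

lemma zero_not_positive_codim:
  assumes "finite C" "positive_codim n C" "\<Union> C = tropical_set n ord (0 :: 'k laurent)"
  shows False
proof -
  define w where "w s = (\<lambda>i\<in>{..<n}. real s ^ Suc i)" for s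
  have "w s \<in> tropical_set n ord (0 :: 'k laurent)" for s
  proof -
    define z where "z = (\<lambda>i\<in>{..<n}. (of_nat p :: 'k) ^ (s ^ Suc i))"
    have p0: "(of_nat p :: 'k) \<noteq> 0" using prime_p by auto
    have "z \<in> torus_zeros n UNIV {0}"
      using p0 by (auto simp: torus_zeros_def laurent_eval_def z_def)
    moreover have "ord_vec n ord z = w s"
      using p0 by (auto simp: ord_vec_def z_def w_def ord_power ord_p)
    ultimately have "w s \<in> ord_vec n ord ` torus_zeros n UNIV {0 :: 'k laurent}"
      by (metis imageI)
    then show ?thesis unfolding tropical_set_def by (rule closure_subset[THEN subsetD])
  qed
  then have "\<exists>P\<in>C. w s \<in> P" for s using assms(3) by (metis UnionE)
  then have cover: "(\<Union>P\<in>C. {s. w s \<in> P}) = UNIV" by auto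
  have "finite {s. w s \<in> P}" if "P \<in> C" for P
  proof -
    obtain u b where u: "nonzero_vec n u" "\<forall>v\<in>P. dot n u v = b"
      using assms(2) \<open>P \<in> C\<close> unfolding positive_codim_def by blast
    define g where "g = (\<Sum>i<n. monom (u i) (Suc i)) - [:b:]"
    obtain i where i: "i < n" "u i \<noteq> 0" using u(1) by (auto simp: nonzero_vec_def)
    have "coeff g (Suc i) = u i" using i by (simp add: g_def coeff_sum)
    then have "g \<noteq> 0" using i by auto
    have "poly g (real s) = dot n u (w s) - b" for s
      by (simp add: g_def poly_sum poly_monom dot_def w_def mult.commute)
    then have "{s. w s \<in> P} \<subseteq> real -` {x. poly g x = 0}" using u(2) by auto
    moreover have "finite (real -` {x. poly g x = 0})"
      using poly_roots_finite[OF \<open>g \<noteq> 0\<close>] by (intro finite_vimageI) (auto simp: inj_on_def)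
    ultimately show ?thesis by (rule finite_subset)
  qed
  then have "finite (\<Union>P\<in>C. {s. w s \<in> P})" using assms(1) by simp
  then show False by (simp add: cover)
qed

text \<open>
  If every pair of tied terms at \<open>w\<close> had exponents with a difference that is not normal to the cell, some
  direction in the cell would separate all these pairs at once.  A small step in this direction stays within
  the cell, where terms must be tied, but only terms that are minimal at \<open>w\<close> can be minimal near \<open>w\<close>.
\<close>

lemma tie_normal:
  assumes f: "f \<noteq> 0" and P: "P \<subseteq> tropical_set n ord f" and w: "w \<in> euclid n"
    and int: "rel_interior_hyper n P u w"
  shows "\<exists>a b. tie n ord f w a b \<and> (\<forall>d. dot n u d = 0 \<longrightarrow> dot n (\<lambda>i. of_int (look a i - look b i)) d = 0)"
proof (rule ccontr)
  assume no: "\<not> ?thesis"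
  let ?K = "Poly_Mapping.keys f" and ?v = "\<lambda>a b i. real_of_int (look a i - look b i)"
  obtain e where e: "e > 0" "\<And>v. v \<in> euclid n \<Longrightarrow> dot n u v = dot n u w \<Longrightarrow>
      (\<forall>i<n. \<bar>v i - w i\<bar> < e) \<Longrightarrow> v \<in> P"
    using int unfolding rel_interior_hyper_def by blast
  define S where "S = (\<lambda>(a, b). ?v a b) ` {(a, b) \<in> ?K \<times> ?K. tie n ord f w a b}"
  have finS: "finite S"
    unfolding S_def by (intro finite_imageI) (rule finite_subset[of _ "?K \<times> ?K"], auto)
  obtain d where d: "dot n u d = 0" "\<And>v. v \<in> S \<Longrightarrow> dot n v d \<noteq> 0"
  proof -
    have "\<exists>x. dot n u x = 0 \<and> (\<forall>v\<in>S. dot n v x \<noteq> 0)"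
    proof (rule avoid_hyperplanes[OF finS])
      show "\<exists>x. dot n u x = 0 \<and> dot n v x \<noteq> 0" if "v \<in> S" for v
        using no that by (auto simp: S_def)
    qed (auto simp: dot_add, simp add: dot_def)
    then show ?thesis using that by blast
  qed
  define x where "x s = (\<lambda>i\<in>{..<n}. w i + s * d i)" for s
  have tv: "term_val n ord f (x s) c = term_val n ord f w c + s * dot n (\<lambda>i. of_int (look c i)) d" for s c
  proof -
    have "dot n v (x s) = dot n v (\<lambda>i. w i + s * d i)" for v
      by (rule dot_cong) (simp add: x_def)
    then show ?thesis by (simp add: term_val_def dot_add)
  qed
  have dotx: "dot n u (x s) = dot n u w" for s
  proof -
    have "dot n u (x s) = dot n u (\<lambda>i. w i + s * d i)"
      by (rule dot_cong) (simp add: x_def)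
    then show ?thesis using d(1) by (simp add: dot_add)
  qed
  \<comment> \<open>For small positive s, the terms minimal at the displaced point are minimal at w.\<close>
  have small1: "\<forall>\<^sub>F s in at_right 0. \<forall>i\<in>{..<n}. \<bar>x s i - w i\<bar> < e"
  proof (rule eventually_ball_finite, simp, rule ballI)
    fix i assume "i \<in> {..<n}"
    have "((\<lambda>s. \<bar>s * d i\<bar>) \<longlongrightarrow> \<bar>0 * d i\<bar>) (at_right 0)" by (intro tendsto_intros)
    then have "\<forall>\<^sub>F s in at_right 0. \<bar>s * d i\<bar> < e"
      using e(1) by (intro order_tendstoD(2)) auto
    then show "\<forall>\<^sub>F s in at_right 0. \<bar>x s i - w i\<bar> < e"
      by eventually_elim (use \<open>i \<in> {..<n}\<close> in \<open>simp add: x_def\<close>)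
  qed
  have small2: "\<forall>\<^sub>F s in at_right 0. \<forall>c\<in>?K \<times> ?K. term_val n ord f w (fst c) < term_val n ord f w (snd c) \<longrightarrow>
      term_val n ord f (x s) (fst c) < term_val n ord f (x s) (snd c)"
  proof (rule eventually_ball_finite, simp, rule ballI)
    fix c assume "c \<in> ?K \<times> ?K"
    show "\<forall>\<^sub>F s in at_right 0. term_val n ord f w (fst c) < term_val n ord f w (snd c) \<longrightarrow>
      term_val n ord f (x s) (fst c) < term_val n ord f (x s) (snd c)"
    proof (cases "term_val n ord f w (fst c) < term_val n ord f w (snd c)")
      case True
      have lim: "((\<lambda>s. term_val n ord f (x s) (snd c) - term_val n ord f (x s) (fst c)) \<longlongrightarrow>
          (term_val n ord f w (snd c) + 0 * dot n (\<lambda>i. of_int (look (snd c) i)) d) -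
          (term_val n ord f w (fst c) + 0 * dot n (\<lambda>i. of_int (look (fst c) i)) d)) (at_right 0)"
        unfolding tv by (intro tendsto_intros)
      have "\<forall>\<^sub>F s in at_right 0. term_val n ord f (x s) (snd c) - term_val n ord f (x s) (fst c) > 0"
        by (rule order_tendstoD(1)[OF lim]) (use True in simp)
      then show ?thesis by eventually_elim simp
    qed simp
  qed
  have "\<forall>\<^sub>F s in at_right (0::real). s > 0" by (simp add: eventually_at_right_less)
  then have "\<forall>\<^sub>F s in at_right 0. s > 0 \<and> (\<forall>i\<in>{..<n}. \<bar>x s i - w i\<bar> < e) \<and>
      (\<forall>c\<in>?K \<times> ?K. term_val n ord f w (fst c) < term_val n ord f w (snd c) \<longrightarrow>
        term_val n ord f (x s) (fst c) < term_val n ord f (x s) (snd c))"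
    using small1 small2 by eventually_elim blast
  from eventually_happens'[OF _ this]
  obtain s where s0: "s > 0" "\<forall>i\<in>{..<n}. \<bar>x s i - w i\<bar> < e"
      "\<forall>c\<in>?K \<times> ?K. term_val n ord f w (fst c) < term_val n ord f w (snd c) \<longrightarrow>
        term_val n ord f (x s) (fst c) < term_val n ord f (x s) (snd c)"
    by (auto simp: trivial_limit_at_right_real)
  have s: "s > 0" "\<forall>i\<in>{..<n}. \<bar>x s i - w i\<bar> < e"
      "\<And>a b. a \<in> ?K \<Longrightarrow> b \<in> ?K \<Longrightarrow> term_val n ord f w a < term_val n ord f w b \<Longrightarrow>
        term_val n ord f (x s) a < term_val n ord f (x s) b"
    using s0 by auto
  have "x s \<in> P"
    by (rule e(2)) (use s(2) dotx in \<open>auto simp: x_def euclid_def\<close>)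
  then obtain a b where ab: "tie n ord f (x s) a b"
    using P tropical_set_subset_ties[OF f] by blast
  have min: "term_val n ord f w c \<le> term_val n ord f w c'" if "c = a \<or> c = b" "c' \<in> ?K" for c c'
  proof (rule ccontr)
    assume "\<not> ?thesis"
    then have "term_val n ord f (x s) c' < term_val n ord f (x s) c"
      using s(3)[of c' c] that ab by (auto simp: tie_def)
    then show False using ab that unfolding tie_def by fastforce
  qed
  have ab': "a \<in> ?K" "b \<in> ?K" "a \<noteq> b" "term_val n ord f (x s) a = term_val n ord f (x s) b"
    using ab by (auto simp: tie_def)
  have eq: "term_val n ord f w a = term_val n ord f w b"
    using min[of a b] min[of b a] ab' by fastforce
  then have "tie n ord f w a b" using ab' min unfolding tie_def by blast
  then have "?v a b \<in> S" using ab' unfolding S_def by force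
  moreover have "dot n (?v a b) d = 0"
  proof -
    have "s * dot n (\<lambda>i. of_int (look a i)) d = s * dot n (\<lambda>i. of_int (look b i)) d"
      using ab'(4) eq by (simp add: tv)
    then show ?thesis using s(1) by (simp add: dot_def left_diff_distrib sum_subtractf)
  qed
  ultimately show False using d(2) by blast
qed

text \<open>
  The difference of the two tied exponents in an equation is not 0 and vanishes on the hyperplane of the cell,
  so it is a multiple of the normal vector of the cell.  Transversality thus makes the differences of exponents
  linearly independent.
\<close>

theorem generic_ties:
  assumes f: "tropically_generic n ord f" and exps: "\<And>i. i < n \<Longrightarrow> Poly_Mapping.keys (f i) \<subseteq> exponents n"
    and z: "z \<in> torus_zeros n (UNIV :: 'k set) (f ` {..<n})"
  shows "\<exists>a b. (\<forall>i<n. tie n ord (f i) (ord_vec n ord z) (a i) (b i)) \<and>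
    (\<forall>d. (\<forall>i<n. dot n (\<lambda>j. of_int (look (a i) j - look (b i) j)) d = 0) \<longrightarrow> (\<forall>j<n. d j = 0))"
proof -
  let ?w = "ord_vec n ord z"
  obtain C where C: "\<And>i. i < n \<Longrightarrow> polyhedral_complex n (C i) \<and> positive_codim n (C i) \<and>
      \<Union> (C i) = tropical_set n ord (f i)"
    and T: "\<forall>w\<in>euclid n. (\<forall>i<n. w \<in> tropical_set n ord (f i)) \<longrightarrow>
      (\<exists>P u. (\<forall>i<n. P i \<in> C i \<and> rel_interior_hyper n (P i) (u i) w) \<and> lin_independent n u)"
    using f unfolding tropically_generic_def by auto
  have w: "?w \<in> euclid n" by (auto simp: euclid_def ord_vec_def)
  have "?w \<in> tropical_set n ord (f i)" if "i < n" for i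
    unfolding tropical_set_def using z that
    by (intro closure_subset[THEN subsetD] imageI) (auto simp: torus_zeros_def)
  then obtain P u where P: "\<And>i. i < n \<Longrightarrow> P i \<in> C i \<and> rel_interior_hyper n (P i) (u i) ?w"
    and u: "lin_independent n u"
    using T w by blast
  have nz: "f i \<noteq> 0" if "i < n" for i
  proof
    assume "f i = 0"
    then show False
      using zero_not_positive_codim[of "C i" n] C[OF that] by (simp add: polyhedral_complex_def)
  qed
  have sub: "P i \<subseteq> tropical_set n ord (f i)" if "i < n" for i
    using C[OF that] P[OF that] by blast
  have "\<forall>i. \<exists>a b. i < n \<longrightarrow> tie n ord (f i) ?w a b \<and>
      (\<forall>d. dot n (u i) d = 0 \<longrightarrow> dot n (\<lambda>j. of_int (look a j - look b j)) d = 0)"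
    using tie_normal[OF nz sub w] P by blast
  then obtain a b where ab: "\<And>i. i < n \<Longrightarrow> tie n ord (f i) ?w (a i) (b i)"
      "\<And>i d. i < n \<Longrightarrow> dot n (u i) d = 0 \<Longrightarrow> dot n (\<lambda>j. of_int (look (a i) j - look (b i) j)) d = 0"
    by metis
  have "\<forall>j<n. d j = 0" if d: "\<forall>i<n. dot n (\<lambda>j. of_int (look (a i) j - look (b i) j)) d = 0" for d
  proof -
    have "dot n (u i) d = 0" if i: "i < n" for i
    proof (rule ccontr)
      assume ud: "dot n (u i) d \<noteq> 0"
      let ?v = "\<lambda>j. real_of_int (look (a i) j - look (b i) j)"
      have "a i \<noteq> b i" "a i \<in> exponents n" "b i \<in> exponents n"
        using ab(1)[OF i] exps[OF i] by (auto simp: tie_def)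
      then obtain j where j: "look (a i) j \<noteq> look (b i) j"
        using poly_mapping_eqI[of "a i" "b i"] by blast
      then have "j \<in> Poly_Mapping.keys (a i) \<or> j \<in> Poly_Mapping.keys (b i)" by (auto simp: in_keys_iff)
      then have jn: "j < n"
        using \<open>a i \<in> exponents n\<close> \<open>b i \<in> exponents n\<close> by (auto simp: exponents_def)
      \<comment> \<open>The unit vector of index j, corrected by a multiple of d so that it is orthogonal to u i.\<close>
      define x where "x l = (if l = j then 1 else 0) + (- u i j / dot n (u i) d) * d l" for l
      have unit: "dot n v (\<lambda>l. if l = j then 1 else 0) = v j" for v
      proof -
        have "dot n v (\<lambda>l. if l = j then 1 else 0) = (\<Sum>l<n. if l = j then v l else 0)"
          unfolding dot_def by (intro sum.cong) auto
        then show ?thesis using jn by simp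
      qed
      have "dot n (u i) x = 0"
        unfolding x_def dot_add unit using ud by simp
      then have "dot n ?v x = 0" by (rule ab(2)[OF i])
      then have "?v j = 0" unfolding x_def dot_add unit using d i by simp
      then show False using j by simp
    qed
    then show ?thesis using lin_independent_kernel[OF u, of d] by simp
  qed
  with ab(1) have "(\<forall>i<n. tie n ord (f i) ?w (a i) (b i)) \<and>
    (\<forall>d. (\<forall>i<n. dot n (\<lambda>j. of_int (look (a i) j - look (b i) j)) d = 0) \<longrightarrow> (\<forall>j<n. d j = 0))"
    by simp
  then show ?thesis by (intro exI)
qed

end

section \<open>Breakpoints of piecewise affine functions\<close>

text \<open>
  Affinity up to the end points of the intervals makes a function that is affine off a finite set continuous.
\<close>

definition affine_off :: "real set \<Rightarrow> (real \<Rightarrow> real) \<Rightarrow> bool" where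
  "affine_off Y g \<longleftrightarrow> (\<forall>u v. u < v \<longrightarrow> Y \<inter> {u<..<v} = {} \<longrightarrow>
     (\<exists>s t. \<forall>x\<in>{u..v}. g x = s * x + t))"

text \<open>
  For \<open>g\<close> affine off a finite set \<open>Y\<close>, these are the zeros outside \<open>Y\<close> at which \<open>g\<close> has nonzero slope.
\<close>

definition cross :: "real set \<Rightarrow> (real \<Rightarrow> real) \<Rightarrow> real set" where
  "cross Y g = {x. x \<notin> Y \<and> g x = 0 \<and> (\<forall>e>0. \<exists>y. \<bar>y - x\<bar> < e \<and> g y \<noteq> 0)}"

lemma affine_off_mono: "affine_off Y g \<Longrightarrow> Y \<subseteq> Y' \<Longrightarrow> affine_off Y' g"
  unfolding affine_off_def by (metis Int_mono bot.extremum_uniqueI order_refl)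

lemma affine_off_linear: "affine_off Y (\<lambda>x. c * x)"
  unfolding affine_off_def by (intro allI impI exI[of _ c] exI[of _ 0]) auto

lemma affine_off_const: "affine_off Y (\<lambda>x. c)"
  unfolding affine_off_def by (intro allI impI exI[of _ 0] exI[of _ c]) auto

lemma affine_off_comb:
  assumes "affine_off Y f" "affine_off Y g"
  shows "affine_off Y (\<lambda>x. c + a * f x + b * g x)"
  unfolding affine_off_def
proof (intro allI impI)
  fix u v :: real assume uv: "u < v" "Y \<inter> {u<..<v} = {}"
  obtain s t where f: "\<forall>x\<in>{u..v}. f x = s * x + t"
    using assms(1) uv unfolding affine_off_def by blast
  obtain s' t' where g: "\<forall>x\<in>{u..v}. g x = s' * x + t'"
    using assms(2) uv unfolding affine_off_def by blast
  have "\<forall>x\<in>{u..v}. c + a * f x + b * g x = (a * s + b * s') * x + (c + a * t + b * t')"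
    using f g by (simp add: algebra_simps)
  then show "\<exists>s t. \<forall>x\<in>{u..v}. c + a * f x + b * g x = s * x + t" by blast
qed

lemma gap_around:
  assumes "finite Y" "x \<notin> Y"
  obtains e :: real where "e > 0" "Y \<inter> {x - e..x + e} = {}"
proof -
  obtain e where e: "e > 0" "\<forall>y\<in>Y. y \<noteq> x \<longrightarrow> e \<le> dist x y"
    using finite_set_avoid[OF assms(1)] by blast
  have "Y \<inter> {x - e/2..x + e/2} = {}"
    using e assms(2) by (force simp: dist_real_def abs_if split: if_splits)
  then show ?thesis using that[of "e/2"] e(1) by simp
qed

lemma affine_near:
  assumes "affine_off Y g" "finite Y" "x \<notin> Y"
  shows "\<exists>e>0. \<exists>s. \<forall>y. \<bar>y - x\<bar> \<le> e \<longrightarrow> g y = g x + s * (y - x)"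
proof -
  obtain e where e: "e > 0" "Y \<inter> {x - e..x + e} = {}" by (rule gap_around[OF assms(2,3)])
  then have "Y \<inter> {x - e<..<x + e} = {}" "x - e < x + e" by auto
  then obtain s t where st: "\<forall>y\<in>{x - e..x + e}. g y = s * y + t"
    using assms(1) unfolding affine_off_def by blast
  have "g y = g x + s * (y - x)" if "\<bar>y - x\<bar> \<le> e" for y
  proof -
    have "g y = s * y + t" "g x = s * x + t" using st that e(1) by (auto simp: abs_le_iff)
    then show ?thesis by (simp add: algebra_simps)
  qed
  then show ?thesis using e(1) by blast
qed

text \<open>
  A nonzero affine function has at most one zero, so an element of \<open>cross Y g\<close> is determined by the number of
  points of \<open>Y\<close> to its left.
\<close>

lemma card_cross:
  assumes "affine_off Y g" "finite Y"
  shows "finite (cross Y g) \<and> card (cross Y g) \<le> card Y + 1"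
proof -
  let ?m = "\<lambda>x. card {y \<in> Y. y < x}"
  have less: "?m x \<noteq> ?m x'" if x: "x \<in> cross Y g" "x' \<in> cross Y g" "x < x'" for x x'
  proof
    assume eq: "?m x = ?m x'"
    have "{y \<in> Y. y < x} \<subseteq> {y \<in> Y. y < x'}" using x(3) by auto
    then have same: "{y \<in> Y. y < x} = {y \<in> Y. y < x'}"
      using eq assms(2) by (intro card_subset_eq) auto
    have xY: "x \<notin> Y" "x' \<notin> Y" "g x = 0" "g x' = 0" using x by (auto simp: cross_def)
    obtain e where e: "e > 0" "Y \<inter> {x - e..x + e} = {}" by (rule gap_around[OF assms(2) xY(1)])
    have "y \<notin> {x - e<..<x'}" if "y \<in> Y" for y
    proof
      assume y: "y \<in> {x - e<..<x'}"
      then have "y < x" using same that by auto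
      then show False using e y that by auto
    qed
    then have "Y \<inter> {x - e<..<x'} = {}" by blast
    moreover have "x - e < x'" using e(1) x(3) by simp
    ultimately obtain s t where st: "\<forall>y\<in>{x - e..x'}. g y = s * y + t"
      using assms(1) unfolding affine_off_def by blast
    then have "s * x + t = 0" "s * x' + t = 0" using xY e(1) x(3) by force+
    then have "s * x = s * x'" by linarith
    then have "s * (x' - x) = 0" by (simp only: right_diff_distrib)
    then have "s = 0" "t = 0" using x(3) \<open>s * x + t = 0\<close> by auto
    moreover have "min e (x' - x) > 0" using e(1) x(3) by simp
    then obtain y where "\<bar>y - x\<bar> < min e (x' - x)" "g y \<noteq> 0"
      using x(1) unfolding cross_def by blast
    ultimately show False using st by (auto simp: abs_less_iff)
  qed
  have inj: "inj_on ?m (cross Y g)"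
  proof (rule inj_onI)
    fix x x' assume "x \<in> cross Y g" "x' \<in> cross Y g" "?m x = ?m x'"
    then show "x = x'" using less[of x x'] less[of x' x] by (cases x x' rule: linorder_cases) auto
  qed
  have sub: "?m ` cross Y g \<subseteq> {..card Y}"
    using assms(2) by (auto intro!: card_mono)
  have "finite (cross Y g)" using inj sub by (meson finite_atMost inj_on_finite)
  moreover have "card (cross Y g) \<le> card {..card Y}" using inj sub by (meson card_inj_on_le finite_atMost)
  ultimately show ?thesis by simp
qed

lemma zero_in_cross:
  assumes "\<forall>x\<in>{u..v}. g x = s * x + t" "r \<in> {u<..<v}" "g r = 0" "r \<notin> Y" "x \<in> {u..v}" "g x \<noteq> 0"
  shows "r \<in> cross Y g"
proof -
  have r: "s * r + t = 0" using assms(1,2,3) by auto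
  have "s \<noteq> 0" using assms(1,5,6) r by auto
  have "\<exists>y. \<bar>y - r\<bar> < e \<and> g y \<noteq> 0" if "e > 0" for e
  proof -
    define d where "d = min e (v - r) / 2"
    have d: "d > 0" "d < e" "r + d \<le> v" using that assms(2) by (auto simp: d_def min_def field_simps)
    have "g (r + d) = s * d" using assms(1,2) d r by (simp add: algebra_simps)
    then show ?thesis using d \<open>s \<noteq> 0\<close> by (intro exI[of _ "r + d"]) auto
  qed
  then show ?thesis using assms(3,4) by (auto simp: cross_def)
qed

text \<open>The minimum of finitely many piecewise affine functions breaks only where two of them cross.\<close>

lemma affine_off_Min:
  assumes T: "finite T" "T \<noteq> {}" and m: "\<And>t. t \<in> T \<Longrightarrow> affine_off Y (m t)"
  shows "affine_off (Y \<union> (\<Union>t\<in>T. \<Union>t'\<in>T. cross Y (\<lambda>x. m t' x - m t x))) (\<lambda>x. Min ((\<lambda>t. m t x) ` T))"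
  unfolding affine_off_def
proof (intro allI impI)
  fix u v :: real
  assume uv: "u < v"
    and gap: "(Y \<union> (\<Union>t\<in>T. \<Union>t'\<in>T. cross Y (\<lambda>x. m t' x - m t x))) \<inter> {u<..<v} = {}"
  define c where "c = (u + v) / 2"
  have c: "c \<in> {u<..<v}" using uv by (simp add: c_def)
  define t where "t = arg_min_on (\<lambda>t. m t c) T"
  have t: "t \<in> T" "\<And>t'. t' \<in> T \<Longrightarrow> m t c \<le> m t' c"
    unfolding t_def using T arg_min_if_finite(1) arg_min_least[of T _ "\<lambda>t. m t c"] by blast+
  have gapY: "Y \<inter> {u<..<v} = {}" using gap by blast
  have le: "m t x \<le> m t' x" if x: "x \<in> {u..v}" and t': "t' \<in> T" for x t'
  proof (rule ccontr)
    assume neg: "\<not> m t x \<le> m t' x"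
    let ?g = "\<lambda>x. m t' x - m t x"
    have "affine_off Y (\<lambda>x. 0 + 1 * m t' x + (-1) * m t x)" by (intro affine_off_comb m t' t(1))
    then have "affine_off Y ?g" by simp
    then obtain s d where sd: "\<forall>x\<in>{u..v}. ?g x = s * x + d"
      using uv gapY unfolding affine_off_def by blast
    have "?g c = s * c + d" "?g x = s * x + d" using sd c x by auto
    then have gc: "s * c + d \<ge> 0" and gx: "s * x + d < 0"
      using t(2)[OF t'] neg by linarith+
    then have s0: "s \<noteq> 0" by auto
    define r where "r = - d / s"
    have r: "s * r + d = 0" using s0 by (simp add: r_def)
    have gr: "s * (c - r) \<ge> 0" "s * (x - r) < 0" using gc gx r by (simp_all add: algebra_simps)
    have "(x < r \<and> r \<le> c) \<or> (c \<le> r \<and> r < x)"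
      using gr by (auto simp: zero_le_mult_iff mult_less_0_iff)
    then have rin: "r \<in> {u<..<v}" using c x by auto
    moreover have "?g r = 0" using sd rin r by auto
    moreover have "r \<notin> Y" using rin gapY by blast
    ultimately have "r \<in> cross Y ?g"
      using zero_in_cross[OF sd rin _ _ x] neg by simp
    then show False using gap rin t(1) t' by blast
  qed
  have "Min ((\<lambda>t. m t x) ` T) = m t x" if "x \<in> {u..v}" for x
    by (rule Min_eqI) (use T le[OF that] t(1) in auto)
  moreover obtain s d where "\<forall>x\<in>{u..v}. m t x = s * x + d"
    using m[OF t(1)] uv gapY unfolding affine_off_def by blast
  ultimately show "\<exists>s d. \<forall>x\<in>{u..v}. Min ((\<lambda>t. m t x) ` T) = s * x + d" by auto
qed

section \<open>Counting tropical solutions\<close>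

text \<open>
  The tropical version of a system on a tree.  A pair \<open>t\<close> in \<open>T k\<close> stands for a term of the equation of
  \<open>k\<close> in which the left child occurs with exponent \<open>fst t\<close> and the right child with exponent \<open>snd t\<close>; the
  valuation \<open>cf k t\<close> of its coefficient is taken relative to that of the coefficient of the node \<open>k\<close>.
\<close>

locale tropical_tree =
  fixes T :: "nat \<Rightarrow> (nat \<times> nat) set" and cf :: "nat \<Rightarrow> nat \<times> nat \<Rightarrow> real" and a :: "nat \<Rightarrow> nat"
  assumes T_sub: "T k \<subseteq> {0, 1} \<times> {0, 1}"
begin

lemma finite_T [simp]: "finite (T k)"
  using T_sub by (rule finite_subset) simp

lemma card_T: "card (T k) \<le> 4"
  using card_mono[OF _ T_sub[of k]] by simp

definition val :: "nat \<Rightarrow> nat \<times> nat \<Rightarrow> real \<Rightarrow> real \<Rightarrow> real" where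
  "val k t x y = cf k t + real (fst t) * x + real (snd t) * y"

primrec phi :: "nat \<Rightarrow> nat \<Rightarrow> real \<Rightarrow> real" where
  "phi 0 k x = real (a k) * x"
| "phi (Suc h) k x = Min ((\<lambda>t. val k t (phi h (2 * k) x) (phi h (2 * k + 1) x)) ` T k)"

primrec breaks :: "nat \<Rightarrow> nat \<Rightarrow> real set" where
  "breaks 0 k = {}"
| "breaks (Suc h) k = breaks h (2 * k) \<union> breaks h (2 * k + 1) \<union>
    (\<Union>t\<in>T k. \<Union>t'\<in>T k. cross (breaks h (2 * k) \<union> breaks h (2 * k + 1))
      (\<lambda>x. val k t' (phi h (2 * k) x) (phi h (2 * k + 1) x) -
        val k t (phi h (2 * k) x) (phi h (2 * k + 1) x)))"

text \<open>
  The minimum of at most 4 functions breaks where they break and where 2 of them cross.  The 16 pairs have at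
  most one crossing per interval between the at most \<open>2 * 50 ^ h - 2\<close> breakpoints of the children, and
  \<open>2 * 17 < 50\<close>.
\<close>

lemma breaks: "affine_off (breaks h k) (phi h k) \<and> finite (breaks h k) \<and> card (breaks h k) < 50 ^ h"
proof (induction h arbitrary: k)
  case 0
  then show ?case by (simp add: affine_off_linear)
next
  case (Suc h)
  let ?Y = "breaks h (2 * k) \<union> breaks h (2 * k + 1)"
  let ?m = "\<lambda>t x. val k t (phi h (2 * k) x) (phi h (2 * k + 1) x)"
  let ?C = "\<Union>t\<in>T k. \<Union>t'\<in>T k. cross ?Y (\<lambda>x. ?m t' x - ?m t x)"
  have fin: "finite ?Y" using Suc by simp
  have m: "affine_off ?Y (?m t)" for t
    unfolding val_def by (intro affine_off_comb) (use Suc affine_off_mono in blast)+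
  have d: "affine_off ?Y (\<lambda>x. ?m t' x - ?m t x)" for t t'
    using affine_off_comb[OF m m, of 0 1 t' "-1" t] by simp
  have cY: "card ?Y + 2 \<le> 2 * 50 ^ h"
    using Suc[of "2 * k"] Suc[of "2 * k + 1"] card_Un_le[of "breaks h (2 * k)" "breaks h (2 * k + 1)"] by linarith
  have cC: "finite ?C \<and> card ?C \<le> 16 * (card ?Y + 1)"
  proof
    show "finite ?C" using card_cross[OF d fin] by simp
    have "card ?C \<le> (\<Sum>t\<in>T k. \<Sum>t'\<in>T k. card ?Y + 1)"
      by (intro order.trans[OF card_UN_le] sum_mono) (use card_cross[OF d fin] in auto)
    also have "\<dots> \<le> 4 * (4 * (card ?Y + 1))"
      by (simp only: sum_constant of_nat_id) (intro mult_le_mono card_T order.refl)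
    finally show "card ?C \<le> 16 * (card ?Y + 1)" by simp
  qed
  have "card (breaks (Suc h) k) \<le> card ?Y + 16 * (card ?Y + 1)"
    using card_Un_le[of ?Y ?C] cC by simp
  also have "\<dots> < 50 ^ Suc h" using cY by simp
  finally have "card (breaks (Suc h) k) < 50 ^ Suc h" .
  moreover have "phi (Suc h) k = (\<lambda>x. Min ((\<lambda>t. ?m t x) ` T k))" by (rule ext) simp
  then have "affine_off (breaks (Suc h) k) (phi (Suc h) k)"
  proof (cases "T k = {}")
    case True
    then show ?thesis using \<open>phi (Suc h) k = _\<close> by (simp add: affine_off_const)
  next
    case False
    then show ?thesis using \<open>phi (Suc h) k = _\<close> affine_off_Min[OF finite_T False m] by simp
  qed
  moreover have "finite (breaks (Suc h) k)" using fin cC by simp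
  ultimately show ?case by blast
qed

text \<open>
  At each node, two terms of the equation are selected: the variable of the node and a term \<open>t\<close>
  (a pair \<open>(t, None)\<close>), or two terms \<open>t\<close> and \<open>t'\<close> in the children (a pair \<open>(t, Some t')\<close>).
\<close>

primrec holds :: "(nat \<Rightarrow> (nat \<times> nat) \<times> (nat \<times> nat) option) \<Rightarrow> nat \<Rightarrow> nat \<Rightarrow> (nat \<Rightarrow> real) \<Rightarrow> bool" where
  "holds ch 0 k w \<longleftrightarrow> w k = real (a k) * w 0"
| "holds ch (Suc h) k w \<longleftrightarrow>
     fst (ch k) \<in> T k \<and>
     (\<forall>t\<in>T k. val k (fst (ch k)) (w (2 * k)) (w (2 * k + 1)) \<le> val k t (w (2 * k)) (w (2 * k + 1))) \<and>
     (case snd (ch k) of None \<Rightarrow> w k = val k (fst (ch k)) (w (2 * k)) (w (2 * k + 1))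
      | Some t \<Rightarrow> t \<in> T k \<and> val k (fst (ch k)) (w (2 * k)) (w (2 * k + 1)) = val k t (w (2 * k)) (w (2 * k + 1))) \<and>
     holds ch h (2 * k) w \<and> holds ch h (2 * k + 1) w"

text \<open>
  For the linear system of the selected pairs of terms, \<open>dependent\<close> and \<open>upright\<close> are the graphs and the
  vertical lines of the classification, and \<open>slope\<close> is the slope of the graph, which is a line.
\<close>

primrec dependent :: "(nat \<Rightarrow> (nat \<times> nat) \<times> (nat \<times> nat) option) \<Rightarrow> nat \<Rightarrow> nat \<Rightarrow> bool" where
  "dependent ch 0 k \<longleftrightarrow> True"
| "dependent ch (Suc h) k \<longleftrightarrow> snd (ch k) = None \<and> dependent ch h (2 * k) \<and> dependent ch h (2 * k + 1)"

primrec slope :: "(nat \<Rightarrow> (nat \<times> nat) \<times> (nat \<times> nat) option) \<Rightarrow> nat \<Rightarrow> nat \<Rightarrow> real" where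
  "slope ch 0 k = real (a k)"
| "slope ch (Suc h) k = real (fst (fst (ch k))) * slope ch h (2 * k) +
     real (snd (fst (ch k))) * slope ch h (2 * k + 1)"

primrec upright :: "(nat \<Rightarrow> (nat \<times> nat) \<times> (nat \<times> nat) option) \<Rightarrow> nat \<Rightarrow> nat \<Rightarrow> bool" where
  "upright ch 0 k \<longleftrightarrow> False"
| "upright ch (Suc h) k \<longleftrightarrow> (let t = fst (ch k) in case snd (ch k) of
     None \<Rightarrow> upright ch h (2 * k) \<and> dependent ch h (2 * k + 1) \<and> fst t \<noteq> 0 \<or>
       dependent ch h (2 * k) \<and> upright ch h (2 * k + 1) \<and> snd t \<noteq> 0
   | Some t' \<Rightarrow> dependent ch h (2 * k) \<and> dependent ch h (2 * k + 1) \<and>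
         (real (fst t) - real (fst t')) * slope ch h (2 * k) +
         (real (snd t) - real (snd t')) * slope ch h (2 * k + 1) \<noteq> 0 \<or>
       upright ch h (2 * k) \<and> dependent ch h (2 * k + 1) \<and> fst t \<noteq> fst t' \<or>
       dependent ch h (2 * k) \<and> upright ch h (2 * k + 1) \<and> snd t \<noteq> snd t')"

lemma dependent_phi: "dependent ch h k \<Longrightarrow> holds ch h k w \<Longrightarrow> w k = phi h k (w 0)"
proof (induction h arbitrary: k)
  case 0
  then show ?case by simp
next
  case (Suc h)
  then have w: "w (2 * k) = phi h (2 * k) (w 0)" "w (2 * k + 1) = phi h (2 * k + 1) (w 0)"
    by simp_all
  show ?case
    unfolding phi.simps w[symmetric]
    by (rule Min_eqI[symmetric]) (use Suc.prems in auto)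
qed

lemma dependent_unique:
  "dependent ch h k \<Longrightarrow> holds ch h k w \<Longrightarrow> dependent ch' h k \<Longrightarrow> holds ch' h k w' \<Longrightarrow>
   w 0 = w' 0 \<Longrightarrow> i \<in> desc h k \<Longrightarrow> w i = w' i"
proof (induction h arbitrary: k)
  case 0
  then show ?case by simp
next
  case (Suc h)
  then have "w k = w' k" using dependent_phi by metis
  then show ?case using Suc by auto
qed

text \<open>
  A piecewise affine function built from minima and nonnegative combinations lies below each of
  its selected affine branches, so where it is affine near a point, any branch through that
  point has its slope.
\<close>

lemma phi_le_branch:
  "dependent ch h k \<Longrightarrow> holds ch h k w \<Longrightarrow> phi h k x \<le> w k + slope ch h k * (x - w 0)"
proof (induction h arbitrary: k)
  case 0
  then show ?case by (simp add: algebra_simps)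
next
  case (Suc h)
  let ?t = "fst (ch k)"
  have "phi (Suc h) k x \<le> val k ?t (phi h (2 * k) x) (phi h (2 * k + 1) x)"
    using Suc.prems by (auto intro!: Min_le)
  also have "\<dots> \<le> val k ?t (w (2 * k) + slope ch h (2 * k) * (x - w 0))
      (w (2 * k + 1) + slope ch h (2 * k + 1) * (x - w 0))"
    unfolding val_def by (intro add_mono mult_left_mono) (use Suc in auto)
  also have "\<dots> = w k + slope ch (Suc h) k * (x - w 0)"
    using Suc.prems by (simp add: val_def algebra_simps)
  finally show ?case .
qed

lemma phi_near:
  assumes "dependent ch h k" "holds ch h k w" "finite Y" "breaks h k \<subseteq> Y" "w 0 \<notin> Y"
  shows "\<exists>e>0. \<forall>x. \<bar>x - w 0\<bar> \<le> e \<longrightarrow> phi h k x = w k + slope ch h k * (x - w 0)"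
proof -
  have "affine_off Y (phi h k)" using breaks assms(4) affine_off_mono by blast
  then obtain e s where e: "e > 0" and
      s: "\<forall>x. \<bar>x - w 0\<bar> \<le> e \<longrightarrow> phi h k x = phi h k (w 0) + s * (x - w 0)"
    using affine_near[OF _ assms(3,5)] by blast
  have wk: "phi h k (w 0) = w k" using dependent_phi[OF assms(1,2)] by simp
  have "phi h k (w 0 + e) = w k + s * e" "phi h k (w 0 - e) = w k - s * e"
    using s[rule_format, of "w 0 + e"] s[rule_format, of "w 0 - e"] e wk by simp_all
  then have "s * e \<le> slope ch h k * e" "- (s * e) \<le> - (slope ch h k * e)"
    using phi_le_branch[OF assms(1,2), of "w 0 + e"] phi_le_branch[OF assms(1,2), of "w 0 - e"]
    by simp_all
  then have "s = slope ch h k" using e by simp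
  then show ?thesis using e s wk by auto
qed

text \<open>
  Away from the breakpoints of its two children, the value of each child is affine near the abscissa with the
  slope of the selected branch.  A tie between two terms of different slope is then a crossing.
\<close>

lemma upright_break:
  "upright ch h k \<Longrightarrow> holds ch h k w \<Longrightarrow> w 0 \<in> breaks h k"
proof (induction h arbitrary: k)
  case 0
  then show ?case by simp
next
  case (Suc h)
  let ?Y = "breaks h (2 * k) \<union> breaks h (2 * k + 1)" and ?t = "fst (ch k)"
  have l: "holds ch h (2 * k) w" and r: "holds ch h (2 * k + 1) w" using Suc.prems by auto
  have "upright ch h (2 * k) \<or> upright ch h (2 * k + 1) \<or>
    (\<exists>t'. snd (ch k) = Some t' \<and> dependent ch h (2 * k) \<and> dependent ch h (2 * k + 1) \<and>
         (real (fst ?t) - real (fst t')) * slope ch h (2 * k) +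
         (real (snd ?t) - real (snd t')) * slope ch h (2 * k + 1) \<noteq> 0)"
    using Suc.prems(1) by (auto simp: Let_def split: option.splits)
  moreover have crossing: "w 0 \<in> breaks (Suc h) k"
    if t': "snd (ch k) = Some t'" and d: "dependent ch h (2 * k)" "dependent ch h (2 * k + 1)"
      and s: "(real (fst ?t) - real (fst t')) * slope ch h (2 * k) +
         (real (snd ?t) - real (snd t')) * slope ch h (2 * k + 1) \<noteq> 0" for t'
  proof (cases "w 0 \<in> ?Y")
    case True
    then show ?thesis by auto
  next
    case False
    have fin: "finite ?Y" using breaks by simp
    let ?g = "\<lambda>x. val k ?t (phi h (2 * k) x) (phi h (2 * k + 1) x) -
        val k t' (phi h (2 * k) x) (phi h (2 * k + 1) x)"
    obtain el where el: "el > 0" "\<forall>x. \<bar>x - w 0\<bar> \<le> el \<longrightarrow>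
        phi h (2 * k) x = w (2 * k) + slope ch h (2 * k) * (x - w 0)"
      using phi_near[OF d(1) l fin _ False] by blast
    obtain er where er: "er > 0" "\<forall>x. \<bar>x - w 0\<bar> \<le> er \<longrightarrow>
        phi h (2 * k + 1) x = w (2 * k + 1) + slope ch h (2 * k + 1) * (x - w 0)"
      using phi_near[OF d(2) r fin _ False] by blast
    have TT: "?t \<in> T k" "t' \<in> T k" and tie: "val k ?t (w (2 * k)) (w (2 * k + 1)) =
        val k t' (w (2 * k)) (w (2 * k + 1))"
      using Suc.prems(2) t' by auto
    let ?s = "(real (fst ?t) - real (fst t')) * slope ch h (2 * k) +
         (real (snd ?t) - real (snd t')) * slope ch h (2 * k + 1)"
    have g: "?g x = ?s * (x - w 0)" if "\<bar>x - w 0\<bar> \<le> min el er" for x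
    proof -
      have pl: "phi h (2 * k) x = w (2 * k) + slope ch h (2 * k) * (x - w 0)"
        and pr: "phi h (2 * k + 1) x = w (2 * k + 1) + slope ch h (2 * k + 1) * (x - w 0)"
        using el(2) er(2) that by auto
      have "?g x = (val k ?t (w (2 * k)) (w (2 * k + 1)) - val k t' (w (2 * k)) (w (2 * k + 1))) +
          ?s * (x - w 0)"
        unfolding val_def pl pr by (simp add: algebra_simps)
      then show ?thesis using tie by simp
    qed
    have "\<exists>y. \<bar>y - w 0\<bar> < e \<and> ?g y \<noteq> 0" if "e > 0" for e
    proof (intro exI conjI)
      let ?y = "w 0 + min (min el er) (e / 2)"
      show "\<bar>?y - w 0\<bar> < e" using that el(1) er(1) by (auto simp: min_def)
      have "?g ?y = ?s * (?y - w 0)" by (rule g) (use that el(1) er(1) in \<open>auto simp: min_def\<close>)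
      moreover have "?y - w 0 \<noteq> 0" using that el(1) er(1) by (auto simp: min_def)
      ultimately show "?g ?y \<noteq> 0" using s by (metis mult_eq_0_iff)
    qed
    then have "w 0 \<in> cross ?Y ?g" using False g[of "w 0"] el(1) er(1) by (auto simp: cross_def)
    then show ?thesis using TT by auto
  qed
  moreover have "w 0 \<in> breaks (Suc h) k" if "upright ch h (2 * k)"
    using Suc.IH[OF that l] by simp
  moreover have "w 0 \<in> breaks (Suc h) k" if "upright ch h (2 * k + 1)"
    using Suc.IH[OF that r] by simp
  ultimately show ?case by blast
qed

text \<open>
  A solution that depends on its abscissa is unique, whereas an upright one is determined only together with
  its value at the root, up to finitely many choices of terms.
\<close>

definition fibre :: "nat \<Rightarrow> nat \<Rightarrow> real \<Rightarrow> real \<Rightarrow> (nat \<Rightarrow> real) set" where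
  "fibre h k x y = {restrict w (desc h k) | w. w 0 = x \<and> w k = y \<and>
     (\<exists>ch. holds ch h k w \<and> (dependent ch h k \<or> upright ch h k))}"

definition dfibre :: "nat \<Rightarrow> nat \<Rightarrow> real \<Rightarrow> (nat \<Rightarrow> real) set" where
  "dfibre h k x = {restrict w (desc h k) | w. w 0 = x \<and> (\<exists>ch. holds ch h k w \<and> dependent ch h k)}"

lemma card_dfibre: "finite (dfibre h k x) \<and> card (dfibre h k x) \<le> 1"
proof -
  have "u = u'" if u: "u \<in> dfibre h k x" and u': "u' \<in> dfibre h k x" for u u'
  proof -
    obtain w ch where w: "u = restrict w (desc h k)" "w 0 = x" "holds ch h k w" "dependent ch h k"
      using u unfolding dfibre_def by blast
    obtain w' ch' where w': "u' = restrict w' (desc h k)" "w' 0 = x" "holds ch' h k w'" "dependent ch' h k"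
      using u' unfolding dfibre_def by blast
    have "w i = w' i" if "i \<in> desc h k" for i
      by (rule dependent_unique[OF w(4,3) w'(4,3) _ that]) (simp add: w w')
    then show ?thesis unfolding w(1) w'(1) by (rule restrict_ext)
  qed
  then have sub: "dfibre h k x \<subseteq> {SOME u. u \<in> dfibre h k x}"
    by (metis singletonI someI subsetI)
  show ?thesis using finite_subset[OF sub] card_mono[OF _ sub] by simp
qed

definition join :: "nat \<Rightarrow> nat \<Rightarrow> real \<Rightarrow> (nat \<Rightarrow> real) \<times> (nat \<Rightarrow> real) \<Rightarrow> nat \<Rightarrow> real" where
  "join h k y uv = (\<lambda>j\<in>desc (Suc h) k. if j = k then y else
     if j \<in> desc h (2 * k) then fst uv j else snd uv j)"

lemma restrict_join:
  "restrict w (desc (Suc h) k) = join h k (w k) (restrict w (desc h (2 * k)), restrict w (desc h (2 * k + 1)))"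
proof
  fix j show "restrict w (desc (Suc h) k) j =
      join h k (w k) (restrict w (desc h (2 * k)), restrict w (desc h (2 * k + 1))) j"
    by (simp add: join_def restrict_def)
qed

text \<open>
  The possible values at the upright child, given the value \<open>y\<close> at the node and the value \<open>b\<close> at
  the other child: the selected terms determine it by an affine equation.
\<close>

definition left_vals :: "nat \<Rightarrow> real \<Rightarrow> real \<Rightarrow> real set" where
  "left_vals k y b = (\<lambda>t. y - val k t 0 b) ` T k \<union>
     (\<lambda>(t, t'). (val k t' 0 b - val k t 0 b) / (real (fst t) - real (fst t'))) ` (T k \<times> T k)"

definition right_vals :: "nat \<Rightarrow> real \<Rightarrow> real \<Rightarrow> real set" where
  "right_vals k y b = (\<lambda>t. y - val k t b 0) ` T k \<union>
     (\<lambda>(t, t'). (val k t' b 0 - val k t b 0) / (real (snd t) - real (snd t'))) ` (T k \<times> T k)"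

lemma card_vals:
  "finite (left_vals k y b) \<and> card (left_vals k y b) \<le> 20"
  "finite (right_vals k y b) \<and> card (right_vals k y b) \<le> 20"
proof -
  have *: "finite (f ` T k \<union> g ` (T k \<times> T k)) \<and> card (f ` T k \<union> g ` (T k \<times> T k)) \<le> 20"
    for f :: "nat \<times> nat \<Rightarrow> real" and g
  proof -
    have "card (f ` T k \<union> g ` (T k \<times> T k)) \<le> card (f ` T k) + card (g ` (T k \<times> T k))"
      by (rule card_Un_le)
    also have "\<dots> \<le> card (T k) + card (T k \<times> T k)"
      by (intro add_mono card_image_le) auto
    also have "\<dots> \<le> 4 + 4 * 4"
      unfolding card_cartesian_product by (intro add_mono mult_le_mono card_T)
    finally show ?thesis by simp
  qed
  show "finite (left_vals k y b) \<and> card (left_vals k y b) \<le> 20"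
    "finite (right_vals k y b) \<and> card (right_vals k y b) \<le> 20"
    unfolding left_vals_def right_vals_def by (rule *)+
qed

lemma fibre_cover:
  "fibre (Suc h) k x y \<subseteq> join h k y ` (dfibre h (2 * k) x \<times> dfibre h (2 * k + 1) x) \<union>
     (\<Union>v\<in>left_vals k y (phi h (2 * k + 1) x). join h k y ` (fibre h (2 * k) x v \<times> dfibre h (2 * k + 1) x)) \<union>
     (\<Union>v\<in>right_vals k y (phi h (2 * k) x). join h k y ` (dfibre h (2 * k) x \<times> fibre h (2 * k + 1) x v))"
proof
  fix u assume "u \<in> fibre (Suc h) k x y"
  then obtain w ch where u: "u = restrict w (desc (Suc h) k)" and w: "w 0 = x" "w k = y"
    and hold: "holds ch (Suc h) k w" and rigid: "dependent ch (Suc h) k \<or> upright ch (Suc h) k"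
    unfolding fibre_def by blast
  let ?t = "fst (ch k)" and ?l = "restrict w (desc h (2 * k))" and ?r = "restrict w (desc h (2 * k + 1))"
  have hl: "holds ch h (2 * k) w" and hr: "holds ch h (2 * k + 1) w" using hold by auto
  have uj: "u = join h k y (?l, ?r)" using u w restrict_join[of w h k] by simp
  have tT: "?t \<in> T k" "\<And>t'. snd (ch k) = Some t' \<Longrightarrow> t' \<in> T k"
    and none: "snd (ch k) = None \<Longrightarrow> y = val k ?t (w (2 * k)) (w (2 * k + 1))"
    and some: "\<And>t'. snd (ch k) = Some t' \<Longrightarrow>
      val k ?t (w (2 * k)) (w (2 * k + 1)) = val k t' (w (2 * k)) (w (2 * k + 1))"
    using hold w by auto
  consider (both) "dependent ch h (2 * k)" "dependent ch h (2 * k + 1)"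
    | (left) "upright ch h (2 * k)" "dependent ch h (2 * k + 1)"
       "snd (ch k) = None \<Longrightarrow> fst ?t \<noteq> 0" "\<And>t'. snd (ch k) = Some t' \<Longrightarrow> fst ?t \<noteq> fst t'"
    | (right) "dependent ch h (2 * k)" "upright ch h (2 * k + 1)"
       "snd (ch k) = None \<Longrightarrow> snd ?t \<noteq> 0" "\<And>t'. snd (ch k) = Some t' \<Longrightarrow> snd ?t \<noteq> snd t'"
    using rigid by (auto simp: Let_def split: option.splits)
  then show "u \<in> join h k y ` (dfibre h (2 * k) x \<times> dfibre h (2 * k + 1) x) \<union>
     (\<Union>v\<in>left_vals k y (phi h (2 * k + 1) x). join h k y ` (fibre h (2 * k) x v \<times> dfibre h (2 * k + 1) x)) \<union>
     (\<Union>v\<in>right_vals k y (phi h (2 * k) x). join h k y ` (dfibre h (2 * k) x \<times> fibre h (2 * k + 1) x v))"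
  proof cases
    case both
    have "?l \<in> dfibre h (2 * k) x" "?r \<in> dfibre h (2 * k + 1) x"
      using both hl hr w(1) unfolding dfibre_def by blast+
    then show ?thesis using uj by blast
  next
    case left
    have r: "w (2 * k + 1) = phi h (2 * k + 1) x" using dependent_phi[OF left(2) hr] w by simp
    have "w (2 * k) \<in> left_vals k y (phi h (2 * k + 1) x)"
    proof (cases "snd (ch k)")
      case None
      have "fst ?t = 1" using left(3)[OF None] tT(1) T_sub[of k] by auto
      then have "w (2 * k) = y - val k ?t 0 (w (2 * k + 1))" using none[OF None] by (simp add: val_def)
      then show ?thesis using tT(1) unfolding left_vals_def r by blast
    next
      case (Some t')
      have "real (fst ?t) - real (fst t') \<noteq> 0" using left(4)[OF Some] by simp
      moreover have "w (2 * k) * (real (fst ?t) - real (fst t')) =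
          val k t' 0 (w (2 * k + 1)) - val k ?t 0 (w (2 * k + 1))"
        using some[OF Some] by (simp add: val_def algebra_simps)
      ultimately have "w (2 * k) = (val k t' 0 (w (2 * k + 1)) - val k ?t 0 (w (2 * k + 1))) /
          (real (fst ?t) - real (fst t'))"
        by (simp add: eq_divide_eq)
      then show ?thesis using tT(1) tT(2)[OF Some] unfolding left_vals_def r by force
    qed
    moreover have "?l \<in> fibre h (2 * k) x (w (2 * k))"
      using left(1) hl w(1) unfolding fibre_def by blast
    moreover have "?r \<in> dfibre h (2 * k + 1) x"
      using left(2) hr w(1) unfolding dfibre_def by blast
    ultimately show ?thesis using uj by blast
  next
    case right
    have l: "w (2 * k) = phi h (2 * k) x" using dependent_phi[OF right(1) hl] w by simp
    have "w (2 * k + 1) \<in> right_vals k y (phi h (2 * k) x)"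
    proof (cases "snd (ch k)")
      case None
      have "snd ?t = 1" using right(3)[OF None] tT(1) T_sub[of k] by auto
      then have "w (2 * k + 1) = y - val k ?t (w (2 * k)) 0" using none[OF None] by (simp add: val_def)
      then show ?thesis using tT(1) unfolding right_vals_def l by blast
    next
      case (Some t')
      have "real (snd ?t) - real (snd t') \<noteq> 0" using right(4)[OF Some] by simp
      moreover have "w (2 * k + 1) * (real (snd ?t) - real (snd t')) =
          val k t' (w (2 * k)) 0 - val k ?t (w (2 * k)) 0"
        using some[OF Some] by (simp add: val_def algebra_simps)
      ultimately have "w (2 * k + 1) = (val k t' (w (2 * k)) 0 - val k ?t (w (2 * k)) 0) /
          (real (snd ?t) - real (snd t'))"
        by (simp add: eq_divide_eq)
      then show ?thesis using tT(1) tT(2)[OF Some] unfolding right_vals_def l by force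
    qed
    moreover have "?r \<in> fibre h (2 * k + 1) x (w (2 * k + 1))"
      using right(2) hr w(1) unfolding fibre_def by blast
    moreover have "?l \<in> dfibre h (2 * k) x"
      using right(1) hl w(1) unfolding dfibre_def by blast
    ultimately show ?thesis using uj by blast
  qed
qed

text \<open>
  Here \<open>41 = 1 + 20 + 20\<close>: both children depend on the abscissa, or one of them is upright and has one of at most
  20 values.
\<close>

lemma card_fibre: "finite (fibre h k x y) \<and> card (fibre h k x y) \<le> 41 ^ h"
proof (induction h arbitrary: k y)
  case 0
  have "fibre 0 k x y \<subseteq> {\<lambda>i\<in>{k}. y}" by (auto simp: fibre_def restrict_def fun_eq_iff)
  then show ?case using finite_subset card_mono[of "{\<lambda>i\<in>{k}. y}"] by fastforce
next
  case (Suc h)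
  let ?A = "join h k y ` (dfibre h (2 * k) x \<times> dfibre h (2 * k + 1) x)"
  let ?B = "\<Union>v\<in>left_vals k y (phi h (2 * k + 1) x). join h k y ` (fibre h (2 * k) x v \<times> dfibre h (2 * k + 1) x)"
  let ?C = "\<Union>v\<in>right_vals k y (phi h (2 * k) x). join h k y ` (dfibre h (2 * k) x \<times> fibre h (2 * k + 1) x v)"
  have prod: "finite (f ` (P \<times> Q)) \<and> card (f ` (P \<times> Q)) \<le> p * q"
    if "finite P \<and> card P \<le> p" "finite Q \<and> card Q \<le> q"
    for f :: "(nat \<Rightarrow> real) \<times> (nat \<Rightarrow> real) \<Rightarrow> nat \<Rightarrow> real" and P Q p q
    using that card_image_le[of "P \<times> Q" f] mult_le_mono[of "card P" p "card Q" q]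
    by (auto simp: card_cartesian_product)
  have union: "finite (\<Union>v\<in>V. F v) \<and> card (\<Union>v\<in>V. F v) \<le> 20 * c"
    if "finite V \<and> card V \<le> 20" "\<And>v. finite (F v) \<and> card (F v) \<le> c"
    for V :: "real set" and F :: "real \<Rightarrow> (nat \<Rightarrow> real) set" and c
  proof
    show "finite (\<Union>v\<in>V. F v)" using that by simp
    have "card (\<Union>v\<in>V. F v) \<le> (\<Sum>v\<in>V. c)"
      using that by (intro order.trans[OF card_UN_le] sum_mono) auto
    also have "\<dots> \<le> 20 * c" using that by simp
    finally show "card (\<Union>v\<in>V. F v) \<le> 20 * c" .
  qed
  have A: "finite ?A \<and> card ?A \<le> 1 * 1"
    by (rule prod[OF card_dfibre card_dfibre])
  have B: "finite ?B \<and> card ?B \<le> 20 * (41 ^ h * 1)"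
    by (rule union[OF card_vals(1)], rule prod[OF Suc card_dfibre])
  have C: "finite ?C \<and> card ?C \<le> 20 * (1 * 41 ^ h)"
    by (rule union[OF card_vals(2)], rule prod[OF card_dfibre Suc])
  have fin: "finite (?A \<union> ?B \<union> ?C)" using A B C by blast
  have "card (?A \<union> ?B \<union> ?C) \<le> card ?A + card ?B + card ?C"
    by (meson add_le_mono card_Un_le le_refl order_trans)
  also have "\<dots> \<le> 1 + 20 * 41 ^ h + 20 * 41 ^ h" using A B C by linarith
  also have "\<dots> \<le> 41 ^ Suc h" by simp
  finally show ?case
    using fibre_cover[of h k x y] fin by (meson card_mono finite_subset order_trans)
qed

text \<open>
  The abscissa is a breakpoint or, if the root depends on it, a point at which \<open>phi\<close> crosses the level \<open>y\<close>.
  There are at most \<open>2 * 50 ^ h\<close> of these, each with at most \<open>41 ^ h\<close> solutions, and \<open>2050 = 50 * 41\<close>.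
\<close>

theorem card_tropical_solutions:
  assumes W: "\<And>w. w \<in> W \<Longrightarrow> w k = y \<and> (\<exists>ch. holds ch h k w \<and>
      (dependent ch h k \<and> slope ch h k \<noteq> 0 \<or> upright ch h k))"
  and ext: "\<And>w w'. w \<in> W \<Longrightarrow> w' \<in> W \<Longrightarrow> (\<And>i. i \<in> insert 0 (desc h k) \<Longrightarrow> w i = w' i) \<Longrightarrow> w = w'"
  shows "card W \<le> 2 * 2050 ^ h"
proof -
  let ?Y = "breaks h k"
  let ?X = "?Y \<union> cross ?Y (\<lambda>x. phi h k x - y)"
  have aff: "affine_off ?Y (\<lambda>x. phi h k x - y)"
    using affine_off_comb[of ?Y "phi h k" "phi h k" "- y" 1 0] breaks[of h k] by simp
  have finY: "finite ?Y" and cardY: "card ?Y < 50 ^ h" using breaks by blast+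
  have finX: "finite ?X" using finY card_cross[OF aff finY] by blast
  have "card ?X \<le> card ?Y + (card ?Y + 1)"
    using card_Un_le[of ?Y "cross ?Y (\<lambda>x. phi h k x - y)"] card_cross[OF aff finY] by linarith
  then have cardX: "card ?X \<le> 2 * 50 ^ h" using cardY by linarith
  have X: "w 0 \<in> ?X" if wW: "w \<in> W" for w
  proof -
    obtain ch where ch: "holds ch h k w" "dependent ch h k \<and> slope ch h k \<noteq> 0 \<or> upright ch h k"
      and y: "w k = y" using W[OF wW] by blast
    show ?thesis
    proof (cases "upright ch h k \<or> w 0 \<in> ?Y")
      case True
      then show ?thesis using upright_break[OF _ ch(1)] by blast
    next
      case False
      then have d: "dependent ch h k" and s: "slope ch h k \<noteq> 0" and nY: "w 0 \<notin> ?Y" using ch(2) by auto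
      obtain e where e: "e > 0" "\<forall>x. \<bar>x - w 0\<bar> \<le> e \<longrightarrow> phi h k x = w k + slope ch h k * (x - w 0)"
        using phi_near[OF d ch(1) finY order.refl nY] by blast
      have "\<exists>x. \<bar>x - w 0\<bar> < e' \<and> phi h k x - y \<noteq> 0" if "e' > 0" for e'
        using e(1) e(2)[rule_format, of "w 0 + min e (e' / 2)"] that s y
        by (intro exI[of _ "w 0 + min e (e' / 2)"]) (auto simp: min_def)
      then show ?thesis using nY e(2)[rule_format, of "w 0"] e(1) y by (auto simp: cross_def)
    qed
  qed
  let ?f = "\<lambda>w. (w 0, restrict w (desc h k))"
  have "inj_on ?f W"
  proof (rule inj_onI, rule ext)
    fix w w' i assume "?f w = ?f w'" "i \<in> insert 0 (desc h k)"
    then have "w 0 = w' 0" "restrict w (desc h k) i = restrict w' (desc h k) i" by simp_all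
    then show "w i = w' i" using \<open>i \<in> insert 0 (desc h k)\<close> by (auto split: if_splits)
  qed
  moreover have "?f ` W \<subseteq> Sigma ?X (\<lambda>x. fibre h k x y)"
    using X W unfolding fibre_def by blast
  ultimately have "card W \<le> card (Sigma ?X (\<lambda>x. fibre h k x y))"
    using finX card_fibre by (meson card_inj_on_le finite_SigmaI)
  also have "\<dots> = (\<Sum>x\<in>?X. card (fibre h k x y))"
    using finX card_fibre by simp
  also have "\<dots> \<le> (\<Sum>x\<in>?X. 41 ^ h)" using card_fibre by (intro sum_mono) blast
  also have "\<dots> \<le> 2 * 50 ^ h * 41 ^ h" using cardX by simp
  also have "\<dots> = 2 * 2050 ^ h" by (simp flip: power_mult_distrib)
  finally show ?thesis .
qed

end

section \<open>Generic systems on a tree\<close>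

definition child_term :: "nat \<Rightarrow> (nat \<Rightarrow> nat) \<Rightarrow> nat \<Rightarrow> nat \<times> nat \<Rightarrow> (nat \<Rightarrow>\<^sub>0 int)" where
  "child_term M a i t = (if fst t = 1 then node M a (2 * i) else 0) + (if snd t = 1 then node M a (2 * i + 1) else 0)"

lemma children_terms: "children M a i = child_term M a i ` ({0, 1} \<times> {0, 1})"
  by (auto simp: children_def child_term_def image_iff)

definition extend_lin :: "nat \<Rightarrow> (nat \<Rightarrow> nat) \<Rightarrow> (nat \<Rightarrow> real) \<Rightarrow> nat \<Rightarrow> real" where
  "extend_lin M a w i = (if i < M then w i else real (a i) * w 0)"

lemma dot_exponent_add:
  "dot n (\<lambda>j. of_int (look (e + e') j)) v = dot n (\<lambda>j. of_int (look e j)) v + dot n (\<lambda>j. of_int (look e' j)) v"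
  by (simp add: dot_def lookup_add algebra_simps sum.distrib)

lemma dot_exponent_diff:
  "dot n (\<lambda>j. of_int (look e j - look e' j)) v = dot n (\<lambda>j. of_int (look e j)) v - dot n (\<lambda>j. of_int (look e' j)) v"
  by (simp add: dot_def algebra_simps sum_subtractf)

lemma dot_exponent_single: "i < n \<Longrightarrow> dot n (\<lambda>j. of_int (look (mon i m) j)) v = of_int m * v i"
proof -
  assume "i < n"
  have "dot n (\<lambda>j. of_int (look (mon i m) j)) v = (\<Sum>j<n. if j = i then of_int m * v i else 0)"
    unfolding dot_def by (intro sum.cong) (auto simp: lookup_single when_def)
  then show ?thesis using \<open>i < n\<close> by simp
qed

lemma dot_unit: "i < n \<Longrightarrow> dot n (\<lambda>j. of_int (if j = i then 1 else 0)) v = v i"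
  using dot_exponent_single[of i n 1 v] by simp

lemma dot_zero [simp]: "dot n (\<lambda>j. 0) v = 0"
  by (simp add: dot_def)

lemma dot_node: "1 < M \<Longrightarrow> dot M (\<lambda>j. of_int (look (node M a i) j)) v = extend_lin M a v i"
  by (simp add: node_def extend_lin_def dot_exponent_single dot_unit del: single_of_nat)

lemma dot_child_term:
  assumes "1 < M" "t \<in> {0, 1} \<times> {0, 1}"
  shows "dot M (\<lambda>j. of_int (look (child_term M a i t) j)) v =
    real (fst t) * extend_lin M a v (2 * i) + real (snd t) * extend_lin M a v (2 * i + 1)"
  using assms by (auto simp: child_term_def dot_exponent_add dot_node)

interpretation real_abs: abs_field "abs :: real \<Rightarrow> real"
  by unfold_locales (auto simp: abs_mult intro: exI[of _ "1/2"])

context padic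
begin

text \<open>
  A generic valuation vector selects two tied terms in each equation.  The linear equations for a
  displacement that are given by these pairs form again a system on the tree, over the reals and with
  constant and mixed coefficients 0, and by transversality the zero displacement is its only
  solution.  The classification of isolated solutions then says that the tropical solution is dependent with
  nonzero slope or upright, and such solutions have been counted.
\<close>

theorem generic_bound:
  assumes M: "M = 2 ^ \<Delta>" "0 < \<Delta>" and fin: "f \<in> finite_systems M (tree_support M a)"
    and gen: "tropically_generic M ord f"
  shows "card (ord_vec M ord ` torus_zeros M (UNIV :: 'k set) (f ` {..<M})) \<le> 2 * 2050 ^ \<Delta>"
proof -
  have M1: "1 < M" using M one_less_power[of "2::nat" \<Delta>] by simp
  have keys: "Poly_Mapping.keys (f i) \<subseteq> tree_support M a i" if "i < M" for i
    using fin that by (auto simp: finite_systems_def)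
  define T where "T i = {t \<in> {0, 1} \<times> {0, 1}. child_term M a i t \<in> Poly_Mapping.keys (f i)}" for i
  define cf where "cf i t = ord (look (f i) (child_term M a i t)) - ord (look (f i) (mon i 1))" for i t
  interpret tt: tropical_tree T cf a
    by unfold_locales (auto simp: T_def)
  let ?x = "extend_lin M a"
  define y where "y = ord (look (f 0) 0) - ord (look (f 0) (mon 1 1))"
  have level: "at_level \<Delta> \<Delta> 1" by (rule at_level_root)
  have tval: "term_val M ord (f i) w (child_term M a i t) =
      tt.val i t (?x w (2 * i)) (?x w (2 * i + 1)) + ord (look (f i) (mon i 1))" if "t \<in> T i" for i t w
    using that by (auto simp: term_val_def tt.val_def cf_def dot_child_term[OF M1] T_def)
  have nval: "term_val M ord (f i) w (mon i 1) = w i + ord (look (f i) (mon i 1))" if "i < M" for i w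
    using that by (simp add: term_val_def dot_unit)
  have key: "e = mon i 1 \<or> (\<exists>t\<in>T i. e = child_term M a i t)"
    if "e \<in> Poly_Mapping.keys (f i)" "0 < i" "i < M" for e i
    using that keys[of i] by (auto simp: tree_support_def children_terms T_def)
  \<comment> \<open>The change of the difference of the two selected terms under a displacement d.\<close>
  define lin where "lin i c d = (case snd c of
      None \<Rightarrow> d i - real (fst (fst c)) * ?x d (2 * i) - real (snd (fst c)) * ?x d (2 * i + 1)
    | Some t' \<Rightarrow> (real (fst (fst c)) - real (fst t')) * ?x d (2 * i) +
        (real (snd (fst c)) - real (snd t')) * ?x d (2 * i + 1))"
    for i :: nat and c :: "(nat \<times> nat) \<times> (nat \<times> nat) option" and d
  have choice: "\<exists>c. fst c \<in> T i \<and> (\<forall>t\<in>T i. tt.val i (fst c) (?x w (2 * i)) (?x w (2 * i + 1)) \<le>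
        tt.val i t (?x w (2 * i)) (?x w (2 * i + 1))) \<and>
      (case snd c of None \<Rightarrow> w i = tt.val i (fst c) (?x w (2 * i)) (?x w (2 * i + 1))
      | Some t \<Rightarrow> t \<in> T i \<and> tt.val i (fst c) (?x w (2 * i)) (?x w (2 * i + 1)) =
          tt.val i t (?x w (2 * i)) (?x w (2 * i + 1))) \<and>
      (\<forall>d. lin i c d = 0 \<longrightarrow> dot M (\<lambda>j. of_int (look e j - look e' j)) d = 0)"
    if tie: "tie M ord (f i) w e e'" and i: "0 < i" "i < M" for w e e' i
  proof -
    have e: "e \<in> Poly_Mapping.keys (f i)" "e' \<in> Poly_Mapping.keys (f i)" "e \<noteq> e'"
      "term_val M ord (f i) w e = term_val M ord (f i) w e'"
      "\<And>e''. e'' \<in> Poly_Mapping.keys (f i) \<Longrightarrow> term_val M ord (f i) w e \<le> term_val M ord (f i) w e''"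
      using tie by (auto simp: tie_def)
    have Tk: "child_term M a i t \<in> Poly_Mapping.keys (f i)" if "t \<in> T i" for t
      using that by (simp add: T_def)
    have dt: "dot M (\<lambda>j. of_int (look (child_term M a i t) j)) d =
        real (fst t) * ?x d (2 * i) + real (snd t) * ?x d (2 * i + 1)" if "t \<in> T i" for t d
      by (rule dot_child_term[OF M1]) (use that in \<open>auto simp: T_def\<close>)
    have dn: "dot M (\<lambda>j. of_int (look (mon i 1) j)) d = d i" for d
      using i by (simp add: dot_unit)
    consider (one) t where "t \<in> T i" "(e = mon i 1 \<and> e' = child_term M a i t) \<or> (e' = mon i 1 \<and> e = child_term M a i t)"
      | (two) t t' where "t \<in> T i" "t' \<in> T i" "e = child_term M a i t" "e' = child_term M a i t'"
      using key[OF e(1) i] key[OF e(2) i] e(3) by blast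
    then show ?thesis
    proof cases
      case one
      show ?thesis
      proof (intro exI[of _ "(t, None)"] conjI ballI allI impI)
        show "fst (t, None :: (nat \<times> nat) option) \<in> T i" using one by simp
        show "tt.val i (fst (t, None :: (nat \<times> nat) option)) (?x w (2 * i)) (?x w (2 * i + 1)) \<le>
            tt.val i t'' (?x w (2 * i)) (?x w (2 * i + 1))" if "t'' \<in> T i" for t''
          using e(5)[OF Tk[OF that]] e(4) one tval[OF that, of w] tval[OF one(1), of w] by auto
        show "case snd (t, None :: (nat \<times> nat) option) of
            None \<Rightarrow> w i = tt.val i (fst (t, None :: (nat \<times> nat) option)) (?x w (2 * i)) (?x w (2 * i + 1))
          | Some t'' \<Rightarrow> t'' \<in> T i \<and> tt.val i (fst (t, None :: (nat \<times> nat) option)) (?x w (2 * i)) (?x w (2 * i + 1)) =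
              tt.val i t'' (?x w (2 * i)) (?x w (2 * i + 1))"
          using e(4) one tval[OF one(1), of w] nval[OF i(2), of w] by auto
        show "dot M (\<lambda>j. of_int (look e j - look e' j)) d = 0" if "lin i (t, None) d = 0" for d
          unfolding dot_exponent_diff using that one dt[OF one(1)] dn by (auto simp: lin_def)
      qed
    next
      case two
      show ?thesis
      proof (intro exI[of _ "(t, Some t')"] conjI ballI allI impI)
        show "fst (t, Some t') \<in> T i" using two by simp
        show "tt.val i (fst (t, Some t')) (?x w (2 * i)) (?x w (2 * i + 1)) \<le>
            tt.val i t'' (?x w (2 * i)) (?x w (2 * i + 1))" if "t'' \<in> T i" for t''
          using e(5)[OF Tk[OF that]] two tval[OF that, of w] tval[OF two(1), of w] by auto
        show "case snd (t, Some t') of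
            None \<Rightarrow> w i = tt.val i (fst (t, Some t')) (?x w (2 * i)) (?x w (2 * i + 1))
          | Some t'' \<Rightarrow> t'' \<in> T i \<and> tt.val i (fst (t, Some t')) (?x w (2 * i)) (?x w (2 * i + 1)) =
              tt.val i t'' (?x w (2 * i)) (?x w (2 * i + 1))"
          using e(4) two tval[OF two(1), of w] tval[OF two(2), of w] by auto
        show "dot M (\<lambda>j. of_int (look e j - look e' j)) d = 0" if "lin i (t, Some t') d = 0" for d
          unfolding dot_exponent_diff using that two dt[OF two(1)] dt[OF two(2)]
          by (simp add: lin_def algebra_simps)
      qed
    qed
  qed
  have sol: "\<exists>ch. tt.holds ch \<Delta> 1 (?x w) \<and> (tt.dependent ch \<Delta> 1 \<and> tt.slope ch \<Delta> 1 \<noteq> 0 \<or> tt.upright ch \<Delta> 1) \<and> w 1 = y"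
    if w: "w \<in> ord_vec M ord ` torus_zeros M (UNIV :: 'k set) (f ` {..<M})" for w
  proof -
    obtain z where z: "z \<in> torus_zeros M (UNIV :: 'k set) (f ` {..<M})" "w = ord_vec M ord z" using w by blast
    have "\<And>i. i < M \<Longrightarrow> Poly_Mapping.keys (f i) \<subseteq> exponents M"
      using keys tree_support_exponents[OF M1] by blast
    from generic_ties[OF gen this z(1)]
    obtain A B where tie: "\<forall>i<M. tie M ord (f i) w (A i) (B i)"
      and indep: "\<forall>d. (\<forall>i<M. dot M (\<lambda>j. of_int (look (A i) j - look (B i) j)) d = 0) \<longrightarrow> (\<forall>j<M. d j = 0)"
      unfolding z(2) by blast
    have "\<forall>i. \<exists>c. 0 < i \<and> i < M \<longrightarrow> fst c \<in> T i \<and> (\<forall>t\<in>T i. tt.val i (fst c) (?x w (2 * i)) (?x w (2 * i + 1)) \<le>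
        tt.val i t (?x w (2 * i)) (?x w (2 * i + 1))) \<and>
      (case snd c of None \<Rightarrow> w i = tt.val i (fst c) (?x w (2 * i)) (?x w (2 * i + 1))
      | Some t \<Rightarrow> t \<in> T i \<and> tt.val i (fst c) (?x w (2 * i)) (?x w (2 * i + 1)) =
          tt.val i t (?x w (2 * i)) (?x w (2 * i + 1))) \<and>
      (\<forall>d. lin i c d = 0 \<longrightarrow> dot M (\<lambda>j. of_int (look (A i) j - look (B i) j)) d = 0)"
      using choice tie by blast
    from choice_iff[THEN iffD1, OF this]
    obtain ch where ch: "\<forall>i. 0 < i \<and> i < M \<longrightarrow> fst (ch i) \<in> T i \<and>
      (\<forall>t\<in>T i. tt.val i (fst (ch i)) (?x w (2 * i)) (?x w (2 * i + 1)) \<le>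
        tt.val i t (?x w (2 * i)) (?x w (2 * i + 1))) \<and>
      (case snd (ch i) of None \<Rightarrow> w i = tt.val i (fst (ch i)) (?x w (2 * i)) (?x w (2 * i + 1))
      | Some t \<Rightarrow> t \<in> T i \<and> tt.val i (fst (ch i)) (?x w (2 * i)) (?x w (2 * i + 1)) =
          tt.val i t (?x w (2 * i)) (?x w (2 * i + 1))) \<and>
      (\<forall>d. lin i (ch i) d = 0 \<longrightarrow> dot M (\<lambda>j. of_int (look (A i) j - look (B i) j)) d = 0)"
      by blast
    have holds: "at_level \<Delta> h k \<Longrightarrow> tt.holds ch h k (?x w)" for h k
    proof (induction h arbitrary: k)
      case 0
      then show ?case using at_level_leaf[of \<Delta> k] M M1 by (simp add: extend_lin_def)
    next
      case (Suc h)
      have k: "0 < k" "k < M" "?x w k = w k"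
        using at_level_pos[OF Suc.prems] at_level_inner[OF Suc.prems] M by (auto simp: extend_lin_def)
      then show ?case
        using ch[rule_format, of k] Suc.IH at_level_children[OF Suc.prems] by (auto split: option.splits)
    qed
    \<comment> \<open>The coefficients of the system of linear equations lin i (ch i) d = 0.\<close>
    define c0 where "c0 k = (if snd (ch k) = None then 1 else 0 :: real)" for k
    define c2 where "c2 k = (case snd (ch k) of None \<Rightarrow> - real (fst (fst (ch k)))
      | Some t \<Rightarrow> real (fst (fst (ch k))) - real (fst t))" for k
    define c3 where "c3 k = (case snd (ch k) of None \<Rightarrow> - real (snd (fst (ch k)))
      | Some t \<Rightarrow> real (snd (fst (ch k))) - real (snd t))" for k
    interpret bt: bilinear_tree "abs :: real \<Rightarrow> real" c0 "\<lambda>_. 0" c2 c3 "\<lambda>_. 0" "\<lambda>k x. real (a k) * x"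
      by unfold_locales (rule real_abs.conv_mult[OF real_abs.conv_const])
    have form: "bt.form k u v = c2 k * u + c3 k * v" for k u v by (simp add: bt.form_def)
    have sol0: "bt.sol h k (\<lambda>_. 0)" for h k by (induction h arbitrary: k) (auto simp: form)
    have iso: "bt.isolated \<Delta> 1 1 0 (\<lambda>_. 0)"
      unfolding bt.isolated_def
    proof (intro allI impI notI)
      fix Z assume Z: "bt.tracks \<Delta> 1 (\<lambda>_. 0) Z" "\<forall>\<^sub>F n in sequentially. 1 * Z n 1 + 0 = 0"
        "\<forall>\<^sub>F n in sequentially. \<exists>i\<in>insert 0 (desc \<Delta> 1). Z n i \<noteq> 0"
      have "\<forall>\<^sub>F n in sequentially. bt.sol \<Delta> 1 (Z n)" using Z(1) by (simp add: bt.tracks_def)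
      then have "\<forall>\<^sub>F n in sequentially. False"
        using Z(2,3)
      proof eventually_elim
        case (elim n)
        let ?d = "Z n"
        note sn = bt.sol_at_level_node[OF elim(1) level]
        have xd: "?x ?d i = ?d i" if "i \<in> desc \<Delta> 1" for i
          using sn[OF that] M by (auto simp: extend_lin_def)
        have "dot M (\<lambda>j. of_int (look (A i) j - look (B i) j)) ?d = 0" if i: "i < M" for i
        proof (cases "i = 0")
          case True
          have "A 0 \<in> {mon 1 1, 0}" "B 0 \<in> {mon 1 1, 0}" "A 0 \<noteq> B 0"
            using tie[rule_format, of 0] keys[of 0] M1 by (auto simp: tie_def tree_support_def)
          then show ?thesis
            unfolding dot_exponent_diff using True elim(2) M1 by (auto simp: dot_unit)
        next
          case False
          have ds: "i \<in> desc \<Delta> 1" "2 * i \<in> desc \<Delta> 1" "2 * i + 1 \<in> desc \<Delta> 1"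
            using False i M by (auto intro!: in_desc_one[of _ \<Delta>, simplified])
          have "c0 i * ?d i + (c2 i * ?d (2 * i) + c3 i * ?d (2 * i + 1)) = 0"
            using sn[OF ds(1)] i M by (simp add: form)
          then have "lin i (ch i) ?d = 0"
            unfolding lin_def xd[OF ds(2)] xd[OF ds(3)]
            by (simp add: c0_def c2_def c3_def algebra_simps split: option.splits)
          then show ?thesis using ch[rule_format, of i] i False by simp
        qed
        then have zero: "?d j = 0" if "j < M" for j using indep that by blast
        have "?d i = 0" if "i \<in> insert 0 (desc \<Delta> 1)" for i
          using zero[of i] zero[of 0] that xd[of i] M1 by (cases "i < M") (auto simp: extend_lin_def)
        then show False using elim(3) by blast
      qed
      then show False by simp
    qed
    have graph: "bt.graph h k \<longleftrightarrow> tt.dependent ch h k" for h k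
      by (induction h arbitrary: k) (auto simp: c0_def)
    have gval: "bt.graph h k \<Longrightarrow> bt.gval h k x = tt.slope ch h k * x" for h k x
      by (induction h arbitrary: k) (auto simp: form c0_def c2_def c3_def distrib_right mult.assoc split: if_splits)
    have vert: "bt.vertical h k (\<lambda>_. 0) \<Longrightarrow> tt.upright ch h k" for h k
    proof (induction h arbitrary: k)
      case (Suc h)
      have nz: "c2 k * tt.slope ch h (2 * k) + c3 k * tt.slope ch h (2 * k + 1) \<noteq> 0"
        if "bt.graph h (2 * k)" "bt.graph h (2 * k + 1)"
          "bt.form k (bt.gval h (2 * k) x) (bt.gval h (2 * k + 1) x) \<noteq> 0" for x
      proof -
        have "bt.form k (bt.gval h (2 * k) x) (bt.gval h (2 * k + 1) x) =
            (c2 k * tt.slope ch h (2 * k) + c3 k * tt.slope ch h (2 * k + 1)) * x"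
          unfolding gval[OF that(1)] gval[OF that(2)] form by (simp add: distrib_right)
        then show ?thesis using that(3) by auto
      qed
      have "snd (ch k) \<noteq> None \<and> tt.dependent ch h (2 * k) \<and> tt.dependent ch h (2 * k + 1) \<and>
          c2 k * tt.slope ch h (2 * k) + c3 k * tt.slope ch h (2 * k + 1) \<noteq> 0 \<or>
        tt.upright ch h (2 * k) \<and> tt.dependent ch h (2 * k + 1) \<and> c2 k \<noteq> 0 \<or>
        tt.dependent ch h (2 * k) \<and> tt.upright ch h (2 * k + 1) \<and> c3 k \<noteq> 0"
      proof -
        consider "c0 k = 0" "bt.graph h (2 * k)" "bt.graph h (2 * k + 1)"
            "\<exists>x. bt.form k (bt.gval h (2 * k) x) (bt.gval h (2 * k + 1) x) \<noteq> 0"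
          | "bt.vertical h (2 * k) (\<lambda>_. 0)" "bt.graph h (2 * k + 1)" "c2 k \<noteq> 0"
          | "bt.graph h (2 * k)" "bt.vertical h (2 * k + 1) (\<lambda>_. 0)" "c3 k \<noteq> 0"
          using Suc.prems by auto
        then show ?thesis
        proof cases
          case 1
          then have "snd (ch k) \<noteq> None" by (metis c0_def zero_neq_one)
          then show ?thesis using 1 nz graph by blast
        qed (use Suc.IH graph in blast)+
      qed
      then show ?case
        by (cases "snd (ch k)") (simp_all add: c2_def c3_def Let_def)
    qed simp
    have "tt.dependent ch \<Delta> 1 \<and> tt.slope ch \<Delta> 1 \<noteq> 0 \<or> tt.upright ch \<Delta> 1"
      using bt.isolated_cases[OF _ sol0 _ iso] graph vert gval by fastforce
    moreover have "w 1 = y"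
    proof -
      have "A 0 \<in> {mon 1 1, 0}" "B 0 \<in> {mon 1 1, 0}" "A 0 \<noteq> B 0"
        "term_val M ord (f 0) w (A 0) = term_val M ord (f 0) w (B 0)"
        using tie[rule_format, of 0] keys[of 0] M1 by (auto simp: tie_def tree_support_def)
      then show ?thesis
        using M1 by (auto simp: term_val_def y_def dot_unit)
    qed
    ultimately show ?thesis using holds[OF level] by blast
  qed
  let ?O = "ord_vec M ord ` torus_zeros M (UNIV :: 'k set) (f ` {..<M})"
  have "inj_on ?x ?O"
  proof (rule inj_onI)
    fix w w' assume *: "w \<in> ?O" "w' \<in> ?O" "?x w = ?x w'"
    show "w = w'"
    proof
      fix i show "w i = w' i"
        using *(1,2) fun_cong[OF *(3), of i] by (cases "i < M") (auto simp: extend_lin_def ord_vec_def)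
    qed
  qed
  then have "card ?O = card (?x ` ?O)" by (simp add: card_image)
  also have "\<dots> \<le> 2 * 2050 ^ \<Delta>"
  proof (rule tt.card_tropical_solutions[of _ 1 y \<Delta>])
    show "w 1 = y \<and> (\<exists>ch. tt.holds ch \<Delta> 1 w \<and>
        (tt.dependent ch \<Delta> 1 \<and> tt.slope ch \<Delta> 1 \<noteq> 0 \<or> tt.upright ch \<Delta> 1))" if "w \<in> ?x ` ?O" for w
    proof -
      obtain v where v: "v \<in> ?O" "w = ?x v" using \<open>w \<in> ?x ` ?O\<close> by blast
      then have "w 1 = v 1" using M1 by (simp add: extend_lin_def)
      then show ?thesis using sol[OF v(1)] v(2) by metis
    qed
    show "w = w'" if "w \<in> ?x ` ?O" "w' \<in> ?x ` ?O" "\<And>i. i \<in> insert 0 (desc \<Delta> 1) \<Longrightarrow> w i = w' i" for w w'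
    proof
      fix i show "w i = w' i"
      proof (cases "i < M")
        case True
        then show ?thesis using that(3)[of i] in_desc_one[of i \<Delta>] M by auto
      next
        case False
        then show ?thesis using that(1,2) that(3)[of 0] M1 by (auto simp: extend_lin_def)
      qed
    qed
  qed
  finally show ?thesis .
qed

end

section \<open>Formulas of low depth\<close>

text \<open>
  A step of a formula is as general as the equation of a node in a tree.  Powers of the variable count as
  leaves whatever their degree, because exponents at the leaves do not affect the number of valuation
  vectors of generic systems.
\<close>

primrec formulas :: "nat \<Rightarrow> 'a::field_char_0 poly set" where
  "formulas 0 = range (\<lambda>a. monom 1 a)"
| "formulas (Suc h) = {[:c1:] + smult c2 f + smult c3 g + smult c4 (f * g) | c1 c2 c3 c4 f g.
     c1 \<in> \<rat> \<and> c2 \<in> \<rat> \<and> c3 \<in> \<rat> \<and> c4 \<in> \<rat> \<and> f \<in> formulas h \<and> g \<in> formulas h}"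

lemma formulasI:
  "c1 \<in> \<rat> \<Longrightarrow> c2 \<in> \<rat> \<Longrightarrow> c3 \<in> \<rat> \<Longrightarrow> c4 \<in> \<rat> \<Longrightarrow> f \<in> formulas h \<Longrightarrow> g \<in> formulas h \<Longrightarrow>
   F = [:c1:] + smult c2 f + smult c3 g + smult c4 (f * g) \<Longrightarrow> F \<in> formulas (Suc h)"
  unfolding formulas.simps by blast

declare formulas.simps(2) [simp del]

lemma formulas_Suc: "f \<in> formulas h \<Longrightarrow> f \<in> formulas (Suc h)"
  by (rule formulasI[of 0 1 0 0 f _ f]) auto

lemma formulas_mono: "h \<le> h' \<Longrightarrow> f \<in> formulas h \<Longrightarrow> f \<in> formulas h'"
  by (induction h' rule: dec_induct) (use formulas_Suc in auto)

lemma formulas_nonempty: "\<exists>f. f \<in> formulas h"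
proof (induction h)
  case 0
  show ?case by auto
next
  case (Suc h)
  then show ?case using formulas_Suc by metis
qed

lemma formulas_add: "f \<in> formulas h \<Longrightarrow> g \<in> formulas h \<Longrightarrow> f + g \<in> formulas (Suc h)"
  by (rule formulasI[of 0 1 1 0 f _ g]) auto

lemma formulas_mult: "f \<in> formulas h \<Longrightarrow> g \<in> formulas h \<Longrightarrow> f * g \<in> formulas (Suc h)"
  by (rule formulasI[of 0 0 0 1 f _ g]) auto

lemma formulas_const_Suc: "c \<in> \<rat> \<Longrightarrow> [:c:] \<in> formulas (Suc h)"
proof -
  assume c: "c \<in> \<rat>"
  obtain f :: "'a poly" where f: "f \<in> formulas h" using formulas_nonempty by blast
  show ?thesis by (rule formulasI[OF c _ _ _ f f, of 0 0 0]) auto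
qed

lemma formulas_const: "c \<in> \<rat> \<Longrightarrow> 1 \<le> h \<Longrightarrow> [:c:] \<in> formulas h"
  using formulas_const_Suc[of c "h - 1"] by simp

lemma formulas_0: "1 \<le> h \<Longrightarrow> 0 \<in> formulas h"
  using formulas_const[of 0 h] by simp

lemma formulas_1: "1 \<le> h \<Longrightarrow> 1 \<in> formulas h"
  using formulas_const[of 1 h] by (simp add: one_pCons)

lemma formulas_uminus: "f \<in> formulas h \<Longrightarrow> - f \<in> formulas (Suc h)"
  by (rule formulasI[of 0 "-1" 0 0 f _ f]) auto

lemma formulas_sum:
  assumes "finite A" "card A \<le> 2 ^ m" "\<And>i. i \<in> A \<Longrightarrow> f i \<in> formulas h" "1 \<le> h"
  shows "(\<Sum>i\<in>A. f i) \<in> formulas (h + m)"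
  using assms(1-3)
proof (induction m arbitrary: A)
  case 0
  show ?case
  proof (cases "A = {}")
    case True
    then show ?thesis using formulas_0 assms(4) by simp
  next
    case False
    then have "card A = 1" using 0 by (simp add: Suc_leI card_gt_0_iff le_antisym)
    then obtain i where "A = {i}" by (rule card_1_singletonE)
    then show ?thesis using 0 by simp
  qed
next
  case (Suc m)
  obtain B where B: "B \<subseteq> A" "card B \<le> 2 ^ m" "card (A - B) \<le> 2 ^ m"
  proof (cases "card A \<le> 2 ^ m")
    case True
    then show ?thesis using that[of A] by simp
  next
    case False
    then obtain B where "B \<subseteq> A" "card B = 2 ^ m"
      using ex_card[of "2 ^ m" A] by auto
    then show ?thesis using that[of B] Suc.prems by (simp add: card_Diff_subset finite_subset)
  qed
  have "finite B" "finite (A - B)" using B Suc.prems finite_subset by auto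
  then have "(\<Sum>i\<in>B. f i) \<in> formulas (h + m)" "(\<Sum>i\<in>A - B. f i) \<in> formulas (h + m)"
    using Suc.IH[of B] Suc.IH[of "A - B"] B Suc.prems by auto
  then have "(\<Sum>i\<in>A - B. f i) + (\<Sum>i\<in>B. f i) \<in> formulas (Suc (h + m))" by (rule formulas_add[rotated])
  then show ?case using sum.subset_diff[OF B(1) Suc.prems(1), of f] by simp
qed

text \<open>
  A triangular system of linear equations is solved by repeated squaring: substituting the
  equations into themselves doubles the distance that the coefficients reach back.
\<close>

lemma triangular_solve:
  fixes a q :: "'i \<Rightarrow> 'a::field_char_0 poly" and rk :: "'i \<Rightarrow> nat"
  assumes I: "finite I" "card I \<le> 2 ^ m" and d: "1 \<le> d"
    and eq: "\<And>u. u \<in> I \<Longrightarrow> a u = q u + (\<Sum>w\<in>I. L u w * a w)"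
    and tri: "\<And>u w. u \<in> I \<Longrightarrow> w \<in> I \<Longrightarrow> L u w \<noteq> 0 \<Longrightarrow> rk w < rk u"
    and rk: "\<And>u. u \<in> I \<Longrightarrow> rk u < 2 ^ J"
    and q: "\<And>u. u \<in> I \<Longrightarrow> q u \<in> formulas d" and L: "\<And>u w. u \<in> I \<Longrightarrow> w \<in> I \<Longrightarrow> L u w \<in> formulas d"
    and u: "u \<in> I"
  shows "a u \<in> formulas (d + J * (m + 2))"
proof -
  have "\<exists>q L. (\<forall>u\<in>I. a u = q u + (\<Sum>w\<in>I. L u w * a w) \<and> q u \<in> formulas (d + j * (m + 2)) \<and>
      (\<forall>w\<in>I. L u w \<in> formulas (d + j * (m + 2)) \<and> (L u w \<noteq> 0 \<longrightarrow> rk w + 2 ^ j \<le> rk u)))" for j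
  proof (induction j)
    case 0
    show ?case
      by (intro exI[of _ q], intro exI[of _ L]) (use eq q L tri in \<open>auto simp: Suc_le_eq\<close>)
  next
    case (Suc j)
    define D where "D = d + j * (m + 2)"
    obtain q L where "\<forall>u\<in>I. a u = q u + (\<Sum>w\<in>I. L u w * a w) \<and> q u \<in> formulas D \<and>
        (\<forall>w\<in>I. L u w \<in> formulas D \<and> (L u w \<noteq> 0 \<longrightarrow> rk w + 2 ^ j \<le> rk u))"
      using Suc.IH unfolding D_def by blast
    then have *: "\<And>u. u \<in> I \<Longrightarrow> a u = q u + (\<Sum>w\<in>I. L u w * a w)"
        "\<And>u. u \<in> I \<Longrightarrow> q u \<in> formulas D"
        "\<And>u w. u \<in> I \<Longrightarrow> w \<in> I \<Longrightarrow> L u w \<in> formulas D"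
        "\<And>u w. u \<in> I \<Longrightarrow> w \<in> I \<Longrightarrow> L u w \<noteq> 0 \<Longrightarrow> rk w + 2 ^ j \<le> rk u"
      by blast+
    define q' where "q' u = q u + (\<Sum>w\<in>I. L u w * q w)" for u
    define L' where "L' u v = (\<Sum>w\<in>I. L u w * L w v)" for u v
    have D1: "1 \<le> D" using d by (simp add: D_def)
    have target: "d + Suc j * (m + 2) = Suc (Suc (D + m))" by (simp add: D_def)
    have "a u = q' u + (\<Sum>v\<in>I. L' u v * a v)" if "u \<in> I" for u
    proof -
      have "(\<Sum>w\<in>I. L u w * a w) = (\<Sum>w\<in>I. L u w * (q w + (\<Sum>v\<in>I. L w v * a v)))"
        using *(1) by (intro sum.cong) auto
      also have "\<dots> = (\<Sum>w\<in>I. L u w * q w) + (\<Sum>w\<in>I. \<Sum>v\<in>I. L u w * L w v * a v)"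
        by (simp add: distrib_left sum.distrib sum_distrib_left mult.assoc)
      also have "(\<Sum>w\<in>I. \<Sum>v\<in>I. L u w * L w v * a v) = (\<Sum>v\<in>I. L' u v * a v)"
        by (subst sum.swap) (simp add: L'_def sum_distrib_right)
      finally show ?thesis using *(1)[OF that] by (simp add: q'_def)
    qed
    moreover have "q' u \<in> formulas (d + Suc j * (m + 2))" if "u \<in> I" for u
    proof -
      have A: "(\<Sum>w\<in>I. L u w * q w) \<in> formulas (Suc D + m)"
        by (intro formulas_sum I formulas_mult *) (use that in auto)
      have B: "q u \<in> formulas (Suc D + m)" by (rule formulas_mono[OF _ *(2)[OF that]]) simp
      show ?thesis using formulas_add[OF B A] unfolding target q'_def by (simp only: add_Suc)
    qed
    moreover have "L' u v \<in> formulas (d + Suc j * (m + 2))" if "u \<in> I" "v \<in> I" for u v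
    proof -
      have "L' u v \<in> formulas (Suc D + m)"
        unfolding L'_def by (intro formulas_sum I formulas_mult *) (use that in auto)
      then show ?thesis unfolding target by (rule formulas_mono[rotated]) simp
    qed
    moreover have "rk v + 2 ^ Suc j \<le> rk u" if uv: "u \<in> I" "v \<in> I" "L' u v \<noteq> 0" for u v
    proof -
      obtain w where "w \<in> I" "L u w * L w v \<noteq> 0"
        using uv(3) unfolding L'_def by (meson sum.neutral)
      then have "rk w + 2 ^ j \<le> rk u" "rk v + 2 ^ j \<le> rk w" using *(4) uv by auto
      then show ?thesis by simp
    qed
    ultimately show ?case by (intro exI[of _ q'], intro exI[of _ L']) blast
  qed
  from this[of J] obtain q L where
    *: "a u = q u + (\<Sum>w\<in>I. L u w * a w)" "q u \<in> formulas (d + J * (m + 2))"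
      "\<forall>w\<in>I. L u w \<noteq> 0 \<longrightarrow> rk w + 2 ^ J \<le> rk u"
    using u by blast
  have "(\<Sum>w\<in>I. L u w * a w) = 0"
    by (rule sum.neutral) (use *(3) rk[OF u] in fastforce)
  then show ?thesis using *(1,2) by simp
qed

section \<open>Evaluation of polynomials with integer coefficients\<close>

definition eval_mono :: "('v \<Rightarrow> 'r::comm_ring_1) \<Rightarrow> ('v \<Rightarrow>\<^sub>0 nat) \<Rightarrow> 'r" where
  "eval_mono s m = (\<Prod>v\<in>Poly_Mapping.keys m. s v ^ look m v)"

definition eval :: "('v \<Rightarrow> 'r::comm_ring_1) \<Rightarrow> 'v int_mpoly \<Rightarrow> 'r" where
  "eval s P = (\<Sum>m\<in>Poly_Mapping.keys P. of_int (look P m) * eval_mono s m)"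

lemma eval_mono_superset:
  "finite S \<Longrightarrow> Poly_Mapping.keys m \<subseteq> S \<Longrightarrow> eval_mono s m = (\<Prod>v\<in>S. s v ^ look m v)"
  unfolding eval_mono_def by (rule prod.mono_neutral_left) (auto simp: in_keys_iff)

lemma eval_mono_add: "eval_mono s (m + m') = eval_mono s m * eval_mono s m'"
proof -
  let ?S = "Poly_Mapping.keys m \<union> Poly_Mapping.keys m'"
  have "Poly_Mapping.keys (m + m') \<subseteq> ?S" by (rule keys_add)
  then show ?thesis
    by (simp add: eval_mono_superset[of ?S] lookup_add power_add prod.distrib)
qed

lemma eval_superset:
  "finite S \<Longrightarrow> Poly_Mapping.keys P \<subseteq> S \<Longrightarrow> eval s P = (\<Sum>m\<in>S. of_int (look P m) * eval_mono s m)"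
  unfolding eval_def by (rule sum.mono_neutral_left) (auto simp: in_keys_iff)

lemma eval_add: "eval s (P + Q) = eval s P + eval s Q"
proof -
  let ?S = "Poly_Mapping.keys P \<union> Poly_Mapping.keys Q"
  have "Poly_Mapping.keys (P + Q) \<subseteq> ?S" by (rule keys_add)
  then show ?thesis
    by (simp add: eval_superset[of ?S] lookup_add distrib_right sum.distrib)
qed

lemma eval_single: "eval s (mon m c) = of_int c * eval_mono s m"
  by (simp add: eval_superset[of "{m}"])

lemma eval_0 [simp]: "eval s 0 = 0" by (simp add: eval_def)

lemma eval_1 [simp]: "eval s 1 = 1"
  using eval_single[of s 0 1] by (simp add: eval_mono_def)

lemma eval_diff: "eval s (P - Q) = eval s P - eval s Q"
  using eval_add[of s "P - Q" Q] by (simp add: algebra_simps)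

lemma eval_sum: "eval s (\<Sum>i\<in>A. f i) = (\<Sum>i\<in>A. eval s (f i))"
  by (induction A rule: infinite_finite_induct) (auto simp: eval_add)

lemma sum_singles: "P = (\<Sum>m\<in>Poly_Mapping.keys P. mon m (look P m))"
proof (rule poly_mapping_eqI)
  fix m
  have "look (\<Sum>m\<in>Poly_Mapping.keys P. mon m (look P m)) m =
      (\<Sum>m'\<in>Poly_Mapping.keys P. if m' = m then look P m else 0)"
    unfolding lookup_sum by (intro sum.cong) (auto simp: lookup_single when_def)
  then show "look P m = look (\<Sum>m\<in>Poly_Mapping.keys P. mon m (look P m)) m"
    by (simp add: in_keys_iff)
qed

lemma eval_mult: "eval s (P * Q) = eval s P * eval s Q"
proof -
  let ?K = Poly_Mapping.keys
  have "P * Q = (\<Sum>m\<in>?K P. \<Sum>m'\<in>?K Q. mon m (look P m) * mon m' (look Q m'))"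
    unfolding sum_product[symmetric] sum_singles[symmetric] ..
  then have "eval s (P * Q) = (\<Sum>m\<in>?K P. \<Sum>m'\<in>?K Q. eval s (mon m (look P m) * mon m' (look Q m')))"
    by (simp only: eval_sum)
  also have "\<dots> = (\<Sum>m\<in>?K P. \<Sum>m'\<in>?K Q.
      of_int (look P m) * eval_mono s m * (of_int (look Q m') * eval_mono s m'))"
    by (intro sum.cong refl) (simp only: mult_single eval_single eval_mono_add of_int_mult mult_ac)
  also have "\<dots> = eval s P * eval s Q"
    unfolding eval_def by (simp only: sum_product)
  finally show ?thesis .
qed

lemma eval_prod: "eval s (\<Prod>i\<in>A. f i) = (\<Prod>i\<in>A. eval s (f i))"
  by (induction A rule: infinite_finite_induct) (auto simp: eval_mult)

lemma eval_mvar: "eval s (mvar v) = s v"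
  unfolding mvar_def by (simp only: eval_single) (simp add: eval_mono_superset[of "{v}"])

section \<open>From circuits to formulas\<close>

definition gate_polys :: "'v gate list \<Rightarrow> 'v int_mpoly list" where
  "gate_polys gs = foldl (\<lambda>qs g. qs @ [gate_poly qs g]) [] gs"

lemma gate_polys_snoc: "gate_polys (gs @ [g]) = gate_polys gs @ [gate_poly (gate_polys gs) g]"
  by (simp add: gate_polys_def)

lemma length_gate_polys [simp]: "length (gate_polys gs) = length gs"
  by (induction gs rule: rev_induct) (auto simp: gate_polys_snoc, simp add: gate_polys_def)

lemma operand_poly_append: "operand_ok (length qs) x \<Longrightarrow> operand_poly (qs @ rs) x = operand_poly qs x"
  by (cases x) (auto simp: nth_append)

lemma gate_poly_append: "gate_ok (length qs) g \<Longrightarrow> gate_poly (qs @ rs) g = gate_poly qs g"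
  by (cases g) (auto simp: operand_poly_append)

lemma gate_polys_nth:
  "\<forall>k<length gs. gate_ok k (gs ! k) \<Longrightarrow> k < length gs \<Longrightarrow>
   gate_polys gs ! k = gate_poly (gate_polys gs) (gs ! k)"
proof (induction gs rule: rev_induct)
  case Nil
  then show ?case by simp
next
  case (snoc g gs)
  have ok: "\<forall>k<length gs. gate_ok k (gs ! k)" "gate_ok (length gs) g"
    using snoc.prems(1) by (auto simp: nth_append less_Suc_eq split: if_splits)
  show ?case
  proof (cases "k < length gs")
    case True
    have "gate_ok (length (gate_polys gs)) (gs ! k)"
    proof -
      have "gate_ok k (gs ! k)" using ok(1) True by blast
      moreover have "operand_ok k x \<Longrightarrow> operand_ok (length gs) x" for x :: "'a operand"
        using True by (cases x) auto
      ultimately show ?thesis by (cases "gs ! k") auto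
    qed
    then show ?thesis
      using snoc.IH[OF ok(1) True] True by (simp add: gate_polys_snoc nth_append gate_poly_append)
  next
    case False
    then have "k = length gs" using snoc.prems(2) by simp
    then show ?thesis using ok(2) gate_poly_append[of "gate_polys gs" g]
      by (simp add: gate_polys_snoc nth_append)
  qed
qed

text \<open>
  Multiplying all inputs by an auxiliary variable separates the values of the gates into parts of different
  degree in the inputs, as in the parallelisation of circuits by Valiant, Skyum, Berkowitz and Rackoff.
\<close>

locale graded_circuit =
  fixes gs :: "'v gate list" and s :: "'v \<Rightarrow> 'a::field_char_0 poly"
  assumes ok: "k < length gs \<Longrightarrow> gate_ok k (gs ! k)"
    and entries: "s v \<in> formulas 1"
begin

text \<open>The part of degree \<open>e\<close> of the value of an operand, the inputs having degree 1.\<close>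

definition part :: "'v operand \<Rightarrow> nat \<Rightarrow> 'a poly" where
  "part x e = coeff (eval (\<lambda>v. monom (s v) 1) (operand_poly (gate_polys gs) x)) e"

lemma part_Gate:
  assumes "k < length gs"
  shows "part (Gate k) e = (case gs ! k of Add x y \<Rightarrow> part x e + part y e
    | Sub x y \<Rightarrow> part x e - part y e | Mult x y \<Rightarrow> (\<Sum>i\<le>e. part x i * part y (e - i)))"
  using gate_polys_nth[of gs k] ok assms
  by (auto simp: part_def eval_add eval_diff eval_mult coeff_mult split: gate.splits)

lemma part_Input: "part (Input v) e = (if e = 1 then s v else 0)"
  by (auto simp: part_def eval_mvar)

lemma part_One: "part One e = (if e = 0 then 1 else 0)"
  by (auto simp: part_def)

lemma part_0:
  assumes "operand_ok (length gs) x" shows "\<exists>c\<in>\<rat>. part x 0 = [:c:]"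
proof -
  have op: "\<exists>c\<in>\<rat>. part x 0 = [:c:]"
    if "operand_ok k x" and "\<And>j. j < k \<Longrightarrow> \<exists>c\<in>\<rat>. part (Gate j) 0 = [:c:]" for x k
  proof (cases x)
    case (Gate j)
    then show ?thesis using that by simp
  next
    case One
    show ?thesis by (rule bexI[of _ 1]) (simp_all add: One part_One one_pCons)
  next
    case (Input v)
    show ?thesis by (rule bexI[of _ 0]) (simp_all add: Input part_Input)
  qed
  have gates: "k < length gs \<Longrightarrow> \<exists>c\<in>\<rat>. part (Gate k) 0 = [:c:]" for k
  proof (induction k rule: less_induct)
    case (less k)
    have two: "\<exists>c\<in>\<rat>. \<exists>d\<in>\<rat>. part x 0 = [:c:] \<and> part y 0 = [:d:]"
      if "operand_ok k x" "operand_ok k y" for x y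
      using op[OF that(1)] op[OF that(2)] less by force
    have ok': "gate_ok k (gs ! k)" using ok less.prems by simp
    show ?case
    proof (cases "gs ! k")
      case (Add x y)
      then obtain c d where cd: "c \<in> \<rat>" "d \<in> \<rat>" "part x 0 = [:c:]" "part y 0 = [:d:]"
        using two[of x y] ok' by auto
      show ?thesis by (rule bexI[of _ "c + d"]) (simp_all add: part_Gate[OF less.prems] Add cd)
    next
      case (Sub x y)
      then obtain c d where cd: "c \<in> \<rat>" "d \<in> \<rat>" "part x 0 = [:c:]" "part y 0 = [:d:]"
        using two[of x y] ok' by auto
      show ?thesis by (rule bexI[of _ "c - d"]) (simp_all add: part_Gate[OF less.prems] Sub cd)
    next
      case (Mult x y)
      then obtain c d where cd: "c \<in> \<rat>" "d \<in> \<rat>" "part x 0 = [:c:]" "part y 0 = [:d:]"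
        using two[of x y] ok' by auto
      show ?thesis by (rule bexI[of _ "c * d"]) (simp_all add: part_Gate[OF less.prems] Mult cd)
    qed
  qed
  show ?thesis by (rule op[OF assms gates])
qed

text \<open>
  The parts of degree at most \<open>2 m + 1\<close> are linear in each other with coefficients of degree at most
  \<open>m\<close>, since at most one factor of a product has degree greater than \<open>m\<close>.
\<close>

definition affine_in :: "nat \<Rightarrow> nat \<Rightarrow> nat \<Rightarrow> 'a poly \<Rightarrow> bool" where
  "affine_in d m k f \<longleftrightarrow> (\<exists>q L. f = q + (\<Sum>w\<in>{..<length gs} \<times> {m<..2 * m + 1}. L w * part (Gate (fst w)) (snd w)) \<and>
     q \<in> formulas d \<and> (\<forall>w. L w \<in> formulas d \<and> (L w \<noteq> 0 \<longrightarrow> fst w < k)))"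

lemma affine_in_known: "1 \<le> d \<Longrightarrow> f \<in> formulas d \<Longrightarrow> affine_in d m k f"
  unfolding affine_in_def
  by (intro exI[of _ f] exI[of _ "\<lambda>_. 0"]) (auto simp: formulas_0)

lemma affine_in_gate:
  assumes "1 \<le> d" "c \<in> formulas d" "j < k" "k \<le> length gs" "e \<in> {m<..2 * m + 1}"
  shows "affine_in d m k (c * part (Gate j) e)"
proof -
  let ?L = "\<lambda>w. if w = (j, e) then c else 0"
  have "(\<Sum>w\<in>{..<length gs} \<times> {m<..2 * m + 1}. ?L w * part (Gate (fst w)) (snd w)) =
      (\<Sum>w\<in>{..<length gs} \<times> {m<..2 * m + 1}. if w = (j, e) then c * part (Gate j) e else 0)"
    by (intro sum.cong) auto
  also have "\<dots> = c * part (Gate j) e" using assms by simp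
  finally show ?thesis
    unfolding affine_in_def
    by (intro exI[of _ 0] exI[of _ ?L]) (use assms in \<open>auto simp: formulas_0\<close>)
qed

lemma affine_in_sum:
  assumes "finite A" "card A \<le> 2 ^ n" "\<And>i. i \<in> A \<Longrightarrow> affine_in d m k (f i)" "1 \<le> d"
  shows "affine_in (d + n) m k (\<Sum>i\<in>A. f i)"
proof -
  have "\<forall>i. \<exists>q L. i \<in> A \<longrightarrow> f i = q + (\<Sum>w\<in>{..<length gs} \<times> {m<..2 * m + 1}. L w * part (Gate (fst w)) (snd w)) \<and>
     q \<in> formulas d \<and> (\<forall>w. L w \<in> formulas d \<and> (L w \<noteq> 0 \<longrightarrow> fst w < k))"
    using assms(3) unfolding affine_in_def by blast
  from choice[OF this] obtain q where "\<forall>i. \<exists>L. i \<in> A \<longrightarrow>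
     f i = q i + (\<Sum>w\<in>{..<length gs} \<times> {m<..2 * m + 1}. L w * part (Gate (fst w)) (snd w)) \<and>
     q i \<in> formulas d \<and> (\<forall>w. L w \<in> formulas d \<and> (L w \<noteq> 0 \<longrightarrow> fst w < k))" by blast
  from choice[OF this] obtain L where "\<forall>i. i \<in> A \<longrightarrow>
     f i = q i + (\<Sum>w\<in>{..<length gs} \<times> {m<..2 * m + 1}. L i w * part (Gate (fst w)) (snd w)) \<and>
     q i \<in> formulas d \<and> (\<forall>w. L i w \<in> formulas d \<and> (L i w \<noteq> 0 \<longrightarrow> fst w < k))" by blast
  then have qL: "\<And>i. i \<in> A \<Longrightarrow>
     f i = q i + (\<Sum>w\<in>{..<length gs} \<times> {m<..2 * m + 1}. L i w * part (Gate (fst w)) (snd w))"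
     "\<And>i. i \<in> A \<Longrightarrow> q i \<in> formulas d" "\<And>i w. i \<in> A \<Longrightarrow> L i w \<in> formulas d"
     "\<And>i w. i \<in> A \<Longrightarrow> L i w \<noteq> 0 \<Longrightarrow> fst w < k"
    by blast+
  have "(\<Sum>i\<in>A. f i) = (\<Sum>i\<in>A. q i) +
      (\<Sum>i\<in>A. \<Sum>w\<in>{..<length gs} \<times> {m<..2 * m + 1}. L i w * part (Gate (fst w)) (snd w))"
    using qL(1) by (simp add: sum.distrib)
  also have "(\<Sum>i\<in>A. \<Sum>w\<in>{..<length gs} \<times> {m<..2 * m + 1}. L i w * part (Gate (fst w)) (snd w)) =
      (\<Sum>w\<in>{..<length gs} \<times> {m<..2 * m + 1}. (\<Sum>i\<in>A. L i w) * part (Gate (fst w)) (snd w))"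
    by (subst sum.swap) (simp add: sum_distrib_right)
  finally have "(\<Sum>i\<in>A. f i) = (\<Sum>i\<in>A. q i) +
      (\<Sum>w\<in>{..<length gs} \<times> {m<..2 * m + 1}. (\<Sum>i\<in>A. L i w) * part (Gate (fst w)) (snd w))" .
  then show ?thesis
    unfolding affine_in_def
  proof (intro exI conjI allI impI)
    show "(\<Sum>i\<in>A. q i) \<in> formulas (d + n)"
      by (rule formulas_sum[OF assms(1,2) qL(2) assms(4)])
    show "(\<Sum>i\<in>A. L i w) \<in> formulas (d + n)" for w
      by (rule formulas_sum[OF assms(1,2) qL(3) assms(4)])
    show "fst w < k" if "(\<Sum>i\<in>A. L i w) \<noteq> 0" for w
      using that qL(4) by (meson sum.neutral)
  qed
qed

definition low :: "nat \<Rightarrow> nat \<Rightarrow> bool" where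
  "low m d \<longleftrightarrow> 1 \<le> d \<and> (\<forall>j<length gs. \<forall>e\<le>m. part (Gate j) e \<in> formulas d)"

text \<open>
  The order of computation makes the linear equations between the parts of higher degree triangular.
\<close>

lemma low_step:
  assumes low: "low m d" and m: "2 * m + 2 \<le> 2 ^ n" and size: "length gs * (m + 1) \<le> 2 ^ n"
  shows "low (2 * m + 1) (d + (n + 2) + n * (n + 2))"
proof -
  have d: "1 \<le> d" and lowd: "\<And>j e. j < length gs \<Longrightarrow> e \<le> m \<Longrightarrow> part (Gate j) e \<in> formulas d"
    using low by (auto simp: low_def)
  have nongate: "part x e \<in> formulas d" if "\<And>j. x \<noteq> Gate j" for x e
    using that d entries[THEN formulas_mono[OF d]] formulas_0[OF d] formulas_1[OF d]
    by (cases x) (auto simp: part_Input part_One)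
  have known: "part x e \<in> formulas d" if "operand_ok (length gs) x" "e \<le> m" for x e
    using that nongate[of x] lowd by (cases x) auto
  define I where "I = {..<length gs} \<times> {m<..2 * m + 1}"
  have prod_term: "affine_in (Suc d) m k (part x i * part y j)"
    if "operand_ok k x" "operand_ok k y" "i + j \<le> 2 * m + 1" "k < length gs" for k x y i j
  proof -
    have ok': "operand_ok (length gs) x" "operand_ok (length gs) y"
      using that by (cases x; cases y; auto)+
    have up: "f \<in> formulas (Suc d)" if "f \<in> formulas d" for f :: "'a poly" using that by (rule formulas_Suc)
    consider (both) "part x i \<in> formulas d" "part y j \<in> formulas d"
      | (left) l where "x = Gate l" "m < i" | (right) l where "y = Gate l" "m < j"
      using known[OF ok'(1), of i] known[OF ok'(2), of j] nongate[of x i] nongate[of y j]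
      by (metis not_le)
    then show ?thesis
    proof cases
      case both
      then show ?thesis by (intro affine_in_known formulas_mult) auto
    next
      case left
      have "affine_in (Suc d) m k (part y j * part (Gate l) i)"
        by (rule affine_in_gate) (use left that known[OF ok'(2), of j] up in auto)
      then show ?thesis using left by (simp add: mult.commute)
    next
      case right
      have "affine_in (Suc d) m k (part x i * part (Gate l) j)"
        by (rule affine_in_gate) (use right that known[OF ok'(1), of i] up in auto)
      then show ?thesis using right by simp
    qed
  qed
  have row: "affine_in (d + n + 2) m k (part (Gate k) e)" if k: "k < length gs" and e: "e \<le> 2 * m + 1" for k e
  proof -
    have ok': "gate_ok k (gs ! k)" using ok k by simp
    have one: "affine_in (Suc d) m k (part x e)" if "operand_ok k x" for x
      using prod_term[of k x One e 0] that e k by (simp add: part_One)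
    have neg: "affine_in (Suc d) m k (- part x e)" if ox: "operand_ok k x" for x
    proof -
      have okx: "operand_ok (length gs) x" using ox k by (cases x) auto
      show ?thesis
      proof (cases "part x e \<in> formulas d")
        case True
        then show ?thesis by (intro affine_in_known formulas_uminus) auto
      next
        case False
        then obtain l where l: "x = Gate l" "m < e" using known[OF okx, of e] nongate[of x e] by (metis not_le)
        have "affine_in (Suc d) m k ([:-1:] * part (Gate l) e)"
          by (rule affine_in_gate) (use l e k ox in \<open>auto intro: formulas_const_Suc simp: Rats_minus_iff\<close>)
        then show ?thesis using l by simp
      qed
    qed
    have pair: "affine_in (d + n + 2) m k (f True + f False)" if "\<And>b. affine_in (Suc d) m k (f b)" for f
    proof -
      have n1: "1 \<le> n" using m by (cases n) auto
      have "affine_in (Suc d + (n + 1)) m k (\<Sum>b\<in>UNIV. f b)"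
        by (rule affine_in_sum) (use that in auto)
      then show ?thesis by (simp add: UNIV_bool add.commute)
    qed
    show ?thesis
    proof (cases "gs ! k")
      case (Add x y)
      then show ?thesis
        using pair[of "\<lambda>b. if b then part x e else part y e"] one ok' by (simp add: part_Gate[OF k])
    next
      case (Sub x y)
      then show ?thesis
        using pair[of "\<lambda>b. if b then part x e else - part y e"] one neg ok' by (simp add: part_Gate[OF k])
    next
      case (Mult x y)
      have "affine_in (Suc d + (n + 1)) m k (\<Sum>i\<le>e. part x i * part y (e - i))"
        by (rule affine_in_sum) (use Mult ok' e m prod_term k in auto)
      then show ?thesis using Mult by (simp add: part_Gate[OF k])
    qed
  qed
  have "\<forall>u. \<exists>q L. u \<in> I \<longrightarrow> part (Gate (fst u)) (snd u) =
      q + (\<Sum>w\<in>I. L w * part (Gate (fst w)) (snd w)) \<and>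
     q \<in> formulas (d + n + 2) \<and> (\<forall>w. L w \<in> formulas (d + n + 2) \<and> (L w \<noteq> 0 \<longrightarrow> fst w < fst u))"
    using row unfolding affine_in_def I_def by fastforce
  from choice[OF this] obtain q where "\<forall>u. \<exists>L. u \<in> I \<longrightarrow> part (Gate (fst u)) (snd u) =
      q u + (\<Sum>w\<in>I. L w * part (Gate (fst w)) (snd w)) \<and>
     q u \<in> formulas (d + n + 2) \<and> (\<forall>w. L w \<in> formulas (d + n + 2) \<and> (L w \<noteq> 0 \<longrightarrow> fst w < fst u))" by blast
  from choice[OF this] obtain L where "\<forall>u. u \<in> I \<longrightarrow> part (Gate (fst u)) (snd u) =
      q u + (\<Sum>w\<in>I. L u w * part (Gate (fst w)) (snd w)) \<and>
     q u \<in> formulas (d + n + 2) \<and> (\<forall>w. L u w \<in> formulas (d + n + 2) \<and> (L u w \<noteq> 0 \<longrightarrow> fst w < fst u))" by blast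
  then have qL: "\<And>u. u \<in> I \<Longrightarrow> part (Gate (fst u)) (snd u) =
      q u + (\<Sum>w\<in>I. L u w * part (Gate (fst w)) (snd w))"
     "\<And>u. u \<in> I \<Longrightarrow> q u \<in> formulas (d + n + 2)" "\<And>u w. u \<in> I \<Longrightarrow> L u w \<in> formulas (d + n + 2)"
     "\<And>u w. u \<in> I \<Longrightarrow> L u w \<noteq> 0 \<Longrightarrow> fst w < fst u"
    by blast+
  have cI: "finite I" "card I \<le> 2 ^ n" using size by (auto simp: I_def card_cartesian_product algebra_simps)
  have rank: "fst u < 2 ^ n" if "u \<in> I" for u
  proof -
    have "fst u < length gs" using that by (auto simp: I_def)
    also have "length gs \<le> length gs * (m + 1)" by simp
    finally show ?thesis using size by simp
  qed
  have high: "part (Gate j) e \<in> formulas (d + n + 2 + n * (n + 2))" if "(j, e) \<in> I" for j e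
    using triangular_solve[OF cI, of "d + n + 2" "\<lambda>u. part (Gate (fst u)) (snd u)" q L fst n "(j, e)"]
      qL rank that by auto
  have "part (Gate j) e \<in> formulas (d + (n + 2) + n * (n + 2))" if "j < length gs" "e \<le> 2 * m + 1" for j e
  proof (cases "e \<le> m")
    case True
    show ?thesis by (rule formulas_mono[OF _ lowd[OF that(1) True]]) simp
  next
    case False
    then show ?thesis using high[of j e] that by (simp add: I_def add.assoc)
  qed
  then show ?thesis using d by (simp add: low_def)
qed

text \<open>
  The degree doubles at the cost of a depth quadratic in the logarithms of degree and size.
\<close>

lemma low_iterate:
  assumes "r \<le> R" "length gs \<le> 2 ^ S"
  shows "low (2 ^ r - 1) (1 + r * ((R + S + 2) * (R + S + 1)))"
  using assms(1)
proof (induction r)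
  case 0
  show ?case using part_0[of "Gate _"] formulas_const[of _ 1] by (fastforce simp: low_def)
next
  case (Suc r)
  let ?m = "2 ^ r - 1 :: nat" and ?n = "R + S"
  have two: "2 * ?m + 2 = 2 ^ Suc r" "?m + 1 = 2 ^ r" "2 * ?m + 1 = 2 ^ Suc r - 1"
  proof -
    obtain y :: nat where "2 ^ r = Suc y" by (metis Suc_pred zero_less_numeral zero_less_power)
    then show "2 * ?m + 2 = 2 ^ Suc r" "?m + 1 = 2 ^ r" "2 * ?m + 1 = 2 ^ Suc r - 1" by simp_all
  qed
  have "low (2 * ?m + 1) (1 + r * ((R + S + 2) * (R + S + 1)) + (?n + 2) + ?n * (?n + 2))"
  proof (rule low_step)
    show "low ?m (1 + r * ((R + S + 2) * (R + S + 1)))" using Suc by simp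
    have "(2::nat) ^ Suc r \<le> 2 ^ (R + S)" using Suc.prems by (intro power_increasing) auto
    then show "2 * ?m + 2 \<le> 2 ^ ?n" unfolding two .
    have "length gs * (?m + 1) \<le> 2 ^ S * 2 ^ R"
      unfolding two using assms(2) Suc.prems by (intro mult_le_mono power_increasing) auto
    then show "length gs * (?m + 1) \<le> 2 ^ ?n" by (simp add: power_add mult.commute)
  qed
  moreover have "1 + r * ((R + S + 2) * (R + S + 1)) + (?n + 2) + ?n * (?n + 2) =
      1 + Suc r * ((R + S + 2) * (R + S + 1))" by (simp add: algebra_simps)
  ultimately show ?case unfolding two by (simp only:)
qed

end

definition permanent :: "nat \<Rightarrow> (nat \<times> nat \<Rightarrow> 'r::comm_ring_1) \<Rightarrow> 'r" where
  "permanent n s = (\<Sum>\<sigma> | \<sigma> permutes {1..n}. \<Prod>i=1..n. s (i, \<sigma> i))"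

text \<open>
  The permanent is homogeneous, so it is its own part of degree \<open>n\<close>, and \<open>R\<close> doublings reach this degree.
\<close>

theorem permanent_formula:
  fixes s :: "nat \<times> nat \<Rightarrow> 'a::field_char_0 poly"
  assumes c: "computes c (permanent_poly n)" and size: "circuit_size c \<le> 2 ^ S" and n: "n < 2 ^ R"
    and s: "\<And>v. s v \<in> formulas 1"
  shows "permanent n s \<in> formulas (1 + R * ((R + S + 2) * (R + S + 1)))"
proof -
  obtain gs x where cx: "c = (gs, x)" by (cases c)
  have circ: "k < length gs \<Longrightarrow> gate_ok k (gs ! k)" "operand_ok (length gs) x" for k
    using c cx by (auto simp: computes_def circuit_ok_def)
  interpret graded_circuit gs s by unfold_locales (use circ s in auto)
  have out: "operand_poly (gate_polys gs) x = permanent_poly n"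
    using c cx by (simp add: computes_def circuit_poly_def gate_polys_def)
  have "(\<Prod>i=1..n. monom (s (i, \<sigma> i)) 1) = monom (\<Prod>i=1..n. s (i, \<sigma> i)) n" for \<sigma> :: "nat \<Rightarrow> nat"
    by (induction n) (simp_all add: mult_monom mult.commute one_pCons monom_0)
  then have "eval (\<lambda>v. monom (s v) 1) (permanent_poly n) = monom (permanent n s) n"
    by (simp add: permanent_poly_def permanent_def eval_sum eval_prod eval_mvar monom_sum)
  then have p: "part x n = permanent n s" by (simp add: part_def out)
  show ?thesis
  proof (cases x)
    case (Gate j)
    have "low (2 ^ R - 1) (1 + R * ((R + S + 2) * (R + S + 1)))"
      by (rule low_iterate) (use size cx in \<open>auto simp: circuit_size_def\<close>)
    moreover have "n \<le> 2 ^ R - 1" using n by simp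
    ultimately have "part (Gate j) n \<in> formulas (1 + R * ((R + S + 2) * (R + S + 1)))"
      unfolding low_def using Gate circ(2) by auto
    then show ?thesis using p Gate by simp
  next
    case (Input v)
    then have "permanent n s \<in> formulas 1"
      using p s[of v] formulas_0[of 1] by (cases "n = 1") (simp_all add: part_Input)
    then show ?thesis by (rule formulas_mono[rotated]) simp
  next
    case One
    then have "permanent n s \<in> formulas 1" using p formulas_0[of 1] formulas_1[of 1]
      by (auto simp: part_One split: if_splits)
    then show ?thesis by (rule formulas_mono[rotated]) simp
  qed
qed

section \<open>Permanents as coefficients\<close>

definition per :: "'i set \<Rightarrow> ('i \<Rightarrow> 'i \<Rightarrow> 'r::comm_ring_1) \<Rightarrow> 'r" where
  "per I M = (\<Sum>\<sigma> | \<sigma> permutes I. \<Prod>i\<in>I. M i (\<sigma> i))"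

lemma permanent_reindex:
  assumes b: "bij_betw b {1..n} I"
  shows "permanent n (\<lambda>(i, j). M (b i) (b j)) = per I M"
proof -
  let ?h = "\<lambda>\<pi> x. if x \<in> I then b (\<pi> (inv_into {1..n} b x)) else x"
  have "per I M = (\<Sum>\<sigma> | \<sigma> permutes {1..n}. \<Prod>i\<in>I. M i (?h \<sigma> i))"
    unfolding per_def by (rule sum.reindex_bij_betw[OF bij_betw_permutations[OF b], symmetric])
  also have "\<dots> = (\<Sum>\<sigma> | \<sigma> permutes {1..n}. \<Prod>i=1..n. M (b i) (b (\<sigma> i)))"
  proof (intro sum.cong refl)
    fix \<sigma> assume "\<sigma> \<in> {\<sigma>. \<sigma> permutes {1..n}}"
    have "(\<Prod>i\<in>I. M i (?h \<sigma> i)) = (\<Prod>i=1..n. M (b i) (?h \<sigma> (b i)))"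
      by (rule prod.reindex_bij_betw[OF b, symmetric])
    also have "\<dots> = (\<Prod>i=1..n. M (b i) (b (\<sigma> i)))"
    proof (intro prod.cong refl)
      fix i assume i: "i \<in> {1..n}"
      have "b i \<in> I" using b i by (auto simp: bij_betw_def)
      moreover have "inv_into {1..n} b (b i) = i" using b i by (simp add: bij_betw_def)
      ultimately show "M (b i) (?h \<sigma> (b i)) = M (b i) (b (\<sigma> i))" by simp
    qed
    finally show "(\<Prod>i\<in>I. M i (?h \<sigma> i)) = (\<Prod>i=1..n. M (b i) (b (\<sigma> i)))" .
  qed
  finally show ?thesis by (simp add: permanent_def)
qed

lemma prod_of_sums:
  fixes f :: "'i \<Rightarrow> 'c \<Rightarrow> 'r::comm_semiring_1"
  assumes "finite I" "finite C"
  shows "(\<Prod>i\<in>I. \<Sum>c\<in>C. f i c) = (\<Sum>\<phi>\<in>I \<rightarrow>\<^sub>E C. \<Prod>i\<in>I. f i (\<phi> i))"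
  using assms(1)
proof (induction I rule: finite_induct)
  case empty
  then show ?case by simp
next
  case (insert i I)
  have inj: "inj_on (\<lambda>(y, g). g(i := y)) (C \<times> (I \<rightarrow>\<^sub>E C))"
    using insert(2) by (rule inj_combinator)
  have "(\<Sum>\<phi>\<in>insert i I \<rightarrow>\<^sub>E C. \<Prod>j\<in>insert i I. f j (\<phi> j)) =
      (\<Sum>(y, g)\<in>C \<times> (I \<rightarrow>\<^sub>E C). \<Prod>j\<in>insert i I. f j ((g(i := y)) j))"
    unfolding PiE_insert_eq by (subst sum.reindex[OF inj]) (simp add: case_prod_unfold)
  also have "\<dots> = (\<Sum>(y, g)\<in>C \<times> (I \<rightarrow>\<^sub>E C). f i y * (\<Prod>j\<in>I. f j (g j)))"
  proof (intro sum.cong refl, clarify)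
    fix y g
    have "(\<Prod>j\<in>I. f j ((g(i := y)) j)) = (\<Prod>j\<in>I. f j (g j))"
      using insert(2) by (intro prod.cong) auto
    then show "(\<Prod>j\<in>insert i I. f j ((g(i := y)) j)) = f i y * (\<Prod>j\<in>I. f j (g j))"
      using insert(1,2) by simp
  qed
  also have "\<dots> = (\<Sum>y\<in>C. f i y) * (\<Sum>g\<in>I \<rightarrow>\<^sub>E C. \<Prod>j\<in>I. f j (g j))"
    by (simp add: sum_product sum.cartesian_product)
  finally show ?case using insert by simp
qed

text \<open>
  Rows of a matrix become linear forms in variables that stand for the columns.  The exponent \<open>full I\<close> is
  that of the product of all variables.
\<close>

definition X :: "'i \<Rightarrow> ('i \<Rightarrow>\<^sub>0 nat) \<Rightarrow>\<^sub>0 'r::comm_ring_1" where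
  "X c = mon (mon c 1) 1"

definition full :: "'i set \<Rightarrow> ('i \<Rightarrow>\<^sub>0 nat)" where
  "full I = (\<Sum>c\<in>I. mon c 1)"

lemma look_sum_mon: "finite I \<Longrightarrow> look (\<Sum>i\<in>I. mon (\<phi> i) 1) c = card {i \<in> I. \<phi> i = c}"
proof -
  assume "finite I"
  have "look (\<Sum>i\<in>I. mon (\<phi> i) (1::nat)) c = (\<Sum>i\<in>I. if \<phi> i = c then 1 else 0)"
    unfolding lookup_sum by (intro sum.cong) (auto simp: lookup_single when_def)
  also have "\<dots> = card {i \<in> I. \<phi> i = c}"
    using \<open>finite I\<close> by (simp add: sum.If_cases Int_def)
  finally show ?thesis .
qed

lemma look_full: "finite I \<Longrightarrow> look (full I) c = (if c \<in> I then 1 else 0)"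
proof -
  assume "finite I"
  then have "look (full I) c = card {i \<in> I. i = c}" using look_sum_mon[of I "\<lambda>i. i"] by (simp add: full_def)
  also have "{i \<in> I. i = c} = (if c \<in> I then {c} else {})" by auto
  finally show ?thesis by simp
qed

lemma prod_mon: "(\<Prod>i\<in>I. mon (m i) (a i)) = mon (\<Sum>i\<in>I. m i) (\<Prod>i\<in>I. a i :: 'r::comm_ring_1)"
  by (induction I rule: infinite_finite_induct) (auto simp: mult_single)

text \<open>
  Multiplying out the product chooses a column for each row.  Each column is chosen once if and only if the
  choice is a permutation.
\<close>

theorem coeff_full_eq_per:
  assumes I: "finite I"
  shows "look (\<Prod>r\<in>I. \<Sum>c\<in>I. mon (mon c 1) (M r c)) (full I) = per I M"
proof -
  let ?P = "{\<sigma>. \<sigma> permutes I}"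
  let ?good = "\<lambda>\<phi>. (\<Sum>r\<in>I. mon (\<phi> r) (1::nat)) = full I"
  have "look (\<Prod>r\<in>I. \<Sum>c\<in>I. mon (mon c 1) (M r c)) (full I) =
      (\<Sum>\<phi>\<in>I \<rightarrow>\<^sub>E I. if ?good \<phi> then \<Prod>r\<in>I. M r (\<phi> r) else 0)"
    unfolding prod_of_sums[OF I I] prod_mon lookup_sum
    by (intro sum.cong refl) (simp only: lookup_single when_def)
  also have "\<dots> = (\<Sum>\<phi>\<in>{\<phi> \<in> I \<rightarrow>\<^sub>E I. ?good \<phi>}. \<Prod>r\<in>I. M r (\<phi> r))"
    using I by (simp add: finite_PiE flip: sum.inter_filter)
  also have "{\<phi> \<in> I \<rightarrow>\<^sub>E I. ?good \<phi>} = (\<lambda>\<sigma>. restrict \<sigma> I) ` ?P"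
  proof (intro equalityI subsetI)
    fix \<phi> assume "\<phi> \<in> {\<phi> \<in> I \<rightarrow>\<^sub>E I. ?good \<phi>}"
    then have \<phi>: "\<phi> \<in> I \<rightarrow>\<^sub>E I" and good: "?good \<phi>" by auto
    have "\<exists>r\<in>I. \<phi> r = c" if "c \<in> I" for c
    proof -
      have "card {r \<in> I. \<phi> r = c} = 1"
        using look_sum_mon[OF I, of \<phi> c] look_full[OF I, of c] good that by simp
      then show ?thesis by (metis (mono_tags, lifting) card_1_singletonE insertI1 mem_Collect_eq)
    qed
    then have "\<phi> ` I = I" using \<phi> by auto
    then have "bij_betw \<phi> I I" using I by (simp add: bij_betw_def eq_card_imp_inj_on)
    then have "bij_betw (\<lambda>x. if x \<in> I then \<phi> x else x) I I" by (rule bij_betw_cong[THEN iffD1, rotated]) simp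
    then have "(\<lambda>x. if x \<in> I then \<phi> x else x) permutes I" by (rule bij_imp_permutes) simp
    moreover have "\<phi> = restrict (\<lambda>x. if x \<in> I then \<phi> x else x) I"
      using \<phi> by (auto simp: restrict_def fun_eq_iff PiE_iff extensional_def)
    ultimately show "\<phi> \<in> (\<lambda>\<sigma>. restrict \<sigma> I) ` ?P" by blast
  next
    fix \<phi> assume "\<phi> \<in> (\<lambda>\<sigma>. restrict \<sigma> I) ` ?P"
    then obtain \<sigma> where \<sigma>: "\<sigma> permutes I" "\<phi> = restrict \<sigma> I" by blast
    have "(\<Sum>r\<in>I. mon (\<phi> r) (1::nat)) = (\<Sum>r\<in>I. mon (\<sigma> r) 1)" using \<sigma>(2) by (intro sum.cong) auto
    also have "\<dots> = full I"
      unfolding full_def by (rule sum.permute[OF \<sigma>(1), of "\<lambda>c. mon c 1", unfolded comp_def, symmetric])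
    finally show "\<phi> \<in> {\<phi> \<in> I \<rightarrow>\<^sub>E I. ?good \<phi>}" using \<sigma> permutes_in_image[OF \<sigma>(1)] by auto
  qed
  also have "(\<Sum>\<phi>\<in>(\<lambda>\<sigma>. restrict \<sigma> I) ` ?P. \<Prod>r\<in>I. M r (\<phi> r)) = (\<Sum>\<sigma>\<in>?P. \<Prod>r\<in>I. M r (restrict \<sigma> I r))"
  proof (subst sum.reindex)
    show "inj_on (\<lambda>\<sigma>. restrict \<sigma> I) ?P"
    proof (rule inj_onI)
      fix \<sigma> \<tau> assume *: "\<sigma> \<in> ?P" "\<tau> \<in> ?P" "restrict \<sigma> I = restrict \<tau> I"
      show "\<sigma> = \<tau>"
      proof
        fix x show "\<sigma> x = \<tau> x"
        proof (cases "x \<in> I")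
          case True
          then show ?thesis using fun_cong[OF *(3), of x] by simp
        next
          case False
          then show ?thesis using *(1,2) by (simp add: permutes_not_in)
        qed
      qed
    qed
  qed simp
  also have "\<dots> = per I M" unfolding per_def by (intro sum.cong prod.cong) auto
  finally show ?thesis .
qed

lemma look_square_multiple:
  assumes "finite I" shows "look (X c * (X c * Q)) (full I) = 0"
proof (rule ccontr)
  have two: "mon c (1::nat) + mon c 1 = mon c 2" by (simp only: single_add[symmetric] one_add_one)
  have sq: "X c * (X c * Q) = mon (mon c 2) 1 * Q"
    unfolding X_def mult.assoc[symmetric] mult_single by (simp only: two mult_1_left)
  assume "look (X c * (X c * Q)) (full I) \<noteq> 0"
  then have "full I \<in> Poly_Mapping.keys ((mon (mon c 2) 1) * Q)"
    unfolding sq by (simp only: in_keys_iff not_False_eq_True)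
  then obtain m where "full I = mon c 2 + m"
    using keys_mult[of "mon (mon c 2) 1" Q] by (auto split: if_splits)
  then have "look (full I) c \<ge> 2" by (simp add: lookup_add)
  then show False using look_full[OF assms, of c] by (simp split: if_splits)
qed

definition free_of :: "'i \<Rightarrow> (('i \<Rightarrow>\<^sub>0 nat) \<Rightarrow>\<^sub>0 'r::comm_ring_1) \<Rightarrow> bool" where
  "free_of g P \<longleftrightarrow> (\<forall>m\<in>Poly_Mapping.keys P. look m g = 0)"

lemma free_of_add: "free_of g P \<Longrightarrow> free_of g Q \<Longrightarrow> free_of g (P + Q)"
  using keys_add[of P Q] unfolding free_of_def by blast

lemma free_of_mult: "free_of g P \<Longrightarrow> free_of g Q \<Longrightarrow> free_of g (P * Q)"
  using keys_mult[of P Q] unfolding free_of_def by (fastforce simp: lookup_add)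

lemma free_of_X: "g \<noteq> c \<Longrightarrow> free_of g (X c)"
  by (auto simp: free_of_def X_def lookup_single)

lemma free_of_const: "free_of g (mon 0 a)"
  by (auto simp: free_of_def split: if_splits)

lemma free_of_uminus: "free_of g P \<Longrightarrow> free_of g (- P)"
  by (simp add: free_of_def)

lemma free_of_diff: "free_of g P \<Longrightarrow> free_of g Q \<Longrightarrow> free_of g (P - Q)"
  by (metis free_of_add free_of_uminus diff_conv_add_uminus)

lemma free_of_prod: "(\<And>i. i \<in> A \<Longrightarrow> free_of g (f i)) \<Longrightarrow> free_of g (\<Prod>i\<in>A. f i)"
  by (induction A rule: infinite_finite_induct)
     (auto intro: free_of_mult simp: free_of_const[of g 1, simplified])

lemmas free_of_intros = free_of_add free_of_mult free_of_diff free_of_uminus free_of_X free_of_const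

lemma look_free_of: "finite I \<Longrightarrow> g \<in> I \<Longrightarrow> free_of g P \<Longrightarrow> look P (full I) = 0"
  using look_full[of I g] unfolding free_of_def by (metis in_keys_iff one_neq_zero)

section \<open>A gadget for pairs of rows\<close>

text \<open>
  The linear forms of three rows which share a column \<open>g\<close> occurring in no other row.  Modulo
  squares, the coefficient of \<open>g\<close> in their product is the product of \<open>c + r\<close> and \<open>c' + r'\<close>, except
  that the term \<open>c c'\<close> gets the weight \<open>1 - 2 u\<close>.
\<close>

lemma gadget_identity:
  fixes c c' r r' g u :: "'r::comm_ring_1"
  shows "((1 - u) * c - u * c' + r + u * g) * (r' - c + g) * (c + c' + g) =
    g * (r * r' + c * r' + c' * r + (1 - 2 * u) * c * c') +
    ((1 - u) * c - u * c' + r) * (r' - c) * (c + c') +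
    c * (c * (- u * g)) + c' * (c' * (- u * g)) +
    g * (g * (u * (r' - c) + ((1 - u) * c - u * c' + r) + u * (c + c') + u * g))"
  by (simp add: algebra_simps)

text \<open>
  Multiples of a square do not contribute to the coefficient of the square-free monomial \<open>full I\<close>, and neither
  do terms free of the variable \<open>g\<close>.
\<close>

lemma gadget:
  assumes I: "finite I" "g \<in> I" and H: "free_of g H"
    and free: "g \<noteq> c" "g \<noteq> c'" "g \<noteq> r" "g \<noteq> r'"
  shows "look ((((1 - mon 0 u) * X c - mon 0 u * X c' + X r + mon 0 u * X g) * (X r' - X c + X g) *
      (X c + X c' + X g)) * H) (full I) =
    look (X g * (X r * X r' + X c * X r' + X c' * X r + mon 0 (1 - 2 * u) * X c * X c') * H) (full I)"
proof -
  let ?u = "mon 0 u"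
  have two: "mon 0 (1 - 2 * u) = (1 - 2 * ?u :: ('a \<Rightarrow>\<^sub>0 nat) \<Rightarrow>\<^sub>0 'b)"
    by (simp add: single_diff mult_single flip: single_numeral)
  have one: "free_of g (1 :: ('a \<Rightarrow>\<^sub>0 nat) \<Rightarrow>\<^sub>0 'b)" using free_of_const[of g 1] by simp
  have fr: "free_of g (((1 - ?u) * X c - ?u * X c' + X r) * (X r' - X c) * (X c + X c') * H)"
    by (intro free_of_intros one H) (use free in auto)
  have squares: "look ((Q1 + Q2 + X c * (X c * a1) + X c' * (X c' * a2) + X g * (X g * a3)) * H) (full I) =
      look (Q1 * H) (full I)" if "look (Q2 * H) (full I) = 0" for Q1 Q2 a1 a2 a3
    using that by (simp add: distrib_right lookup_add mult.assoc look_square_multiple[OF I(1)])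
  show ?thesis
    unfolding gadget_identity two by (rule squares) (rule look_free_of[OF I fr])
qed

text \<open>
  The gadgets can be replaced one by one, because the variable of a gadget occurs in no other factor.
\<close>

lemma replace_factors:
  assumes "finite F"
    and "\<And>e H. e \<in> F \<Longrightarrow> free_of (g e) H \<Longrightarrow> look (A e * H) m = look (B e * H) m"
    and "\<And>e e'. e \<in> F \<Longrightarrow> e' \<in> F \<Longrightarrow> e \<noteq> e' \<Longrightarrow> free_of (g e) (A e') \<and> free_of (g e) (B e')"
    and "\<And>e. e \<in> F \<Longrightarrow> free_of (g e) D"
  shows "look (D * (\<Prod>e\<in>F. A e)) m = look (D * (\<Prod>e\<in>F. B e)) m"
  using assms
proof (induction F arbitrary: D rule: finite_induct)
  case empty
  then show ?case by simp
next
  case (insert e F)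
  have "free_of (g e) (D * (\<Prod>e\<in>F. A e))"
  proof (intro free_of_mult free_of_prod)
    show "free_of (g e) D" by (rule insert.prems(3)) simp
    show "free_of (g e) (A e')" if "e' \<in> F" for e'
      using insert.prems(2)[of e e'] insert.hyps that by auto
  qed
  then have "look (A e * (D * (\<Prod>e\<in>F. A e))) m = look (B e * (D * (\<Prod>e\<in>F. A e))) m"
    using insert.prems(1) by blast
  moreover have "look ((B e * D) * (\<Prod>e\<in>F. A e)) m = look ((B e * D) * (\<Prod>e\<in>F. B e)) m"
  proof (rule insert.IH)
    show "look (A e' * H) m = look (B e' * H) m" if "e' \<in> F" "free_of (g e') H" for e' H
      using insert.prems(1) that by simp
    show "free_of (g e1) (A e2) \<and> free_of (g e1) (B e2)" if "e1 \<in> F" "e2 \<in> F" "e1 \<noteq> e2" for e1 e2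
      using insert.prems(2) that by simp
    show "free_of (g e') (B e * D)" if "e' \<in> F" for e'
      using insert.prems(2)[of e' e] insert.prems(3)[of e'] insert.hyps that by (auto intro!: free_of_mult)
  qed
  ultimately show ?case
    using insert.hyps by (simp add: mult_ac)
qed

lemma (in comm_monoid_set) square_split:
  "F h ({..<\<nu>} \<times> {..<\<nu>}) =
    F (\<lambda>e. h e \<^bold>* h (prod.swap e)) {(j, k). j < k \<and> k < \<nu>} \<^bold>* F (\<lambda>j. h (j, j)) {..<\<nu>}" for \<nu> :: nat
proof -
  let ?E = "{(j, k). j < k \<and> k < \<nu>}" and ?D = "(\<lambda>j. (j, j)) ` {..<\<nu>}"
  have fin: "finite ?E" by (rule finite_subset[of _ "{..<\<nu>} \<times> {..<\<nu>}"]) auto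
  have eq: "{..<\<nu>} \<times> {..<\<nu>} = (?E \<union> prod.swap ` ?E) \<union> ?D"
    by (auto simp: image_iff)
  have "F h ({..<\<nu>} \<times> {..<\<nu>}) = F h (?E \<union> prod.swap ` ?E) \<^bold>* F h ?D"
    unfolding eq by (rule union_disjoint) (use fin in auto)
  also have "F h (?E \<union> prod.swap ` ?E) = F h ?E \<^bold>* F h (prod.swap ` ?E)"
    by (rule union_disjoint) (use fin in auto)
  also have "F h (prod.swap ` ?E) = F (\<lambda>e. h (prod.swap e)) ?E"
    by (subst reindex) (auto simp: comp_def)
  also have "F h ?D = F (\<lambda>j. h (j, j)) {..<\<nu>}"
    by (subst reindex) (auto simp: inj_on_def comp_def)
  finally show ?thesis by (simp add: distrib)
qed

section \<open>A permanent summing over all subsets\<close>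

abbreviation cell :: "nat \<times> nat \<Rightarrow> bool \<times> nat \<times> nat" where "cell x \<equiv> (False, x)"
abbreviation gad :: "nat \<times> nat \<Rightarrow> bool \<times> nat \<times> nat" where "gad x \<equiv> (True, x)"

definition pairs :: "nat \<Rightarrow> (nat \<times> nat) set" where
  "pairs \<nu> = {(j, k). j < k \<and> k < \<nu>}"

lemma finite_pairs [simp]: "finite (pairs \<nu>)"
  by (rule finite_subset[of _ "{..<\<nu>} \<times> {..<\<nu>}"]) (auto simp: pairs_def)

text \<open>
  The matrix has a row and a column for each cell of a square, and for each pair of mirror images in it.
\<close>

definition indices :: "nat \<Rightarrow> (bool \<times> nat \<times> nat) set" where
  "indices \<nu> = cell ` ({..<\<nu>} \<times> {..<\<nu>}) \<union> gad ` pairs \<nu>"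

lemma finite_indices [simp]: "finite (indices \<nu>)" by (simp add: indices_def)

text \<open>
  A matrix whose permanent is a sum over all subsets \<open>S\<close> of \<open>{..<\<nu>}\<close>.  The cells \<open>(j, k)\<close> with the same \<open>j\<close>
  form a cycle, in which the row of a cell uses its own column or that of the next cell.  Since columns are
  used once, all cells of the cycle make the same choice, and \<open>S\<close> consists of those \<open>j\<close> whose cells keep their
  own columns.  The diagonal cell gives \<open>j\<close> the weight \<open>x j\<close>, and a gadget at the cells \<open>(j, k)\<close> and \<open>(k, j)\<close>
  gives the pair the weight \<open>1 - 2 * u (j, k)\<close> if both of its elements are in \<open>S\<close>.
\<close>

locale subset_permanent =
  fixes \<nu> :: nat and x :: "nat \<Rightarrow> 'r::comm_ring_1" and u :: "nat \<times> nat \<Rightarrow> 'r"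
begin

definition right :: "nat \<times> nat \<Rightarrow> nat \<times> nat" where
  "right y = (fst y, (snd y + 1) mod \<nu>)"

fun row :: "bool \<times> nat \<times> nat \<Rightarrow> ((bool \<times> nat \<times> nat) \<Rightarrow>\<^sub>0 nat) \<Rightarrow>\<^sub>0 'r" where
  "row (False, j, k) = (
     if j = k then mon 0 (x j) * X (cell (j, k)) + X (cell (right (j, k)))
     else if j < k then (1 - mon 0 (u (j, k))) * X (cell (j, k)) - mon 0 (u (j, k)) * X (cell (k, j)) +
       X (cell (right (j, k))) + mon 0 (u (j, k)) * X (gad (j, k))
     else X (cell (right (j, k))) - X (cell (k, j)) + X (gad (k, j)))"
| "row (True, j, k) = X (cell (j, k)) + X (cell (k, j)) + X (gad (j, k))"

definition matrix :: "bool \<times> nat \<times> nat \<Rightarrow> bool \<times> nat \<times> nat \<Rightarrow> 'r" where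
  "matrix r c = look (row r) (mon c 1)"

definition linear_on :: "'i set \<Rightarrow> (('i \<Rightarrow>\<^sub>0 nat) \<Rightarrow>\<^sub>0 'r) \<Rightarrow> bool" where
  "linear_on I P \<longleftrightarrow> Poly_Mapping.keys P \<subseteq> (\<lambda>c. mon c 1) ` I"

lemma linear_on_X: "c \<in> I \<Longrightarrow> linear_on I (X c)"
  by (auto simp: linear_on_def X_def)

lemma linear_on_add: "linear_on I P \<Longrightarrow> linear_on I Q \<Longrightarrow> linear_on I (P + Q)"
  using keys_add[of P Q] unfolding linear_on_def by blast

lemma linear_on_uminus: "linear_on I P \<Longrightarrow> linear_on I (- P)"
  by (simp add: linear_on_def)

lemma linear_on_diff: "linear_on I P \<Longrightarrow> linear_on I Q \<Longrightarrow> linear_on I (P - Q)"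
  using linear_on_add[of I P "- Q"] linear_on_uminus[of I Q] by simp

lemma linear_on_scale: "linear_on I P \<Longrightarrow> linear_on I (mon 0 a * P)"
  using keys_mult[of "mon 0 a" P] unfolding linear_on_def by (fastforce split: if_splits)

lemma linear_on_expand:
  assumes "finite I" "linear_on I P"
  shows "P = (\<Sum>c\<in>I. mon (mon c 1) (look P (mon c 1)))"
proof -
  have inj: "inj_on (\<lambda>c. mon c (1::nat)) I"
    by (rule inj_onI) (metis lookup_single_eq lookup_single_not_eq zero_neq_one)
  have "P = (\<Sum>m\<in>(\<lambda>c. mon c 1) ` I. mon m (look P m))"
    by (subst sum_singles, rule sum.mono_neutral_left)
       (use assms in \<open>auto simp: linear_on_def in_keys_iff\<close>)
  also have "\<dots> = (\<Sum>c\<in>I. mon (mon c 1) (look P (mon c 1)))"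
    by (subst sum.reindex[OF inj]) simp
  finally show ?thesis .
qed

lemma right_in: "y \<in> {..<\<nu>} \<times> {..<\<nu>} \<Longrightarrow> right y \<in> {..<\<nu>} \<times> {..<\<nu>}"
  by (auto simp: right_def)

lemma linear_row: "r \<in> indices \<nu> \<Longrightarrow> linear_on (indices \<nu>) (row r)"
proof -
  assume r: "r \<in> indices \<nu>"
  have X: "linear_on (indices \<nu>) (X c)" if "c \<in> indices \<nu>" for c using that by (rule linear_on_X)
  have one: "(1 - mon 0 a) * P = P - mon 0 a * P" for a :: 'r and P :: "((bool \<times> nat \<times> nat) \<Rightarrow>\<^sub>0 nat) \<Rightarrow>\<^sub>0 'r"
    by (simp add: left_diff_distrib)
  obtain b j k where rb: "r = (b, j, k)" by (cases r)
  have cells: "j < \<nu>" "k < \<nu>" using r rb by (auto simp: indices_def pairs_def)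
  have in_c: "cell (j, k) \<in> indices \<nu>" "cell (k, j) \<in> indices \<nu>" "cell (right (j, k)) \<in> indices \<nu>"
    using cells right_in[of "(j, k)"] by (auto simp: indices_def)
  have in_g: "j < k \<Longrightarrow> gad (j, k) \<in> indices \<nu>" "k < j \<Longrightarrow> gad (k, j) \<in> indices \<nu>"
    using cells by (auto simp: indices_def pairs_def)
  show ?thesis
  proof (cases b)
    case True
    then have "j < k" using r rb by (auto simp: indices_def pairs_def)
    then show ?thesis
      unfolding rb using True in_c in_g by (auto intro!: linear_on_add X)
  next
    case False
    show ?thesis
      unfolding rb using False in_c in_g
      by (auto simp: one intro!: linear_on_add linear_on_diff linear_on_scale X)
  qed
qed

lemma per_matrix: "per (indices \<nu>) matrix = look (\<Prod>r\<in>indices \<nu>. row r) (full (indices \<nu>))"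
proof -
  have "(\<Prod>r\<in>indices \<nu>. row r) = (\<Prod>r\<in>indices \<nu>. \<Sum>c\<in>indices \<nu>. mon (mon c 1) (matrix r c))"
    unfolding matrix_def by (intro prod.cong refl linear_on_expand finite_indices linear_row)
  then show ?thesis using coeff_full_eq_per[OF finite_indices, of matrix] by (simp only:)
qed

definition diag :: "nat \<Rightarrow> ((bool \<times> nat \<times> nat) \<Rightarrow>\<^sub>0 nat) \<Rightarrow>\<^sub>0 'r" where
  "diag j = row (cell (j, j))"

definition couple :: "nat \<times> nat \<Rightarrow> ((bool \<times> nat \<times> nat) \<Rightarrow>\<^sub>0 nat) \<Rightarrow>\<^sub>0 'r" where
  "couple e = X (gad e) * (X (cell (right e)) * X (cell (right (prod.swap e))) + X (cell e) * X (cell (right (prod.swap e))) +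
     X (cell (prod.swap e)) * X (cell (right e)) + mon 0 (1 - 2 * u e) * X (cell e) * X (cell (prod.swap e)))"

lemma prod_rows:
  "(\<Prod>r\<in>indices \<nu>. row r) =
   (\<Prod>j<\<nu>. diag j) * (\<Prod>e\<in>pairs \<nu>. row (cell e) * row (cell (prod.swap e)) * row (gad e))"
proof -
  have "(\<Prod>r\<in>indices \<nu>. row r) = (\<Prod>r\<in>cell ` ({..<\<nu>} \<times> {..<\<nu>}). row r) * (\<Prod>r\<in>gad ` pairs \<nu>. row r)"
    unfolding indices_def by (rule prod.union_disjoint) auto
  also have "(\<Prod>r\<in>cell ` ({..<\<nu>} \<times> {..<\<nu>}). row r) = (\<Prod>y\<in>{..<\<nu>} \<times> {..<\<nu>}. row (cell y))"
    by (subst prod.reindex) (auto simp: inj_on_def)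
  also have "(\<Prod>r\<in>gad ` pairs \<nu>. row r) = (\<Prod>e\<in>pairs \<nu>. row (gad e))"
    by (subst prod.reindex) (auto simp: inj_on_def)
  finally show ?thesis
    by (simp add: prod.square_split[of "\<lambda>y. row (cell y)"] pairs_def[symmetric] diag_def prod.distrib mult_ac)
qed

lemma free_couple: "g \<noteq> e \<Longrightarrow> free_of (gad g) (couple e)"
  unfolding couple_def by (intro free_of_intros) auto

lemma free_diag: "free_of (gad g) (diag j)"
  unfolding diag_def by (auto intro!: free_of_intros)

lemma free_triple:
  assumes "g \<noteq> e" "e \<in> pairs \<nu>"
  shows "free_of (gad g) (row (cell e) * row (cell (prod.swap e)) * row (gad e))"
proof -
  obtain j k where e: "e = (j, k)" "j < k" using assms(2) by (auto simp: pairs_def)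
  have one: "free_of (gad g) (1 :: ((bool \<times> nat \<times> nat) \<Rightarrow>\<^sub>0 nat) \<Rightarrow>\<^sub>0 'r)"
    using free_of_const[of "gad g" 1] by simp
  show ?thesis
    using assms(1) e by (auto intro!: free_of_intros one)
qed

lemma per_couples:
  "per (indices \<nu>) matrix = look ((\<Prod>j<\<nu>. diag j) * (\<Prod>e\<in>pairs \<nu>. couple e)) (full (indices \<nu>))"
  unfolding per_matrix prod_rows
proof (rule replace_factors[where g = gad])
  fix e :: "nat \<times> nat" and H :: "((bool \<times> nat \<times> nat) \<Rightarrow>\<^sub>0 nat) \<Rightarrow>\<^sub>0 'r"
  assume "e \<in> pairs \<nu>" and H: "free_of (gad e) H"
  then obtain j k where e: "e = (j, k)" "j < k" "k < \<nu>" by (auto simp: pairs_def)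
  have g: "gad e \<in> indices \<nu>" using \<open>e \<in> pairs \<nu>\<close> by (simp add: indices_def)
  show "look (row (cell e) * row (cell (prod.swap e)) * row (gad e) * H) (full (indices \<nu>)) =
      look (couple e * H) (full (indices \<nu>))"
    using gadget[OF finite_indices g H, of "cell e" "cell (prod.swap e)" "cell (right e)" "cell (right (prod.swap e))" "u e"] e
    by (simp add: couple_def)
next
  fix e e' assume "e \<in> pairs \<nu>" "e' \<in> pairs \<nu>" "e \<noteq> e'"
  then show "free_of (gad e) (row (cell e') * row (cell (prod.swap e')) * row (gad e')) \<and>
      free_of (gad e) (couple e')"
    using free_triple free_couple by blast
next
  show "free_of (gad e) (\<Prod>j<\<nu>. diag j)" for e by (intro free_of_prod free_diag)
qed simp

text \<open>Each cell chooses between its own column and the next one in its cycle.\<close>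

definition target :: "nat \<times> nat \<Rightarrow> bool \<Rightarrow> nat \<times> nat" where
  "target y b = (if b then y else right y)"

lemma diag_expand:
  "diag j = (\<Sum>b\<in>UNIV. mon (mon (cell (target (j, j) b)) 1) (if b then x j else 1))"
  by (simp add: diag_def UNIV_bool target_def X_def mult_single add.commute)

lemma couple_expand:
  "couple e = (\<Sum>b\<in>UNIV. mon (mon (gad e) 1 + mon (cell (target e (fst b))) 1 +
     mon (cell (target (prod.swap e) (snd b))) 1) (if fst b \<and> snd b then 1 - 2 * u e else 1))"
proof -
  have "(\<Sum>b\<in>UNIV. f b) = f (True, True) + f (True, False) + f (False, True) + f (False, False)"
    for f :: "bool \<times> bool \<Rightarrow> ((bool \<times> nat \<times> nat) \<Rightarrow>\<^sub>0 nat) \<Rightarrow>\<^sub>0 'r"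
    by (simp add: UNIV_Times_UNIV[symmetric] UNIV_bool sum.cartesian_product[symmetric] ac_simps)
  then show ?thesis
    by (simp add: couple_def target_def X_def mult_single algebra_simps)
qed

lemma sum_cycle:
  fixes f :: "nat \<Rightarrow> 'm::comm_monoid_add"
  shows "(\<Sum>k<\<nu>. f ((k + 1) mod \<nu>)) = (\<Sum>k<\<nu>. f k)"
proof (cases \<nu>)
  case (Suc m)
  have "(\<Sum>k<\<nu>. f ((k + 1) mod \<nu>)) = (\<Sum>k<m. f (Suc k)) + f 0"
    unfolding Suc by simp
  also have "\<dots> = (\<Sum>k<\<nu>. f k)" unfolding Suc by (subst sum.lessThan_Suc_shift) (simp add: add.commute)
  finally show ?thesis .
qed simp

lemma sum_targets:
  "(\<Sum>y\<in>{..<\<nu>} \<times> {..<\<nu>}. mon (cell (target y (fst y \<in> S))) (1::nat)) = (\<Sum>y\<in>{..<\<nu>} \<times> {..<\<nu>}. mon (cell y) 1)"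
proof -
  have "(\<Sum>k<\<nu>. mon (cell (target (j, k) (j \<in> S))) (1::nat)) = (\<Sum>k<\<nu>. mon (cell (j, k)) 1)" for j
    using sum_cycle[of "\<lambda>k. mon (cell (j, k)) 1"]
    by (cases "j \<in> S") (simp_all only: target_def right_def if_True if_False fst_conv snd_conv)
  then have "(\<Sum>j<\<nu>. \<Sum>k<\<nu>. mon (cell (target (j, k) (j \<in> S))) (1::nat)) = (\<Sum>j<\<nu>. \<Sum>k<\<nu>. mon (cell (j, k)) 1)"
    by (simp only:)
  then show ?thesis by (simp only: sum.cartesian_product case_prod_unfold prod.collapse)
qed

text \<open>
  If a cell takes the column of the next cell, the next cell has to move on as well, and so on around the cycle.
\<close>

lemma targets_constant:
  assumes eq: "(\<Sum>y\<in>{..<\<nu>} \<times> {..<\<nu>}. mon (cell (target y (t y))) (1::nat)) = (\<Sum>y\<in>{..<\<nu>} \<times> {..<\<nu>}. mon (cell y) 1)"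
    and "j < \<nu>" "k < \<nu>" "l < \<nu>" "t (j, k)"
  shows "t (j, l)"
proof (rule ccontr)
  let ?Q = "{..<\<nu>} \<times> {..<\<nu>}"
  assume nl: "\<not> t (j, l)"
  have step: "\<not> t (j, (m + 1) mod \<nu>)" if m: "m < \<nu>" "\<not> t (j, m)" for m
  proof
    let ?m' = "(m + 1) mod \<nu>"
    assume t': "t (j, ?m')"
    have m': "?m' < \<nu>" using m by simp
    have "card {y \<in> ?Q. cell (target y (t y)) = cell (j, ?m')} = look (\<Sum>y\<in>?Q. mon (cell (target y (t y))) 1) (cell (j, ?m'))"
      by (rule look_sum_mon[symmetric]) simp
    also have "\<dots> = card {y \<in> ?Q. cell y = cell (j, ?m')}"
      unfolding eq by (rule look_sum_mon) simp
    also have "{y \<in> ?Q. cell y = cell (j, ?m')} = {(j, ?m')}" using assms(2) m' by auto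
    finally have card1: "card {y \<in> ?Q. cell (target y (t y)) = cell (j, ?m')} = 1" by simp
    have "{(j, m), (j, ?m')} \<subseteq> {y \<in> ?Q. cell (target y (t y)) = cell (j, ?m')}"
      using assms(2) m m' t' by (auto simp: target_def right_def)
    then have "card {(j, m), (j, ?m')} \<le> 1"
      using card_mono[of "{y \<in> ?Q. cell (target y (t y)) = cell (j, ?m')}"] card1 by auto
    moreover have "(j, m) \<noteq> (j, ?m')" using m(2) t' by metis
    ultimately show False by simp
  qed
  have "\<not> t (j, (l + i) mod \<nu>)" for i
  proof (induction i)
    case 0
    then show ?case using nl assms(4) by simp
  next
    case (Suc i)
    then show ?case using step[of "(l + i) mod \<nu>"] assms(4) by (simp add: mod_Suc_eq)
  qed
  from this[of "k + \<nu> - l"] show False using assms by simp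
qed

theorem per_subsets:
  "per (indices \<nu>) matrix = (\<Sum>S\<in>Pow {..<\<nu>}. (\<Prod>j<\<nu>. if j \<in> S then x j else 1) *
     (\<Prod>e\<in>pairs \<nu>. if fst e \<in> S \<and> snd e \<in> S then 1 - 2 * u e else 1))"
proof -
  let ?Q = "{..<\<nu>} \<times> {..<\<nu>}"
  let ?P = "({..<\<nu>} \<rightarrow>\<^sub>E (UNIV :: bool set)) \<times> (pairs \<nu> \<rightarrow>\<^sub>E (UNIV :: (bool \<times> bool) set))"
  define wt where "wt = (\<lambda>(d :: nat \<Rightarrow> bool, w :: nat \<times> nat \<Rightarrow> bool \<times> bool). (\<Prod>j<\<nu>. if d j then x j else 1) *
      (\<Prod>e\<in>pairs \<nu>. if fst (w e) \<and> snd (w e) then 1 - 2 * u e else 1))"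
  define ex where "ex = (\<lambda>(d, w). (\<Sum>j<\<nu>. mon (cell (target (j, j) (d j))) (1::nat)) +
      (\<Sum>e\<in>pairs \<nu>. mon (gad e) 1 + mon (cell (target e (fst (w e)))) 1 +
        mon (cell (target (prod.swap e) (snd (w e)))) 1))"
  \<comment> \<open>The function d chooses at the diagonal cells, and w at the pairs of mirror images.\<close>
  define choice :: "(nat \<Rightarrow> bool) \<times> (nat \<times> nat \<Rightarrow> bool \<times> bool) \<Rightarrow> nat \<times> nat \<Rightarrow> bool" where
    "choice = (\<lambda>(d, w) y. if fst y < snd y then fst (w y) else if snd y < fst y then snd (w (prod.swap y)) else d (fst y))"
  have ex: "ex dw = (\<Sum>y\<in>?Q. mon (cell (target y (choice dw y))) 1) + (\<Sum>e\<in>pairs \<nu>. mon (gad e) 1)" for dw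
  proof -
    obtain d w where dw: "dw = (d, w)" by (cases dw)
    have "(\<Sum>y\<in>?Q. mon (cell (target y (choice dw y))) (1::nat)) =
        (\<Sum>e\<in>pairs \<nu>. mon (cell (target e (fst (w e)))) 1 + mon (cell (target (prod.swap e) (snd (w e)))) 1) +
        (\<Sum>j<\<nu>. mon (cell (target (j, j) (d j))) 1)"
      unfolding sum.square_split pairs_def[symmetric]
      by (intro arg_cong2[of _ _ _ _ "(+)"] sum.cong refl) (auto simp: choice_def dw pairs_def)
    then show ?thesis by (simp add: ex_def dw sum.distrib ac_simps)
  qed
  have full: "full (indices \<nu>) = (\<Sum>y\<in>?Q. mon (cell y) 1) + (\<Sum>e\<in>pairs \<nu>. mon (gad e) 1)"
  proof -
    have "full (indices \<nu>) = (\<Sum>c\<in>cell ` ?Q. mon c 1) + (\<Sum>c\<in>gad ` pairs \<nu>. mon c 1)"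
      unfolding full_def indices_def by (rule sum.union_disjoint) auto
    also have "(\<Sum>c\<in>cell ` ?Q. mon c (1::nat)) = (\<Sum>y\<in>?Q. mon (cell y) 1)"
      by (subst sum.reindex) (auto simp: inj_on_def)
    also have "(\<Sum>c\<in>gad ` pairs \<nu>. mon c (1::nat)) = (\<Sum>e\<in>pairs \<nu>. mon (gad e) 1)"
      by (subst sum.reindex) (auto simp: inj_on_def)
    finally show ?thesis .
  qed
  define sel where "sel S = (\<lambda>j\<in>{..<\<nu>}. j \<in> S, \<lambda>e\<in>pairs \<nu>. (fst e \<in> S, snd e \<in> S))" for S :: "nat set"
  have sel_choice: "choice (sel S) y = (fst y \<in> S)" if "y \<in> ?Q" for S y
    using that by (auto simp: choice_def sel_def pairs_def)
  have good: "{dw \<in> ?P. ex dw = full (indices \<nu>)} = sel ` Pow {..<\<nu>}"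
  proof (intro equalityI subsetI)
    fix dw assume "dw \<in> {dw \<in> ?P. ex dw = full (indices \<nu>)}"
    then have P: "dw \<in> ?P" and "ex dw = full (indices \<nu>)" by auto
    then have eq: "(\<Sum>y\<in>?Q. mon (cell (target y (choice dw y))) (1::nat)) = (\<Sum>y\<in>?Q. mon (cell y) 1)"
      unfolding ex full by simp
    obtain d w where dw: "dw = (d, w)" by (cases dw)
    define S where "S = {j. j < \<nu> \<and> d j}"
    have row: "choice dw (j, k) \<longleftrightarrow> j \<in> S" if "j < \<nu>" "k < \<nu>" for j k
      using targets_constant[OF eq that(1), of j k] targets_constant[OF eq that(1), of k j] that
      by (auto simp: S_def choice_def dw)
    have "d = (\<lambda>j\<in>{..<\<nu>}. j \<in> S)"
      using P dw by (auto simp: S_def restrict_def fun_eq_iff PiE_iff extensional_def)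
    moreover have "w = (\<lambda>e\<in>pairs \<nu>. (fst e \<in> S, snd e \<in> S))"
    proof
      fix e show "w e = (\<lambda>e\<in>pairs \<nu>. (fst e \<in> S, snd e \<in> S)) e"
      proof (cases "e \<in> pairs \<nu>")
        case True
        then obtain j k where e: "e = (j, k)" "j < k" "k < \<nu>" by (auto simp: pairs_def)
        have "fst (w e) \<longleftrightarrow> j \<in> S" "snd (w e) \<longleftrightarrow> k \<in> S"
          using row[of j k] row[of k j] e by (auto simp: choice_def dw)
        then have "w (j, k) = (j \<in> S, k \<in> S)" using e(1) by (simp add: prod_eq_iff)
        then show ?thesis using True e by simp
      next
        case False
        have "w \<in> extensional (pairs \<nu>)" using P dw by (auto simp: PiE_iff)
        then have "w e = undefined" using False unfolding extensional_def by blast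
        then show ?thesis using False by simp
      qed
    qed
    ultimately have "dw = sel S" by (simp add: dw sel_def)
    then show "dw \<in> sel ` Pow {..<\<nu>}" by (auto simp: S_def)
  next
    fix dw assume "dw \<in> sel ` Pow {..<\<nu>}"
    then obtain S where S: "dw = sel S" by blast
    have "(\<Sum>y\<in>?Q. mon (cell (target y (choice dw y))) (1::nat)) = (\<Sum>y\<in>?Q. mon (cell (target y (fst y \<in> S))) 1)"
      unfolding S by (intro sum.cong refl) (simp add: sel_choice)
    then have "ex dw = full (indices \<nu>)" unfolding ex full sum_targets by simp
    then show "dw \<in> {dw \<in> ?P. ex dw = full (indices \<nu>)}" by (simp add: S sel_def)
  qed
  have inj: "inj_on sel (Pow {..<\<nu>})"
  proof (rule inj_onI)
    fix S S' assume *: "S \<in> Pow {..<\<nu>}" "S' \<in> Pow {..<\<nu>}" "sel S = sel S'"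
    then have "(\<lambda>j\<in>{..<\<nu>}. j \<in> S) = (\<lambda>j\<in>{..<\<nu>}. j \<in> S')" by (simp add: sel_def)
    from fun_cong[OF this] have "j < \<nu> \<Longrightarrow> j \<in> S \<longleftrightarrow> j \<in> S'" for j by (metis lessThan_iff restrict_apply')
    then show "S = S'" using * by blast
  qed
  have "(\<Prod>j<\<nu>. diag j) * (\<Prod>e\<in>pairs \<nu>. couple e) = (\<Sum>dw\<in>?P. mon (ex dw) (wt dw))"
    unfolding diag_expand couple_expand
    by (simp add: prod_of_sums prod_mon sum_product sum.cartesian_product mult_single ex_def wt_def case_prod_unfold)
  then have "per (indices \<nu>) matrix = (\<Sum>dw\<in>?P. if ex dw = full (indices \<nu>) then wt dw else 0)"
    unfolding per_couples by (simp add: lookup_sum lookup_single when_def)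
  also have "\<dots> = (\<Sum>dw\<in>{dw \<in> ?P. ex dw = full (indices \<nu>)}. wt dw)"
    by (rule sum.inter_filter[symmetric]) (simp add: finite_PiE)
  also have "\<dots> = (\<Sum>S\<in>Pow {..<\<nu>}. wt (sel S))"
    unfolding good by (subst sum.reindex[OF inj]) simp
  also have "\<dots> = (\<Sum>S\<in>Pow {..<\<nu>}. (\<Prod>j<\<nu>. if j \<in> S then x j else 1) *
     (\<Prod>e\<in>pairs \<nu>. if fst e \<in> S \<and> snd e \<in> S then 1 - 2 * u e else 1))"
    by (intro sum.cong refl) (simp add: wt_def sel_def)
  finally show ?thesis .
qed

end

section \<open>A polynomial with quadratic exponents as a permanent\<close>

lemma card_indices: "card (indices \<nu>) \<le> 2 * \<nu> ^ 2"
proof -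
  have "card (indices \<nu>) \<le> card (cell ` ({..<\<nu>} \<times> {..<\<nu>})) + card (gad ` pairs \<nu>)"
    unfolding indices_def by (rule card_Un_le)
  also have "\<dots> \<le> card ({..<\<nu>} \<times> {..<\<nu>}) + card (pairs \<nu>)"
    by (intro add_mono card_image_le) auto
  also have "card (pairs \<nu>) \<le> card ({..<\<nu>} \<times> {..<\<nu>})"
    by (intro card_mono) (auto simp: pairs_def)
  finally show ?thesis by (simp add: power2_eq_square)
qed

lemma sum_binary:
  fixes h :: "nat \<Rightarrow> 'm::comm_monoid_add"
  shows "(\<Sum>S\<in>Pow {..<\<nu>}. h (\<Sum>j\<in>S. 2 ^ j)) = (\<Sum>i<2 ^ \<nu>. h i)"
proof (induction \<nu> arbitrary: h)
  case 0
  show ?case by simp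
next
  case (Suc \<nu>)
  have "(\<Sum>S\<in>Pow {..<Suc \<nu>}. h (\<Sum>j\<in>S. 2 ^ j)) =
      (\<Sum>S\<in>Pow {..<\<nu>}. h (\<Sum>j\<in>S. 2 ^ j)) + (\<Sum>S\<in>insert \<nu> ` Pow {..<\<nu>}. h (\<Sum>j\<in>S. 2 ^ j))"
    unfolding lessThan_Suc Pow_insert by (rule sum.union_disjoint) auto
  also have "(\<Sum>S\<in>insert \<nu> ` Pow {..<\<nu>}. h (\<Sum>j\<in>S. 2 ^ j)) = (\<Sum>S\<in>Pow {..<\<nu>}. h (\<Sum>j\<in>insert \<nu> S. 2 ^ j))"
  proof (subst sum.reindex)
    show "inj_on (insert \<nu>) (Pow {..<\<nu>})" by (auto simp: inj_on_def)
  qed simp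
  also have "\<dots> = (\<Sum>S\<in>Pow {..<\<nu>}. h ((\<Sum>j\<in>S. 2 ^ j) + 2 ^ \<nu>))"
  proof (intro sum.cong refl arg_cong[of _ _ h])
    fix S assume "S \<in> Pow {..<\<nu>}"
    then have "finite S" "\<nu> \<notin> S" using finite_subset[of S "{..<\<nu>}"] by auto
    then show "(\<Sum>j\<in>insert \<nu> S. 2 ^ j) = (\<Sum>j\<in>S. 2 ^ j) + (2::nat) ^ \<nu>" by simp
  qed
  also have "\<dots> = (\<Sum>i<2 ^ \<nu>. h (i + 2 ^ \<nu>))" by (rule Suc.IH)
  also have "\<dots> = (\<Sum>i\<in>{2 ^ \<nu>..<2 ^ \<nu> + 2 ^ \<nu>}. h i)"
    using sum.shift_bounds_nat_ivl[of h 0 "2 ^ \<nu>" "2 ^ \<nu>"] by (simp add: lessThan_atLeast0)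
  also have "(\<Sum>S\<in>Pow {..<\<nu>}. h (\<Sum>j\<in>S. 2 ^ j)) = (\<Sum>i\<in>{0..<2 ^ \<nu>}. h i)"
    by (simp only: Suc.IH atLeast0LessThan)
  finally show ?case
    using sum.atLeastLessThan_concat[of 0 "2 ^ \<nu>" "2 ^ \<nu> + 2 ^ \<nu>" h] by (simp add: lessThan_atLeast0 mult_2)
qed

lemma square_of_binary:
  assumes "S \<subseteq> {..<\<nu>}"
  shows "(\<Sum>j\<in>S. 2 ^ j) ^ 2 = (\<Sum>j<\<nu>. if j \<in> S then 4 ^ j else 0) +
    (\<Sum>e\<in>pairs \<nu>. if fst e \<in> S \<and> snd e \<in> S then 2 * 2 ^ (fst e + snd e) else (0::nat))"
proof -
  define g where "g j = (if j \<in> S then 2 ^ j else 0 :: nat)" for j :: nat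
  have "(\<Sum>j\<in>S. 2 ^ j) = (\<Sum>j<\<nu>. g j)"
    unfolding g_def using assms by (simp add: sum.If_cases inf.absorb2)
  then have "(\<Sum>j\<in>S. 2 ^ j) ^ 2 = (\<Sum>y\<in>{..<\<nu>} \<times> {..<\<nu>}. g (fst y) * g (snd y))"
    by (simp only: power2_eq_square sum_product sum.cartesian_product case_prod_unfold)
  also have "\<dots> = (\<Sum>j<\<nu>. g j * g j) + (\<Sum>e\<in>pairs \<nu>. g (fst e) * g (snd e) + g (snd e) * g (fst e))"
    unfolding sum.square_split pairs_def[symmetric] by (simp add: add.commute)
  also have "(\<Sum>j<\<nu>. g j * g j) = (\<Sum>j<\<nu>. if j \<in> S then 4 ^ j else 0)"
    by (intro sum.cong) (auto simp: g_def power_mult_distrib[symmetric])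
  also have "(\<Sum>e\<in>pairs \<nu>. g (fst e) * g (snd e) + g (snd e) * g (fst e)) =
      (\<Sum>e\<in>pairs \<nu>. if fst e \<in> S \<and> snd e \<in> S then 2 * 2 ^ (fst e + snd e) else 0)"
    by (intro sum.cong) (auto simp: g_def power_add)
  finally show ?thesis .
qed

lemma prod_monom:
  "(\<Prod>j\<in>A. monom (c ^ a j) (b j)) = monom (c ^ (\<Sum>j\<in>A. a j)) (\<Sum>j\<in>A. b j)" for c :: "'a::comm_semiring_1"
  by (induction A rule: infinite_finite_induct) (simp_all add: mult_monom power_add one_pCons monom_0)

context
  fixes c :: "'a::field_char_0"
  assumes c: "c \<in> \<rat>"
begin

interpretation subset_permanent \<nu> "\<lambda>j. monom (c ^ 4 ^ j) (2 ^ j)" "\<lambda>e. [: (1 - c ^ (2 * 2 ^ (fst e + snd e))) / 2 :]"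
  for \<nu> .

text \<open>
  The weights are made for \<open>square_of_binary\<close>: the factor of a pair is \<open>1 - 2 * u = c ^ (2 * 2 ^ (j + k))\<close>.
\<close>

lemma per_quadratic: "per (indices \<nu>) (matrix \<nu>) = (\<Sum>i<2 ^ \<nu>. monom (c ^ i\<^sup>2) i)"
proof -
  have "(\<Prod>j<\<nu>. if j \<in> S then monom (c ^ 4 ^ j) (2 ^ j) else 1) *
      (\<Prod>e\<in>pairs \<nu>. if fst e \<in> S \<and> snd e \<in> S then 1 - 2 * [: (1 - c ^ (2 * 2 ^ (fst e + snd e))) / 2 :] else 1) =
      monom (c ^ (\<Sum>j\<in>S. 2 ^ j)\<^sup>2) (\<Sum>j\<in>S. 2 ^ j)" if S: "S \<in> Pow {..<\<nu>}" for S
  proof -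
    have half: "1 - 2 * [: (1 - q) / 2 :] = [:q:]" for q :: 'a
      by (simp add: numeral_poly one_pCons diff_divide_distrib)
    have "(\<Prod>j<\<nu>. if j \<in> S then monom (c ^ 4 ^ j) (2 ^ j) else 1) =
        (\<Prod>j<\<nu>. monom (c ^ (if j \<in> S then 4 ^ j else 0)) (if j \<in> S then 2 ^ j else 0))"
      by (intro prod.cong) (auto simp: one_pCons monom_0)
    moreover have "(\<Prod>e\<in>pairs \<nu>. if fst e \<in> S \<and> snd e \<in> S then 1 - 2 * [: (1 - c ^ (2 * 2 ^ (fst e + snd e))) / 2 :] else 1) =
        (\<Prod>e\<in>pairs \<nu>. monom (c ^ (if fst e \<in> S \<and> snd e \<in> S then 2 * 2 ^ (fst e + snd e) else 0)) 0)"
      by (intro prod.cong refl) (simp only: half monom_0 power_0 pCons_one if_True if_False simp_thms split: if_split, blast)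
    moreover have "(\<Sum>j<\<nu>. if j \<in> S then 2 ^ j else 0) = (\<Sum>j\<in>S. (2::nat) ^ j)"
      using S by (simp add: sum.If_cases inf.absorb2)
    ultimately show ?thesis
      using S by (simp add: prod_monom mult_monom square_of_binary[of S \<nu>] power_add)
  qed
  then have "per (indices \<nu>) (matrix \<nu>) = (\<Sum>S\<in>Pow {..<\<nu>}. monom (c ^ (\<Sum>j\<in>S. 2 ^ j)\<^sup>2) (\<Sum>j\<in>S. 2 ^ j))"
    unfolding per_subsets by (intro sum.cong) (simp_all only:)
  then show ?thesis using sum_binary[of "\<lambda>i. monom (c ^ i\<^sup>2) i" \<nu>] by simp
qed

lemma matrix_formulas: "matrix \<nu> r r' \<in> formulas 1"
proof -
  have [simp]: "mon d (Suc 0) = mon d' (Suc 0) \<longleftrightarrow> d = d'" for d d' :: "bool \<times> nat \<times> nat"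
    by (metis lookup_single_eq lookup_single_not_eq nat.distinct(1))
  have X: "look (X d) (mon r' 1) = (if d = r' then 1 else 0)" for d :: "bool \<times> nat \<times> nat"
    by (auto simp: X_def lookup_single when_def)
  have cX: "look (mon 0 a * X d) (mon r' 1) = (if d = r' then a else 0)" for d :: "bool \<times> nat \<times> nat" and a :: "'a poly"
    by (auto simp: X_def mult_single lookup_single when_def)
  define C where "C = {[:q:] | q :: 'a. q \<in> \<rat>}"
  have add: "a + b \<in> C" "a - b \<in> C" if "a \<in> C" "b \<in> C" for a b
    using that by (auto simp: C_def intro: Rats_add Rats_diff)
  have const: "a \<in> C \<Longrightarrow> a \<in> formulas 1" for a by (auto simp: C_def intro: formulas_const)
  have X': "look (X d) (mon r' 1) \<in> C" for d :: "bool \<times> nat \<times> nat"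
    unfolding X C_def by (auto simp: one_pCons intro: exI[of _ 0])
  have cX': "look (mon 0 a * X d) (mon r' 1) \<in> C" if "a \<in> C" for d :: "bool \<times> nat \<times> nat" and a :: "'a poly"
    unfolding cX using that by (auto simp: C_def intro: exI[of _ 0])
  have u: "[: (1 - c ^ n) / 2 :] \<in> C" for n
    unfolding C_def using c by (intro CollectI exI[of _ "(1 - c ^ n) / 2"]) auto
  have one: "(1 - mon 0 a) * P = P - mon 0 a * P" for a :: "'a poly" and P :: "((bool \<times> nat \<times> nat) \<Rightarrow>\<^sub>0 nat) \<Rightarrow>\<^sub>0 'a poly"
    by (simp add: left_diff_distrib)
  obtain b j k where r: "r = (b, j, k)" by (cases r)
  show ?thesis
  proof (cases "\<not> b \<and> j = k")
    case True
    have "monom (c ^ 4 ^ j) (2 ^ j) * [:s:] + [:t:] \<in> formulas 1" if "s \<in> \<rat>" "t \<in> \<rat>" for s t :: 'a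
      unfolding One_nat_def
      by (rule formulasI[of t "s * c ^ 4 ^ j" 0 0 "monom 1 (2 ^ j)" _ "monom 1 (2 ^ j)"])
         (use that c in \<open>auto simp: smult_monom mult.commute\<close>)
    from this[of 1 1] this[of 1 0] this[of 0 1] this[of 0 0] show ?thesis
      using True by (simp add: r matrix_def lookup_add X[unfolded One_nat_def] cX[unfolded One_nat_def] one_pCons)
  next
    case False
    then show ?thesis
      unfolding r matrix_def
      by (cases b) (auto simp: lookup_add lookup_minus one intro!: const[unfolded One_nat_def] add X'[unfolded One_nat_def] cX'[unfolded One_nat_def] u)
  qed
qed

theorem quadratic_formula:
  assumes circ: "computes t (permanent_poly (card (indices \<nu>)))" "circuit_size t \<le> 2 ^ S" "card (indices \<nu>) < 2 ^ R"
  shows "(\<Sum>i<2 ^ \<nu>. monom (c ^ i\<^sup>2) i) \<in> formulas (1 + R * ((R + S + 2) * (R + S + 1)))"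
proof -
  obtain b where b: "bij_betw b {1..card (indices \<nu>)} (indices \<nu>)"
    using ex_bij_betw_nat_finite_1[OF finite_indices] by blast
  have "permanent (card (indices \<nu>)) (\<lambda>(i, j). matrix \<nu> (b i) (b j)) \<in> formulas (1 + R * ((R + S + 2) * (R + S + 1)))"
    by (rule permanent_formula[OF circ]) (auto intro: matrix_formulas[unfolded One_nat_def])
  then show ?thesis using permanent_reindex[OF b, of "matrix \<nu>"] per_quadratic by simp
qed

end

section \<open>The roots of the polynomial with quadratic exponents\<close>

context padic
begin

lemma Qp_conv: "x \<in> (Qp :: 'k set) \<longleftrightarrow> (\<exists>q. conv (\<lambda>n. of_rat (q n)) x)"
proof -
  have tend: "s \<longlonglongrightarrow> x \<longleftrightarrow> conv s x" for s
    unfolding conv_def by (subst tendsto_dist_iff) (simp add: dist_N)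
  have "x \<in> (Qp :: 'k set) \<longleftrightarrow> (\<exists>s. (\<forall>n. s n \<in> range of_rat) \<and> conv s x)"
    unfolding Qp_def closure_sequential tend ..
  also have "\<dots> \<longleftrightarrow> (\<exists>q. conv (\<lambda>n. of_rat (q n)) x)"
  proof
    assume "\<exists>s. (\<forall>n. s n \<in> range of_rat) \<and> conv s x"
    then obtain s where s: "\<forall>n. \<exists>q. s n = of_rat q" "conv s x" by blast
    then obtain q where "\<forall>n. s n = of_rat (q n)" by metis
    then have "s = (\<lambda>n. of_rat (q n))" by auto
    then show "\<exists>q. conv (\<lambda>n. of_rat (q n)) x" using s(2) by blast
  next
    assume "\<exists>q. conv (\<lambda>n. of_rat (q n)) x"
    then obtain q where "conv (\<lambda>n. of_rat (q n)) x" by blast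
    then show "\<exists>s. (\<forall>n. s n \<in> range of_rat) \<and> conv s x"
      by (intro exI[of _ "\<lambda>n. of_rat (q n)"]) simp
  qed
  finally show ?thesis .
qed

lemma Qp_of_rat [simp]: "of_rat q \<in> (Qp :: 'k set)"
  unfolding Qp_conv by (rule exI[of _ "\<lambda>_. q"]) simp

lemma Qp_of_nat [simp]: "of_nat n \<in> (Qp :: 'k set)"
  using Qp_of_rat[of "of_nat n"] by simp

lemma Qp_1 [simp]: "1 \<in> (Qp :: 'k set)" and Qp_0 [simp]: "0 \<in> (Qp :: 'k set)"
  using Qp_of_nat[of 1] Qp_of_nat[of 0] by simp_all

lemma Qp_add: assumes "x \<in> (Qp :: 'k set)" "y \<in> Qp" shows "x + y \<in> Qp"
proof -
  obtain q r where "conv (\<lambda>n. of_rat (q n)) x" "conv (\<lambda>n. of_rat (r n)) y"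
    using assms unfolding Qp_conv by blast
  from conv_add[OF this] show ?thesis
    unfolding Qp_conv by (intro exI[of _ "\<lambda>n. q n + r n"]) (simp add: of_rat_add)
qed

lemma Qp_mult: assumes "x \<in> (Qp :: 'k set)" "y \<in> Qp" shows "x * y \<in> Qp"
proof -
  obtain q r where "conv (\<lambda>n. of_rat (q n)) x" "conv (\<lambda>n. of_rat (r n)) y"
    using assms unfolding Qp_conv by blast
  from conv_mult[OF this] show ?thesis
    unfolding Qp_conv by (intro exI[of _ "\<lambda>n. q n * r n"]) (simp add: of_rat_mult)
qed

lemma Qp_inverse: assumes "x \<in> (Qp :: 'k set)" shows "inverse x \<in> Qp"
proof (cases "x = 0")
  case False
  obtain q where "conv (\<lambda>n. of_rat (q n)) x" using assms unfolding Qp_conv by blast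
  from conv_inverse[OF this False] show ?thesis
    unfolding Qp_conv by (intro exI[of _ "\<lambda>n. inverse (q n)"]) (simp add: of_rat_inverse)
qed simp

lemma Qp_uminus: "x \<in> (Qp :: 'k set) \<Longrightarrow> - x \<in> Qp"
  using Qp_mult[OF Qp_of_rat[of "- 1"], of x] by simp

lemma Qp_diff: "x \<in> (Qp :: 'k set) \<Longrightarrow> y \<in> Qp \<Longrightarrow> x - y \<in> Qp"
  using Qp_add[of x "- y"] Qp_uminus[of y] by simp

lemma Qp_power: "x \<in> (Qp :: 'k set) \<Longrightarrow> x ^ n \<in> Qp"
  by (induction n) (auto intro: Qp_mult)

lemma Qp_sum: "(\<And>i. i \<in> A \<Longrightarrow> f i \<in> (Qp :: 'k set)) \<Longrightarrow> (\<Sum>i\<in>A. f i) \<in> Qp"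
  by (induction A rule: infinite_finite_induct) (auto intro: Qp_add)

lemma N_sum_le: "(\<And>i. i \<in> A \<Longrightarrow> N (f i) \<le> B) \<Longrightarrow> 0 \<le> B \<Longrightarrow> N (\<Sum>i\<in>A. f i) \<le> B"
proof (induction A rule: infinite_finite_induct)
  case (insert i A)
  then have "max (N (f i)) (N (\<Sum>i\<in>A. f i)) \<le> B" by simp
  then show ?case using order.trans[OF N_ultra[of "f i" "\<Sum>i\<in>A. f i"]] insert.hyps by simp
qed auto

lemma N_diff_max: "N (x - y) \<le> max (N x) (N y)"
  using N_ultra[of x "- y"] by simp

lemma N_power_diff:
  assumes "N u = 1" "N w = 1" shows "N (u ^ i - w ^ i) \<le> N (u - w)"
proof (induction i)
  case (Suc i)
  have "N ((u ^ i - w ^ i) * u) \<le> N (u - w)" "N (w ^ i * (u - w)) \<le> N (u - w)"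
    using Suc assms by (simp_all add: N_mult N_power)
  moreover have "u ^ Suc i - w ^ Suc i = (u ^ i - w ^ i) * u + w ^ i * (u - w)" by (simp add: algebra_simps)
  ultimately show ?case using N_ultra[of "(u ^ i - w ^ i) * u" "w ^ i * (u - w)"] by simp
qed simp

text \<open>
  Substituting \<open>x = u / p ^ (2 * m + 1)\<close> and multiplying by \<open>p ^ (m * (m + 1))\<close> turns the terms into
  \<open>p ^ e i * u ^ i\<close> with \<open>e i = (i - m) * (i - m - 1)\<close>, which is positive except for \<open>i = m\<close> and \<open>i = m + 1\<close>.
  Modulo \<open>p\<close> there remains \<open>u ^ m * (1 + u)\<close>, so a root is sought near \<open>- 1\<close>.  It is the fixed point of
  \<open>u \<mapsto> - 1 - G u / u ^ m\<close>, where \<open>G\<close> collects the other terms; this map contracts distances by the factor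
  \<open>1 / p\<close> on the ball of radius \<open>1 / p\<close> around \<open>- 1\<close>.
\<close>

theorem quadratic_root:
  assumes m: "m + 1 < n"
  shows "\<exists>x\<in>Qp. x \<noteq> 0 \<and> ord x = - (2 * real m + 1) \<and> poly (\<Sum>i<n. monom (of_nat p ^ i\<^sup>2) i) x = 0"
proof -
  define P :: 'k where "P = of_nat p"
  have P0: "P \<noteq> 0" and NP: "N P = 1 / p" using prime_p prime_gt_0_nat N_p by (auto simp: P_def)
  define e where "e i = nat ((int i - int m) * (int i - int m - 1))" for i
  have e: "m * (m + 1) + i\<^sup>2 = e i + (2 * m + 1) * i" for i
  proof -
    have "(int i - int m) * (int i - int m - 1) \<ge> 0"
      by (cases "i \<le> m") (auto intro: mult_nonneg_nonneg mult_nonpos_nonpos)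
    then have "int (m * (m + 1) + i\<^sup>2) = int (e i + (2 * m + 1) * i)"
      by (simp add: e_def algebra_simps power2_eq_square)
    then show ?thesis by (simp only: of_nat_eq_iff)
  qed
  have e_pos: "1 \<le> e i" if "i \<noteq> m" "i \<noteq> m + 1" for i
  proof -
    have "0 < (int i - int m) * (int i - int m - 1)"
    proof (cases "i < m")
      case True
      then show ?thesis by (intro mult_neg_neg) auto
    next
      case False
      then show ?thesis using that by (intro mult_pos_pos) auto
    qed
    then show ?thesis by (simp add: e_def)
  qed
  have Pe: "N (P ^ e i) \<le> 1 / p" if "i \<noteq> m" "i \<noteq> m + 1" for i
    using power_decreasing[OF e_pos[OF that], of "1 / real p"] p_gt_1 by (simp add: N_power NP)
  define G where "G u = (\<Sum>i\<in>{..<n} - {m, m + 1}. P ^ e i * u ^ i)" for u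
  define T where "T u = - 1 - G u * inverse u ^ m" for u
  define D where "D = Qp \<inter> cball (- 1 :: 'k) (1 / p)"
  have unit: "N u = 1" if "u \<in> D" for u
  proof -
    have d: "N (- 1 - u) < 1"
      using that p_gt_1 by (simp add: D_def dist_N order.strict_trans1[of _ "1 / real p"])
    have "N u \<le> 1" using N_diff_max[of "- 1" "- 1 - u"] d by simp
    moreover have "1 \<le> max (N u) (N (- 1 - u))" using N_ultra[of u "- 1 - u"] by simp
    ultimately show ?thesis using d by simp
  qed
  have G_small: "N (G u) \<le> 1 / p" if "N u = 1" for u
    unfolding G_def using Pe that by (intro N_sum_le) (auto simp: N_mult N_power)
  have G_lip: "N (G u - G w) \<le> 1 / p * N (u - w)" if "N u = 1" "N w = 1" for u w
  proof -
    have "N (P ^ e i * (u ^ i - w ^ i)) \<le> 1 / p * N (u - w)" if "i \<noteq> m" "i \<noteq> m + 1" for i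
      unfolding N_mult using Pe[OF that] N_power_diff \<open>N u = 1\<close> \<open>N w = 1\<close> by (intro mult_mono) auto
    then show ?thesis
      unfolding G_def sum_subtractf[symmetric] right_diff_distrib[symmetric] by (intro N_sum_le) auto
  qed
  have inv_lip: "N (inverse u ^ m - inverse w ^ m) \<le> N (u - w)" if "N u = 1" "N w = 1" for u w
  proof -
    have nz: "u \<noteq> 0" "w \<noteq> 0" using that by auto
    have iu: "N (inverse u) = 1" "N (inverse w) = 1" using that nz N_divide[of u 1] N_divide[of w 1] by (auto simp: inverse_eq_divide)
    have "inverse u - inverse w = (w - u) * (inverse u * inverse w)" using nz by (simp add: field_simps)
    then have "N (inverse u - inverse w) = N (u - w)" using iu by (simp add: N_mult N_minus_commute)
    then show ?thesis using N_power_diff[OF iu, of m] by simp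
  qed
  have inv_unit: "N (inverse u ^ m) = 1" if "N u = 1" for u
    using that N_divide[of u 1] by (cases "u = 0") (auto simp: N_power inverse_eq_divide)
  have "\<exists>!u\<in>D. T u = u"
  proof (rule Banach_fix[where c = "1 / p"])
    show "complete D"
      unfolding complete_eq_closed D_def Qp_def by (intro closed_Int closed_closure closed_cball)
    have "- 1 \<in> D" using Qp_uminus[of 1] by (simp add: D_def)
    then show "D \<noteq> {}" by blast
    show "T ` D \<subseteq> D"
    proof (intro image_subsetI)
      fix u assume u: "u \<in> D"
      have "T u \<in> Qp"
        using u unfolding T_def G_def P_def D_def
        by (intro Qp_diff Qp_uminus Qp_1 Qp_mult Qp_sum Qp_power Qp_inverse Qp_of_nat) auto
      moreover have "N (- 1 - T u) \<le> 1 / p"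
        using G_small[OF unit[OF u]] inv_unit[OF unit[OF u]] by (simp add: T_def N_mult)
      ultimately show "T u \<in> D" by (simp add: D_def dist_N)
    qed
    show "dist (T u) (T w) \<le> 1 / p * dist u w" if "u \<in> D" "w \<in> D" for u w
    proof -
      have n: "N u = 1" "N w = 1" using that unit by auto
      have "T w - T u = (G u - G w) * inverse u ^ m + G w * (inverse u ^ m - inverse w ^ m)"
        by (simp add: T_def algebra_simps)
      moreover have "N ((G u - G w) * inverse u ^ m) \<le> 1 / p * N (u - w)"
        using G_lip[OF n] inv_unit[OF n(1)] by (simp add: N_mult)
      moreover have "N (G w * (inverse u ^ m - inverse w ^ m)) \<le> 1 / p * N (u - w)"
        unfolding N_mult using G_small[OF n(2)] inv_lip[OF n] by (intro mult_mono) auto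
      ultimately have "N (T w - T u) \<le> 1 / p * N (u - w)"
        using N_ultra[of "(G u - G w) * inverse u ^ m" "G w * (inverse u ^ m - inverse w ^ m)"] by simp
      then show ?thesis by (simp add: dist_N N_minus_commute[of "T w"])
    qed
  qed (use p_gt_1 in auto)
  then obtain u where u: "u \<in> D" "T u = u" by blast
  have Nu: "N u = 1" and u0: "u \<noteq> 0" using unit[OF u(1)] by auto
  have "(1 + u) * u ^ m + G u = 0"
  proof -
    have "1 + u = 1 + T u" using u(2) by simp
    then have "1 + u = - G u * inverse u ^ m" by (simp add: T_def)
    then show ?thesis using u0 by (simp add: field_simps)
  qed
  moreover have "(\<Sum>i<n. P ^ e i * u ^ i) = (1 + u) * u ^ m + G u"
  proof -
    have "(\<Sum>i<n. P ^ e i * u ^ i) = G u + (\<Sum>i\<in>{m, m + 1}. P ^ e i * u ^ i)"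
      unfolding G_def using m by (intro sum.subset_diff) auto
    moreover have "e m = 0" "e (Suc m) = 0" by (simp_all add: e_def)
    ultimately show ?thesis by (simp add: algebra_simps)
  qed
  ultimately have F: "(\<Sum>i<n. P ^ e i * u ^ i) = 0" by simp
  define x where "x = u * inverse (P ^ (2 * m + 1))"
  have "P ^ (m * (m + 1)) * (P ^ i\<^sup>2 * x ^ i) = P ^ e i * u ^ i" for i
  proof -
    have "P ^ (m * (m + 1)) * (P ^ i\<^sup>2 * x ^ i) = P ^ (m * (m + 1) + i\<^sup>2) * x ^ i" by (simp add: power_add)
    also have "\<dots> = P ^ e i * (P ^ (2 * m + 1) * x) ^ i"
      unfolding e power_add power_mult by (simp add: power_mult_distrib)
    moreover have "P ^ (2 * m + 1) * x = u"
    proof -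
      have cancel: "K * (u * inverse K) = u" if "K \<noteq> 0" for K using that by simp
      show ?thesis unfolding x_def by (rule cancel) (use P0 in simp)
    qed
    ultimately show ?thesis by (simp only:)
  qed
  then have "P ^ (m * (m + 1)) * (\<Sum>i<n. P ^ i\<^sup>2 * x ^ i) = 0" using F by (simp add: sum_distrib_left)
  then have "poly (\<Sum>i<n. monom (of_nat p ^ i\<^sup>2) i) x = 0" using P0 by (simp add: poly_sum poly_monom P_def)
  moreover have "x \<noteq> 0" using u0 P0 by (simp add: x_def)
  moreover have "x \<in> Qp"
    unfolding x_def P_def using u(1) by (intro Qp_mult Qp_inverse Qp_power Qp_of_nat) (simp add: D_def)
  moreover have "ord x = - (2 * real m + 1)"
  proof -
    have "ord u = 0" using N_ord[OF u0] Nu p_gt_1 by simp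
    then show ?thesis
      using u0 P0 by (simp add: x_def ord_mult ord_inverse ord_power ord_p P_def del: power_Suc)
  qed
  ultimately show ?thesis by blast
qed

end

section \<open>Formulas as systems on a tree\<close>

text \<open>
  The nodes \<open>1, \<dots>, M - 1\<close> are inner nodes, and those from \<open>M\<close> on are leaves.  The index 0, which is not a node, is
  treated like a leaf for the sake of termination.
\<close>

function heap_value :: "nat \<Rightarrow> (nat \<Rightarrow> nat) \<Rightarrow> (nat \<Rightarrow> nat \<Rightarrow> 'a) \<Rightarrow> 'a \<Rightarrow> nat \<Rightarrow> 'a::comm_ring_1" where
  "heap_value M a c x i = (if i = 0 \<or> M \<le> i then x ^ a i else
     c i 1 + c i 2 * heap_value M a c x (2 * i) + c i 3 * heap_value M a c x (2 * i + 1) +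
     c i 4 * heap_value M a c x (2 * i) * heap_value M a c x (2 * i + 1))"
  by auto
termination by (relation "Wellfounded.measure (\<lambda>(M, a, c, x, i). M - i)") auto

declare heap_value.simps [simp del]

lemma heap_value_leaf: "M \<le> i \<Longrightarrow> heap_value M a c x i = x ^ a i"
  by (subst heap_value.simps) simp

lemma heap_value_node:
  "0 < i \<Longrightarrow> i < M \<Longrightarrow> heap_value M a c x i =
     c i 1 + c i 2 * heap_value M a c x (2 * i) + c i 3 * heap_value M a c x (2 * i + 1) +
     c i 4 * heap_value M a c x (2 * i) * heap_value M a c x (2 * i + 1)"
  by (subst heap_value.simps) simp

lemma heap_inner:
  fixes h k M :: nat
  assumes "M \<le> 2 ^ Suc h * k" "2 ^ Suc h * (k + 1) \<le> 2 * M" "0 < M"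
  shows "k < M" "0 < k"
proof -
  have "2 ^ h * (k + 1) \<le> M" using assms(2) by simp
  moreover have "k + 1 \<le> 2 ^ h * (k + 1)" using mult_le_mono1[of 1 "2 ^ h" "k + 1"] by simp
  ultimately show "k < M" by linarith
  show "0 < k" using assms(1,3) by (cases k) auto
qed

lemma heap_value_cong:
  assumes "M \<le> 2 ^ h * k" "2 ^ h * (k + 1) \<le> 2 * M" "0 < M"
    and "\<And>j. j \<in> desc h k \<Longrightarrow> a j = a' j \<and> c j = c' j"
  shows "heap_value M a c x k = heap_value M a' c' x k"
  using assms
proof (induction h arbitrary: k)
  case 0
  then show ?case by (simp add: heap_value_leaf)
next
  case (Suc h)
  have k: "k < M" "0 < k" using heap_inner[OF Suc.prems(1-3)] .
  have "heap_value M a c x (2 * k) = heap_value M a' c' x (2 * k)"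
    by (rule Suc.IH) (use Suc.prems in \<open>auto simp: algebra_simps\<close>)
  moreover have "heap_value M a c x (2 * k + 1) = heap_value M a' c' x (2 * k + 1)"
    by (rule Suc.IH) (use Suc.prems in \<open>auto simp: algebra_simps\<close>)
  moreover have "c k = c' k" using Suc.prems(4) by simp
  ultimately show ?case using k by (simp add: heap_value_node)
qed

text \<open>
  The subformulas occupy disjoint sets of nodes, so their coefficients and exponents can be put together.  The two
  inequalities say that the nodes at distance \<open>h\<close> below \<open>k\<close> have numbers in \<open>{M..<2 * M}\<close>.
\<close>

lemma formula_on_heap:
  assumes "f \<in> formulas h" "M \<le> 2 ^ h * k" "2 ^ h * (k + 1) \<le> 2 * M" "0 < M"
  shows "\<exists>a c. (\<forall>x. poly f x = heap_value M a c x k) \<and> (\<exists>b. \<forall>j. a j \<le> b) \<and> (\<forall>j i. c j i \<in> \<rat>)"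
  using assms
proof (induction h arbitrary: f k)
  case 0
  then obtain m where "f = monom 1 m" by auto
  then show ?case
    using 0 by (intro exI[of _ "\<lambda>_. m"] exI[of _ "\<lambda>_ _. 0"]) (auto simp: heap_value_leaf poly_monom)
next
  case (Suc h)
  have k: "k < M" "0 < k" using heap_inner[OF Suc.prems(2-4)] .
  obtain c1 c2 c3 c4 f1 f2 where cs: "c1 \<in> \<rat>" "c2 \<in> \<rat>" "c3 \<in> \<rat>" "c4 \<in> \<rat>" and fs: "f1 \<in> formulas h" "f2 \<in> formulas h"
    and f: "f = [:c1:] + smult c2 f1 + smult c3 f2 + smult c4 (f1 * f2)"
    using Suc.prems(1) unfolding formulas.simps by blast
  have left: "M \<le> 2 ^ h * (2 * k)" "2 ^ h * (2 * k + 1) \<le> 2 * M"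
    and right: "M \<le> 2 ^ h * (2 * k + 1)" "2 ^ h * (2 * k + 1 + 1) \<le> 2 * M"
    using Suc.prems(2,3) by (auto simp: algebra_simps)
  obtain a1 c1' b1 where 1: "\<forall>x. poly f1 x = heap_value M a1 c1' x (2 * k)" "\<forall>j. a1 j \<le> b1" "\<forall>j i. c1' j i \<in> \<rat>"
    using Suc.IH[OF fs(1) left Suc.prems(4)] by blast
  obtain a2 c2' b2 where 2: "\<forall>x. poly f2 x = heap_value M a2 c2' x (2 * k + 1)" "\<forall>j. a2 j \<le> b2" "\<forall>j i. c2' j i \<in> \<rat>"
    using Suc.IH[OF fs(2) right Suc.prems(4)] by blast
  define a where "a j = (if j \<in> desc h (2 * k) then a1 j else a2 j)" for j
  define c where "c j = (if j = k then (\<lambda>_. 0)(1 := c1, 2 := c2, 3 := c3, 4 := c4)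
    else if j \<in> desc h (2 * k) then c1' j else c2' j)" for j
  have "heap_value M a c x (2 * k) = heap_value M a1 c1' x (2 * k)" for x
    by (rule heap_value_cong[OF left Suc.prems(4)]) (use root_notin_desc[OF k(2)] in \<open>auto simp: a_def c_def\<close>)
  moreover have "heap_value M a c x (2 * k + 1) = heap_value M a2 c2' x (2 * k + 1)" for x
    by (rule heap_value_cong[OF right Suc.prems(4)])
       (use root_notin_desc[OF k(2)] desc_disjoint[OF k(2), of h] in \<open>auto simp: a_def c_def\<close>)
  ultimately have "poly f x = heap_value M a c x k" for x
    using 1(1) 2(1) k by (simp add: heap_value_node f c_def algebra_simps)
  moreover have "a j \<le> max b1 b2" for j using 1(2) 2(2) by (auto simp: a_def le_max_iff_disj)
  moreover have "c j i \<in> \<rat>" for j i using 1(3) 2(3) cs by (auto simp: c_def)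
  ultimately show ?case by blast
qed

lemma laurent_eval_single: "laurent_eval n (mon e q) x = q * mval n x e"
  using laurent_eval_superset[of "{e}" "mon e q" n x] by simp

lemma laurent_eval_add: "laurent_eval n (f + g) x = laurent_eval n f x + laurent_eval n g x"
proof -
  let ?S = "Poly_Mapping.keys f \<union> Poly_Mapping.keys g"
  have "laurent_eval n h x = (\<Sum>e\<in>?S. look h e * mval n x e)" if "Poly_Mapping.keys h \<subseteq> ?S" for h
    using that by (intro laurent_eval_superset) auto
  from this[of f] this[of g] this[OF keys_add] show ?thesis
    by (simp add: lookup_add distrib_right sum.distrib)
qed

text \<open>
  The variable of an inner node is its value plus a shift \<open>t\<close>, since zeros in the torus must have nonzero
  coordinates while a value may vanish; the value of the root even has to.  Leaves are not shifted.
\<close>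

definition heap_laurent :: "nat \<Rightarrow> (nat \<Rightarrow> nat) \<Rightarrow> (nat \<Rightarrow> nat \<Rightarrow> 'k) \<Rightarrow> 'k \<Rightarrow> nat \<Rightarrow> 'k::field laurent" where
  "heap_laurent M a c t i = (if i = 0 then mon (mon 1 1) 1 + mon 0 (- t) else
    (let s = (\<lambda>j. if j < M then t else 0); l = 2 * i; r = 2 * i + 1 in
      mon (mon i 1) (- 1) + mon 0 (t + c i 1 - c i 2 * s l - c i 3 * s r + c i 4 * s l * s r) +
      mon (node M a l) (c i 2 - c i 4 * s r) + mon (node M a r) (c i 3 - c i 4 * s l) +
      mon (node M a l + node M a r) (c i 4)))"

lemma keys_add_subset:
  "Poly_Mapping.keys f \<subseteq> A \<Longrightarrow> Poly_Mapping.keys g \<subseteq> A \<Longrightarrow> Poly_Mapping.keys (f + g) \<subseteq> A"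
  using keys_add[of f g] by blast

lemma keys_single_subset: "e \<in> A \<Longrightarrow> Poly_Mapping.keys (mon e q) \<subseteq> A"
  by simp

lemma keys_heap_laurent: "Poly_Mapping.keys (heap_laurent M a c t i) \<subseteq> tree_support M a i"
proof (cases "i = 0")
  case True
  show ?thesis
    unfolding heap_laurent_def tree_support_def True
    by (simp only: if_True refl) (intro keys_add_subset keys_single_subset; simp)
next
  case False
  show ?thesis
    unfolding heap_laurent_def tree_support_def children_def Let_def
    by (simp only: False if_False) (intro keys_add_subset keys_single_subset; simp)
qed

lemma heap_laurent_0: "1 < M \<Longrightarrow> laurent_eval M (heap_laurent M a c t 0) z = z 1 - t"
  by (simp add: heap_laurent_def laurent_eval_add laurent_eval_single mval_single)

lemma heap_laurent_node:
  assumes "1 < M" "0 < i" "i < M" "\<And>j. j < M \<Longrightarrow> z j \<noteq> 0"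
    and w: "\<And>j. w j = (if j < M then z j - t else z 0 ^ a j)"
  shows "laurent_eval M (heap_laurent M a c t i) z =
    c i 1 + c i 2 * w (2 * i) + c i 3 * w (2 * i + 1) + c i 4 * w (2 * i) * w (2 * i + 1) - w i"
proof -
  define s where "s = (\<lambda>j. if j < M then t else 0)"
  have e: "extend M a z j = w j + s j" for j by (simp add: extend_def w s_def)
  have i: "z i = w i + t" using assms(3) by (simp add: w)
  show ?thesis
    unfolding heap_laurent_def Let_def s_def[symmetric]
    using assms(1-4)
    by (simp add: laurent_eval_add laurent_eval_single mval_single mval_add mval_node e i algebra_simps)
qed

lemma heap_solution_unique:
  assumes "\<And>j. M \<le> j \<Longrightarrow> w j = x ^ a j"
    and "\<And>i. 0 < i \<Longrightarrow> i < M \<Longrightarrow> w i =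
      c i 1 + c i 2 * w (2 * i) + c i 3 * w (2 * i + 1) + c i 4 * w (2 * i) * w (2 * i + 1)"
    and "0 < i"
  shows "w i = heap_value M a c x i"
  using assms(3)
proof (induction "M - i" arbitrary: i rule: less_induct)
  case less
  show ?case
  proof (cases "M \<le> i")
    case True
    then show ?thesis using assms(1) by (simp add: heap_value_leaf)
  next
    case False
    then have "w (2 * i) = heap_value M a c x (2 * i)" "w (2 * i + 1) = heap_value M a c x (2 * i + 1)"
      by (intro less.hyps; use less.prems in simp)+
    then show ?thesis using assms(2)[of i] False less.prems by (simp only: heap_value_node not_le)
  qed
qed

context padic
begin

lemma heap_value_Qp:
  assumes "x \<in> (Qp :: 'k set)" "\<And>j i. c j i \<in> Qp"
  shows "heap_value M a c x i \<in> Qp"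
proof (induction "M - i" arbitrary: i rule: less_induct)
  case less
  show ?case
  proof (cases "i = 0 \<or> M \<le> i")
    case True
    then show ?thesis using assms(1) by (subst heap_value.simps) (simp add: Qp_power)
  next
    case False
    then have "heap_value M a c x (2 * i) \<in> Qp" "heap_value M a c x (2 * i + 1) \<in> Qp"
      using less.hyps[of "2 * i"] less.hyps[of "2 * i + 1"] by (simp_all add: diff_less_mono2)
    then show ?thesis using False assms(2) by (subst heap_value.simps) (auto intro!: Qp_add Qp_mult)
  qed
qed

text \<open>
  For a shift that avoids finitely many numbers, every nonzero root of \<open>f\<close> extends to a zero of the system on
  the tree, and the extension is unique.  The coordinate 0 of the zero is the root itself.
\<close>

theorem many_valuations:
  fixes f :: "'k poly"
  assumes f: "f \<in> formulas \<Delta>" "f \<noteq> 0" and \<Delta>: "0 < \<Delta>"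
  shows "\<exists>a. card (ord ` {x \<in> Qp. x \<noteq> 0 \<and> poly f x = 0}) \<le> max_vals_Qp (2 ^ \<Delta>) ord (tree_support (2 ^ \<Delta>) a)"
proof -
  define M :: nat where "M = 2 ^ \<Delta>"
  have M1: "1 < M" using \<Delta> one_less_power[of "2::nat" \<Delta>] by (simp add: M_def)
  obtain a c b where fv: "\<forall>x. poly f x = heap_value M a c x 1" and b: "\<forall>j. a j \<le> b" and c: "\<forall>j i. c j i \<in> \<rat>"
    using formula_on_heap[OF f(1), of M 1] M1 by (auto simp: M_def)
  have cQ: "c j i \<in> Qp" for j i
    using c by (metis Qp_of_rat Rats_cases)
  define roots where "roots = {x. x \<noteq> 0 \<and> poly f x = 0}"
  have fin: "finite roots" unfolding roots_def using poly_roots_finite[OF f(2)] by (rule rev_finite_subset) auto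
  obtain t :: nat where "(of_nat t :: 'k) \<notin> (\<lambda>(x, i). - heap_value M a c x i) ` (roots \<times> {..<M})"
  proof -
    have "infinite (range (of_nat :: nat \<Rightarrow> 'k))" by (simp add: finite_image_iff inj_of_nat)
    then have "\<not> range (of_nat :: nat \<Rightarrow> 'k) \<subseteq> (\<lambda>(x, i). - heap_value M a c x i) ` (roots \<times> {..<M})"
      using fin finite_subset by blast
    then show ?thesis using that by blast
  qed
  then have t: "heap_value M a c x i + of_nat t \<noteq> 0" if "x \<in> roots" "i < M" for x i
    using that by (force simp: add_eq_0_iff)
  define F where "F = heap_laurent M a c (of_nat t)"
  define lift where "lift x = (\<lambda>i\<in>{..<M}. if i = 0 then x else heap_value M a c x i + of_nat t)" for x
  have zeros_lift: "z \<in> lift ` roots" if z: "z \<in> torus_zeros M UNIV (F ` {..<M})" for z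
  proof -
    have nz: "\<And>j. j < M \<Longrightarrow> z j \<noteq> 0" and ext: "z \<in> extensional {..<M}" and eq: "\<And>i. i < M \<Longrightarrow> laurent_eval M (F i) z = 0"
      using z by (auto simp: torus_zeros_def PiE_iff)
    define w where "w j = (if j < M then z j - of_nat t else z 0 ^ a j)" for j
    have w: "w i = heap_value M a c (z 0) i" if "0 < i" for i
    proof (rule heap_solution_unique[OF _ _ that])
      show "M \<le> j \<Longrightarrow> w j = z 0 ^ a j" for j by (simp add: w_def)
      show "w i = c i 1 + c i 2 * w (2 * i) + c i 3 * w (2 * i + 1) + c i 4 * w (2 * i) * w (2 * i + 1)"
        if "0 < i" "i < M" for i
        using heap_laurent_node[OF M1 that nz w_def, of c] eq[OF that(2)] by (simp add: F_def)
    qed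
    have "z 1 = of_nat t" using eq[of 0] M1 by (simp add: F_def heap_laurent_0)
    then have "z 0 \<in> roots" using w[of 1] nz[of 0] fv M1 by (simp add: w_def roots_def)
    moreover have "z = lift (z 0)"
    proof
      fix i show "z i = lift (z 0) i"
        using w[of i] ext by (auto simp: lift_def w_def extensional_def diff_eq_eq)
    qed
    ultimately show ?thesis by blast
  qed
  have "finite (torus_zeros M UNIV (F ` {..<M}))"
    using finite_subset[OF subsetI[OF zeros_lift]] fin by blast
  then have sys: "F \<in> finite_systems M (tree_support M a)"
    by (simp add: finite_systems_def F_def keys_heap_laurent)
  have lift_zero: "lift x \<in> torus_zeros M Qp (F ` {..<M})" if x: "x \<in> roots" "x \<in> Qp" for x
  proof -
    have nz: "lift x j \<noteq> 0" if "j < M" for j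
      using that t[OF x(1)] x(1) by (auto simp: lift_def roots_def)
    have "lift x \<in> {..<M} \<rightarrow>\<^sub>E (Qp - {0})"
    proof
      fix j assume "j \<in> {..<M}"
      then have "lift x j \<in> Qp" using x(2) cQ by (auto simp: lift_def intro!: Qp_add heap_value_Qp)
      then show "lift x j \<in> Qp - {0}" using nz \<open>j \<in> {..<M}\<close> by simp
    qed (simp add: lift_def)
    moreover have "laurent_eval M (F i) (lift x) = 0" if "i < M" for i
    proof (cases "i = 0")
      case True
      have "heap_value M a c x 1 = 0" using x(1) fv by (simp add: roots_def)
      then show ?thesis using True M1 by (simp add: F_def heap_laurent_0 lift_def)
    next
      case False
      define w where "w j = (if j < M then lift x j - of_nat t else lift x 0 ^ a j)" for j
      have w: "w j = heap_value M a c x j" if "0 < j" for j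
        using that M1 by (auto simp: w_def lift_def heap_value_leaf)
      show ?thesis
        using heap_laurent_node[OF M1 _ that nz w_def, of c] False that
        by (simp add: F_def w heap_value_node[of i M])
    qed
    ultimately show ?thesis by (simp add: torus_zeros_def)
  qed
  let ?V = "\<lambda>f. card (ord_vec M ord ` torus_zeros M (Qp :: 'k set) (f ` {..<M}))"
  have V: "finite (torus_zeros M (Qp :: 'k set) (f ` {..<M}))" "?V f \<le> (\<Delta> + 1) * 2 ^ \<Delta> * b"
    if "f \<in> finite_systems M (tree_support M a)" for f
  proof -
    have sub: "torus_zeros M (Qp :: 'k set) (f ` {..<M}) \<subseteq> torus_zeros M UNIV (f ` {..<M})"
      by (auto simp: torus_zeros_def PiE_iff)
    have fin': "finite (torus_zeros M (UNIV :: 'k set) (f ` {..<M}))" using that by (simp add: finite_systems_def)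
    show fin: "finite (torus_zeros M (Qp :: 'k set) (f ` {..<M}))" by (rule finite_subset[OF sub fin'])
    have "?V f \<le> card (torus_zeros M (Qp :: 'k set) (f ` {..<M}))" by (rule card_image_le[OF fin])
    also have "\<dots> \<le> card (torus_zeros M (UNIV :: 'k set) (f ` {..<M}))" by (rule card_mono[OF fin' sub])
    also have "\<dots> \<le> (\<Delta> + 1) * 2 ^ \<Delta> * b" using bounded_zeros[OF M_def \<Delta> _ that] b by blast
    finally show "?V f \<le> (\<Delta> + 1) * 2 ^ \<Delta> * b" .
  qed
  have "ord ` {x \<in> Qp. x \<noteq> 0 \<and> poly f x = 0} \<subseteq> (\<lambda>v. v 0) ` ord_vec M ord ` torus_zeros M Qp (F ` {..<M})"
  proof
    fix y assume "y \<in> ord ` {x \<in> Qp. x \<noteq> 0 \<and> poly f x = 0}"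
    then obtain x where x: "x \<in> Qp" "x \<in> roots" "y = ord x" by (auto simp: roots_def)
    then have "y = ord_vec M ord (lift x) 0" using M1 by (simp add: ord_vec_def lift_def)
    then show "y \<in> (\<lambda>v. v 0) ` ord_vec M ord ` torus_zeros M Qp (F ` {..<M})"
      using lift_zero[OF x(2,1)] by blast
  qed
  then have "card (ord ` {x \<in> Qp. x \<noteq> 0 \<and> poly f x = 0}) \<le>
      card ((\<lambda>v. v 0) ` ord_vec M ord ` torus_zeros M Qp (F ` {..<M}))"
    using V(1)[OF sys] by (intro card_mono) auto
  also have "\<dots> \<le> ?V F" using V(1)[OF sys] by (intro card_image_le) auto
  also have "\<dots> \<le> max_vals_Qp M ord (tree_support M a)"
    unfolding max_vals_Qp_def
    by (rule cSUP_upper[OF sys]) (use V(2) in \<open>auto intro!: bdd_aboveI[of _ "(\<Delta> + 1) * 2 ^ \<Delta> * b"]\<close>)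
  finally show ?thesis unfolding M_def by blast
qed

theorem few_generic_valuations:
  assumes \<Delta>: "0 < \<Delta>"
  shows "max_vals_generic (2 ^ \<Delta>) ord (tree_support (2 ^ \<Delta>) a) \<le> 2 * 2050 ^ \<Delta>"
proof (cases "{f \<in> finite_systems (2 ^ \<Delta>) (tree_support (2 ^ \<Delta>) a). tropically_generic (2 ^ \<Delta>) ord f} = {}")
  case True
  then show ?thesis unfolding max_vals_generic_def by (simp only: image_empty) simp
next
  case False
  show ?thesis
    unfolding max_vals_generic_def
    by (rule cSUP_least[OF False]) (use generic_bound[OF refl \<Delta>] in blast)
qed

end

section \<open>Comparison of the growth rates\<close>

lemma poly_le_power:
  fixes q :: "real poly"
  shows "\<exists>e. \<forall>x\<ge>1. poly q x \<le> 2 ^ e * x ^ degree q"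
proof -
  define C where "C = (\<Sum>i\<le>degree q. \<bar>coeff q i\<bar>)"
  obtain e :: nat where e: "C \<le> 2 ^ e"
    using real_arch_pow[of 2 C] by (auto intro: less_imp_le)
  have "poly q x \<le> 2 ^ e * x ^ degree q" if "1 \<le> x" for x
  proof -
    have "poly q x \<le> (\<Sum>i\<le>degree q. \<bar>coeff q i\<bar> * x ^ degree q)"
      unfolding poly_altdef using that by (intro sum_mono mult_mono power_increasing) auto
    also have "\<dots> = C * x ^ degree q" by (simp add: C_def sum_distrib_right)
    also have "\<dots> \<le> 2 ^ e * x ^ degree q" using e that by (intro mult_right_mono) auto
    finally show ?thesis .
  qed
  then show ?thesis by blast
qed

lemma exponential_beats_cube:
  fixes A :: real
  shows "\<exists>r::nat. 1 \<le> r \<and> A * real r ^ 3 + 1 < 2 ^ r"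
proof -
  have "eventually (\<lambda>r::nat. A * real r ^ 3 + 1 < 2 ^ r) sequentially" by real_asymp
  then have "eventually (\<lambda>r::nat. 1 \<le> r \<and> A * real r ^ 3 + 1 < 2 ^ r) sequentially"
    using eventually_ge_at_top[of 1] by eventually_elim simp
  then show ?thesis using eventually_happens by fastforce
qed

lemma (in padic) quadratic_valuations:
  "2 ^ \<nu> - 1 \<le> card (ord ` {x \<in> Qp. x \<noteq> 0 \<and> poly (\<Sum>i<2 ^ \<nu>. monom (of_nat p ^ i\<^sup>2) i) x = 0})"
    (is "_ \<le> card (ord ` ?Z)")
  and quadratic_nonzero: "(\<Sum>i<2 ^ \<nu>. monom (of_nat p ^ i\<^sup>2 :: 'k) i) \<noteq> 0" (is "?f \<noteq> 0")
proof -
  have "coeff ?f 0 = (\<Sum>i<(2::nat) ^ \<nu>. if i = 0 then 1 else 0)"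
    unfolding coeff_sum by (intro sum.cong) auto
  then have "coeff ?f 0 = 1" by simp
  then show "?f \<noteq> 0" by (metis coeff_0 zero_neq_one)
  then have fin: "finite (ord ` ?Z)"
    using poly_roots_finite[of ?f] by (intro finite_imageI) (rule rev_finite_subset, auto)
  have "(\<lambda>m. - (2 * real m + 1)) ` {..<2 ^ \<nu> - 1} \<subseteq> ord ` ?Z"
  proof
    fix y assume "y \<in> (\<lambda>m. - (2 * real m + 1)) ` {..<2 ^ \<nu> - 1 :: nat}"
    then obtain m :: nat where "m < 2 ^ \<nu> - 1" and y: "y = - (2 * real m + 1)" by blast
    then have m: "m + 1 < 2 ^ \<nu>" by linarith
    from quadratic_root[OF m] show "y \<in> ord ` ?Z" unfolding y by force
  qed
  from card_mono[OF fin this] show "2 ^ \<nu> - 1 \<le> card (ord ` ?Z)"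
    by (subst (asm) card_image) (auto simp: inj_on_def)
qed

theorem theorem1p11:
  fixes p :: nat and ord :: "'k::{field_char_0, complete_space} \<Rightarrow> real"
  assumes "prime p" and "complex_padic_field p ord"
    and "\<exists>c::real. c > 0 \<and>
           (\<forall>n\<ge>1. \<forall>A. (\<forall>i<n. finite (A i) \<and> A i \<subseteq> exponents n) \<longrightarrow>
              real (max_vals_Qp n ord A) \<le> real (max_vals_generic n ord A) powr c)"
  shows "\<not> permanent_poly_size_circuits"
proof
  assume "permanent_poly_size_circuits"
  then obtain q :: "real poly" where q: "\<forall>n\<ge>1. \<exists>t. computes t (permanent_poly n) \<and> real (circuit_size t) \<le> poly q (real n)"
    unfolding permanent_poly_size_circuits_def by blast
  obtain c where c: "c > 0" and bound: "\<forall>n\<ge>1. \<forall>A. (\<forall>i<n. finite (A i) \<and> A i \<subseteq> exponents n) \<longrightarrow>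
      real (max_vals_Qp n ord A) \<le> real (max_vals_generic n ord A) powr c"
    using assms(3) by blast
  interpret complex_padic_field p ord by (rule assms(2))
  interpret padic p ord by unfold_locales (rule assms(1))
  \<comment> \<open>For matrices of size n < 2 ^ R, the circuit has size at most 2 ^ S.  As n is polynomial in 2 ^ r, both
      R and S are linear in r, with a factor bounded by K, and \<Delta> is cubic in r.\<close>
  define k where "k = degree q"
  obtain e where e: "\<forall>x\<ge>1. poly q x \<le> 2 ^ e * x ^ k" using poly_le_power unfolding k_def by blast
  define K where "K = e + 3 * k + 6"
  obtain r where r: "1 \<le> r" "26 * c * real (K ^ 3) * real r ^ 3 + 1 < 2 ^ r"
    using exponential_beats_cube[of "26 * c * real (K ^ 3)"] by blast
  define \<nu> :: nat where "\<nu> = 2 ^ r"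
  define n where "n = card (indices \<nu>)"
  have "cell (0, 0) \<in> indices \<nu>" by (simp add: indices_def \<nu>_def)
  then have n1: "1 \<le> n" unfolding n_def using card_gt_0_iff[of "indices \<nu>"] by (auto simp: Suc_le_eq)
  have n_le: "n \<le> 2 ^ (2 * r + 1)"
    using card_indices[of \<nu>] by (simp add: n_def \<nu>_def power_mult[symmetric] mult.commute)
  define R where "R = 2 * r + 2"
  define S where "S = e + k * (2 * r + 1)"
  define \<Delta> where "\<Delta> = 1 + R * ((R + S + 2) * (R + S + 1))"
  have nR: "n < 2 ^ R"
    using n_le by (rule order.strict_trans1) (simp add: R_def)
  obtain t where t: "computes t (permanent_poly n)" "real (circuit_size t) \<le> poly q (real n)"
    using q n1 by blast
  have "real (circuit_size t) \<le> 2 ^ e * real n ^ k" using t(2) e[rule_format, of "real n"] n1 by linarith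
  also have "\<dots> \<le> 2 ^ e * (2 ^ (2 * r + 1)) ^ k"
    using n_le by (intro mult_left_mono power_mono) (auto simp flip: of_nat_le_iff[where 'a = real])
  also have "\<dots> = real (2 ^ S)" by (simp add: S_def power_add power_mult[symmetric] mult.commute)
  finally have size: "circuit_size t \<le> 2 ^ S" by (simp only: of_nat_le_iff)
  have f: "(\<Sum>i<2 ^ \<nu>. monom (of_nat p ^ i\<^sup>2 :: 'k) i) \<in> formulas \<Delta>"
    unfolding \<Delta>_def by (rule quadratic_formula[OF _ t(1)[unfolded n_def] size nR[unfolded n_def]]) simp
  have \<Delta>: "0 < \<Delta>" by (simp add: \<Delta>_def)
  obtain a where a: "2 ^ \<nu> - 1 \<le> max_vals_Qp (2 ^ \<Delta>) ord (tree_support (2 ^ \<Delta>) a)"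
    using many_valuations[OF f quadratic_nonzero \<Delta>] quadratic_valuations[of \<nu>] by (meson order_trans)
  have M1: "1 < (2::nat) ^ \<Delta>" using \<Delta> one_less_power[of "2::nat" \<Delta>] by simp
  have "real (2 ^ \<nu> - 1) \<le> real (max_vals_Qp (2 ^ \<Delta>) ord (tree_support (2 ^ \<Delta>) a))" using a by (simp only: of_nat_le_iff)
  also have "\<dots> \<le> real (max_vals_generic (2 ^ \<Delta>) ord (tree_support (2 ^ \<Delta>) a)) powr c"
    using bound M1 tree_support_exponents[OF M1] by simp
  also have "\<dots> \<le> real (2 * 2050 ^ \<Delta>) powr c"
    using few_generic_valuations[OF \<Delta>] c by (intro powr_mono2) (simp_all only: of_nat_le_iff of_nat_0_le_iff less_imp_le)
  also have "\<dots> \<le> (2 ^ (13 * \<Delta>)) powr c"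
  proof (rule powr_mono2)
    \<comment> \<open>2050 is less than 2 ^ 12.\<close>
    have "2 * 2050 ^ \<Delta> \<le> (2::nat) ^ \<Delta> * (2 ^ 12) ^ \<Delta>"
      by (rule mult_mono) (use \<Delta> M1 in \<open>auto intro: power_mono\<close>)
    also have "\<dots> = (2::nat) ^ (13 * \<Delta>)" by (simp only: power_mult[symmetric] power_add[symmetric]) simp
    finally have "2 * 2050 ^ \<Delta> \<le> (2::nat) ^ (13 * \<Delta>)" .
    from of_nat_mono[OF this, where 'a = real] show "real (2 * 2050 ^ \<Delta>) \<le> 2 ^ (13 * \<Delta>)" by simp
  qed (use c in auto)
  also have "\<dots> = 2 powr (13 * real \<Delta> * c)" by (simp add: powr_realpow[symmetric] powr_powr)
  finally have upper: "real (2 ^ \<nu> - 1) \<le> 2 powr (13 * real \<Delta> * c)" .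
  have "(2::nat) ^ \<nu> = 2 * 2 ^ (\<nu> - 1)" using power_Suc[of "2::nat" "\<nu> - 1"] by (simp add: \<nu>_def del: power_Suc)
  then have "(2::nat) ^ (\<nu> - 1) \<le> 2 ^ \<nu> - 1" using one_le_power[of "2::nat" "\<nu> - 1"] by linarith
  then have "real (2 ^ (\<nu> - 1)) \<le> 2 powr (13 * real \<Delta> * c)" using upper by linarith
  then have "2 powr (real \<nu> - 1) \<le> 2 powr (13 * real \<Delta> * c)"
    by (simp add: powr_realpow[symmetric] of_nat_diff \<nu>_def)
  then have "real \<nu> - 1 \<le> 13 * real \<Delta> * c" by simp
  moreover have "real \<Delta> \<le> 2 * (real (K ^ 3) * real r ^ 3)"
  proof -
    have "R \<le> K * r" "R + S + 2 \<le> K * r" "R + S + 1 \<le> K * r" "1 \<le> K * r"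
      using r(1) unfolding R_def S_def K_def by (cases r; simp add: algebra_simps)+
    then have "\<Delta> \<le> (K * r) * ((K * r) * (K * r)) + (K * r) * ((K * r) * (K * r))"
      unfolding \<Delta>_def by (intro add_mono mult_le_mono) (auto intro: order_trans[OF _ mult_le_mono])
    then have "\<Delta> \<le> 2 * (K ^ 3 * r ^ 3)" by (simp add: power3_eq_cube algebra_simps)
    from of_nat_mono[OF this, where 'a = real] show ?thesis by simp
  qed
  then have "13 * real \<Delta> * c \<le> 13 * (2 * (real (K ^ 3) * real r ^ 3)) * c"
    using c by (intro mult_right_mono mult_left_mono) auto
  ultimately have "real \<nu> \<le> 26 * c * real (K ^ 3) * real r ^ 3 + 1" by (simp add: algebra_simps)
  then show False using r(2) by (simp add: \<nu>_def)
qed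

end
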